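(* Let $D=\prod_{i\in I}D_i$ be a product of feathered Abelian topological groups. Then the subgroup $$\Sigma_{\aleph_1}D=\{x\in PD: |\operatorname{supp}(x)|\le\aleph_1\}$$ of $PD$ is reflexive, and every subgroup $G$ of $PD$ containing $\Sigma_{\aleph_1}D$ is also reflexive (subgroups carry the topology inherited from $PD$).
   Context: Topological groups are assumed Hausdorff. A topological group $G$ is feathered (equivalently, almost metrizable) if it contains a nonempty compact set $K$ with a countable neighbourhood base in $G$. $\mathbb T=\{z\in\mathbb C:|z|=1\}$ is the circle group. For a topological Abelian group $G$, $G^\wedge$ is the group of continuous characters (continuous homomorphisms $G\to\mathbb T$) with the topology of uniform convergence on compact subsets of $G$. $G$ is reflexive if the evaluation homomorphism $\alpha_G:G\to G^{\wedge\wedge}$, $\alpha_G(x)(\chi)=\chi(x)$, is a topological isomorphism of $G$ onto $G^{\wedge\wedge}=(G^\wedge)^\wedge$. For a topological group $H$, $PH$ ($P$-modification) is the same group with the finer group topology whose base consists of all $G_\delta$-sets of $H$. $D=\prod_{i\in I}D_i$ carries the Tychonoff product topology, and $PD$ is the $P$-modification of this product. For $x\in D$, $\operatorname{supp}(x)=\{i\in I: x(i)\ne 0_i\}$, where $0_i$ is the neutral element of $D_i$. *)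

theory Defs
  imports "HOL-Analysis.Analysis" "HOL-Algebra.Product_Groups"
begin

text \<open>Groups are carrier-based and written multiplicatively; a topological group is a group
  record together with a topology on its carrier. Hausdorffness is part of the notion.\<close>

locale topological_abelian_group = comm_group G for G (structure) +
  fixes T :: "'a topology"
  assumes topspace_eq: "topspace T = carrier G"
    and Hausdorff: "Hausdorff_space T"
    and continuous_mult: "continuous_map (prod_topology T T) T (\<lambda>(x, y). x \<otimes> y)"
    and continuous_inv: "continuous_map T T (\<lambda>x. inv x)"

definition feathered :: "'a topology \<Rightarrow> bool" where
  "feathered T \<longleftrightarrow>
     (\<exists>K. K \<noteq> {} \<and> compactin T K \<and>
        (\<exists>\<B>. countable \<B> \<and> (\<forall>U\<in>\<B>. openin T U \<and> K \<subseteq> U) \<and>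
             (\<forall>V. openin T V \<and> K \<subseteq> V \<longrightarrow> (\<exists>U\<in>\<B>. U \<subseteq> V))))"

definition circle_group :: "complex monoid" where
  "circle_group = \<lparr>carrier = sphere 0 1, monoid.mult = (*), one = 1\<rparr>"

definition circle_topology :: "complex topology" where
  "circle_topology = top_of_set (sphere 0 1)"

text \<open>Characters are taken to be extensional, so that distinct elements of the set below are
  distinct as functions on the carrier.\<close>

definition characters :: "('a, 'b) monoid_scheme \<Rightarrow> 'a topology \<Rightarrow> ('a \<Rightarrow> complex) set" where
  "characters G T =
     {\<phi> \<in> extensional (carrier G). \<phi> \<in> hom G circle_group \<and> continuous_map T circle_topology \<phi>}"

definition dual_group :: "('a, 'b) monoid_scheme \<Rightarrow> 'a topology \<Rightarrow> ('a \<Rightarrow> complex) monoid" where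
  "dual_group G T =
     \<lparr>carrier = characters G T,
      monoid.mult = (\<lambda>\<phi> \<psi>. \<lambda>x\<in>carrier G. \<phi> x * \<psi> x),
      one = (\<lambda>x\<in>carrier G. 1)\<rparr>"

text \<open>The topology of uniform convergence on compact sets.\<close>

definition dual_topology :: "('a, 'b) monoid_scheme \<Rightarrow> 'a topology \<Rightarrow> ('a \<Rightarrow> complex) topology" where
  "dual_topology G T = topology (\<lambda>U. U \<subseteq> characters G T \<and>
     (\<forall>\<phi>\<in>U. \<exists>K e. compactin T K \<and> e > 0 \<and>
        {\<psi> \<in> characters G T. \<forall>x\<in>K. dist (\<psi> x) (\<phi> x) < e} \<subseteq> U))"

lemma openin_dual_topology:
  "openin (dual_topology G T) U \<longleftrightarrow> U \<subseteq> characters G T \<and>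
     (\<forall>\<phi>\<in>U. \<exists>K e. compactin T K \<and> e > 0 \<and>
        {\<psi> \<in> characters G T. \<forall>x\<in>K. dist (\<psi> x) (\<phi> x) < e} \<subseteq> U)"
proof -
  let ?N = "\<lambda>K e \<phi>. {\<psi> \<in> characters G T. \<forall>x\<in>K. dist (\<psi> x) (\<phi> x) < e}"
  let ?P = "\<lambda>U. U \<subseteq> characters G T \<and>
     (\<forall>\<phi>\<in>U. \<exists>K (e::real). compactin T K \<and> e > 0 \<and> ?N K e \<phi> \<subseteq> U)"
  have "istopology ?P"
    unfolding istopology_def
  proof (intro conjI allI impI)
    fix A B assume A: "?P A" and B: "?P B"
    show "A \<inter> B \<subseteq> characters G T" using A by blast
    show "\<forall>\<phi>\<in>A \<inter> B. \<exists>K (e::real). compactin T K \<and> e > 0 \<and> ?N K e \<phi> \<subseteq> A \<inter> B"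
    proof
      fix \<phi> assume "\<phi> \<in> A \<inter> B"
      then have "\<phi> \<in> A" "\<phi> \<in> B" by auto
      obtain K e where K: "compactin T K" "(e::real) > 0" "?N K e \<phi> \<subseteq> A"
        using A \<open>\<phi> \<in> A\<close> by blast
      obtain L d where L: "compactin T L" "(d::real) > 0" "?N L d \<phi> \<subseteq> B"
        using B \<open>\<phi> \<in> B\<close> by blast
      have "?N (K \<union> L) (min e d) \<phi> \<subseteq> ?N K e \<phi> \<inter> ?N L d \<phi>"
        by auto
      also have "\<dots> \<subseteq> A \<inter> B"
        using K(3) L(3) by (rule Int_mono)
      finally have "?N (K \<union> L) (min e d) \<phi> \<subseteq> A \<inter> B" .
      moreover have "compactin T (K \<union> L)" "min e d > 0"
        using K L by (simp_all add: compactin_Un)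
      ultimately show "\<exists>K (e::real). compactin T K \<and> e > 0 \<and> ?N K e \<phi> \<subseteq> A \<inter> B"
        by (intro exI conjI)
    qed
  next
    fix \<K> assume H: "\<forall>A\<in>\<K>. ?P A"
    show "\<Union>\<K> \<subseteq> characters G T" using H by blast
    show "\<forall>\<phi>\<in>\<Union>\<K>. \<exists>K (e::real). compactin T K \<and> e > 0 \<and> ?N K e \<phi> \<subseteq> \<Union>\<K>"
    proof
      fix \<phi> assume "\<phi> \<in> \<Union>\<K>"
      then obtain A where "A \<in> \<K>" "\<phi> \<in> A" by blast
      then obtain K e where "compactin T K" "(e::real) > 0" "?N K e \<phi> \<subseteq> A"
        using H by meson
      then show "\<exists>K (e::real). compactin T K \<and> e > 0 \<and> ?N K e \<phi> \<subseteq> \<Union>\<K>"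
        using \<open>A \<in> \<K>\<close> by (meson Union_upper order_trans)
    qed
  qed
  then show ?thesis
    by (simp add: dual_topology_def)
qed

lemma topspace_dual_topology [simp]: "topspace (dual_topology G T) = characters G T"
proof -
  have "openin (dual_topology G T) (characters G T)"
    unfolding openin_dual_topology
    by (metis (no_types, lifting) compactin_empty mem_Collect_eq subsetI zero_less_one)
  then show ?thesis
    by (metis openin_dual_topology openin_subset openin_topspace subset_antisym)
qed

definition evaluation ::
  "('a, 'b) monoid_scheme \<Rightarrow> 'a topology \<Rightarrow> 'a \<Rightarrow> ('a \<Rightarrow> complex) \<Rightarrow> complex" where
  "evaluation G T = (\<lambda>x\<in>carrier G. \<lambda>\<phi>\<in>characters G T. \<phi> x)"

definition reflexive :: "('a, 'b) monoid_scheme \<Rightarrow> 'a topology \<Rightarrow> bool" where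
  "reflexive G T \<longleftrightarrow> topological_abelian_group G T \<and>
     evaluation G T \<in> iso G (dual_group (dual_group G T) (dual_topology G T)) \<and>
     homeomorphic_map T (dual_topology (dual_group G T) (dual_topology G T)) (evaluation G T)"

definition P_modification :: "'a topology \<Rightarrow> 'a topology" where
  "P_modification T = topology (arbitrary union_of gdelta_in T)"

lemma openin_P_modification:
  "openin (P_modification T) = arbitrary union_of gdelta_in T"
  unfolding P_modification_def
  by (rule topology_inverse') (simp add: istopology_base gdelta_in_Int)

lemma topspace_P_modification [simp]: "topspace (P_modification T) = topspace T"
proof -
  have "openin (P_modification T) (topspace T)"
    by (simp add: openin_P_modification arbitrary_union_of_inc)
  moreover have "topspace (P_modification T) \<subseteq> topspace T"
    using openin_topspace[of "P_modification T"]
    by (fastforce simp: openin_P_modification union_of_def dest: gdelta_in_subset)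
  ultimately show ?thesis
    by (meson openin_subset subset_antisym)
qed

definition supp :: "'i set \<Rightarrow> ('i \<Rightarrow> ('a, 'b) monoid_scheme) \<Rightarrow> ('i \<Rightarrow> 'a) \<Rightarrow> 'i set" where
  "supp I D x = {i \<in> I. x i \<noteq> \<one>\<^bsub>D i\<^esub>}"

text \<open>Here \<open>natLeq\<close> represents $\aleph_0$, and hence its cardinal successor $\aleph_1$.\<close>

context includes cardinal_syntax
begin

definition Sigma_aleph1 :: "'i set \<Rightarrow> ('i \<Rightarrow> ('a, 'b) monoid_scheme) \<Rightarrow> ('i \<Rightarrow> 'a) set" where
  "Sigma_aleph1 I D = {x \<in> carrier (product_group I D). |supp I D x| \<le>o cardSuc natLeq}"

end

end

theory Submission
  imports Defs "HOL-Library.Countable_Set_Type"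
begin

text \<open>
  A subgroup \<open>G\<close> of \<open>PD\<close> is a P-group: countable intersections of open sets are open. So its compact
  sets are finite, its dual is topologised pointwise, open subgroups form a base at the identity, and
  characters are the homomorphisms with open kernel. Extension of homomorphisms along subgroups shows
  that continuous characters of the dual are evaluations, and annihilators of open subgroups are
  compact; so the evaluation map is an open bijection. It remains to see that each compact set \<open>C\<close> of
  characters is trivial on a common neighbourhood of the identity.

  If not, recursion over \<open>\<omega>\<^sub>1\<close> yields \<open>ch \<alpha> \<in> C\<close>, points \<open>pt \<alpha>\<close> with \<open>ch \<alpha> (pt \<alpha>)\<close> far from 1, and
  decreasing boxes \<open>N \<alpha>\<close> (compact \<open>G\<^sub>\<delta>\<close>-subgroups in countably many factors, everything elsewhere) such
  that \<open>ch \<alpha>\<close> is trivial on \<open>N \<alpha>\<close> and \<open>pt \<alpha>\<close> lies in all earlier boxes. A cluster point \<open>\<phi> \<in> C\<close> of the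
  \<open>ch \<alpha>\<close> is trivial on a box \<open>N'\<close>. The \<open>N \<alpha>\<close> stabilise modulo \<open>N'\<close>, so for large \<open>\<alpha>\<close> the points can be
  moved into \<open>N'\<close>. Multiplying suitable ones, with limits supplied by compactness, gives \<open>y \<in> N'\<close> of
  support at most \<open>\<aleph>\<^sub>1\<close> with all \<open>ch \<alpha> y\<close> far from 1, although \<open>\<phi> y = 1\<close>.
\<close>

section \<open>Estimates on the unit circle\<close>

text \<open>The circle enters in two ways. It is divisible, so homomorphisms into it extend from
  subgroups without any topology. It has no small subgroups, so a value whose powers all stay within
  distance 1 of 1 is itself 1; hence some power of any nontrivial value is at distance at least 1,
  and 1 is the threshold throughout. The length of the recursion is forced from both sides.
  Countable initial segments let the earlier boxes meet in an open set. The whole index set must be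
  uncountable, so that countably many bad stages can be discarded. It must not exceed
  \<open>\<aleph>\<^sub>1\<close>, because the only points known to lie in \<open>G\<close> are
  those of the \<Sigma>-product. Featheredness supplies compact subgroups inside every
  \<open>G\<^sub>\<delta>\<close>-neighbourhood of the identity in a factor, and limit points are
  found coordinate by coordinate from that compactness. The cluster point is trivial only on its own
  box \<open>N'\<close>, which is unrelated to the boxes of the recursion; hence the points must be
  moved into \<open>N'\<close> before they are multiplied. A product may spoil a single value, but
  if \<open>q\<close> is moved by at least 1, then \<open>v\<close> or \<open>v * q\<close> is moved
  by at least 1/2.\<close>

lemma circle_group_simps [simp]:
  "carrier circle_group = sphere 0 1" "x \<otimes>\<^bsub>circle_group\<^esub> y = x * y" "\<one>\<^bsub>circle_group\<^esub> = 1"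
  by (simp_all add: circle_group_def)

lemma comm_group_circle: "comm_group circle_group"
proof (rule comm_groupI)
  fix x assume "x \<in> carrier circle_group"
  then show "\<exists>y\<in>carrier circle_group. y \<otimes>\<^bsub>circle_group\<^esub> x = \<one>\<^bsub>circle_group\<^esub>"
    by (intro bexI[of _ "inverse x"]) (auto simp: norm_inverse intro!: left_inverse)
qed (auto simp: norm_mult mult_ac)

text \<open>Squaring multiplies the distance to 1 by |w + 1|, and |w - 1| < 1 forces Re w > 1/2, so
  this factor is at least 3/2.\<close>

lemma dist_one_double:
  fixes w :: complex
  assumes "norm w = 1" "dist w 1 < 1"
  shows "dist w 1 \<le> 2/3 * dist (w^2) 1"
proof -
  have sq: "(Re w)\<^sup>2 + (Im w)\<^sup>2 = 1"
    using assms(1) by (metis cmod_power2 one_power2)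
  have "(Re w - 1)\<^sup>2 + (Im w)\<^sup>2 < 1"
    using assms(2) unfolding dist_norm cmod_def by (simp add: real_sqrt_less_iff)
  then have "Re w > 1/2"
    using sq by (simp add: power2_eq_square algebra_simps)
  then have "3/2 \<le> norm (w + 1)"
    using complex_Re_le_cmod[of "w + 1"] by simp
  moreover have "dist (w^2) 1 = norm (w - 1) * norm (w + 1)"
    by (simp add: dist_norm norm_mult[symmetric] power2_eq_square algebra_simps)
  ultimately have "dist (w^2) 1 \<ge> norm (w - 1) * (3/2)"
    by (metis mult_left_mono norm_ge_zero)
  then show ?thesis by (simp add: dist_norm)
qed

text \<open>Each squaring that stays inside the unit ball about 1 gains a factor 3/2; the final 2 is
  the diameter of the circle.\<close>

lemma dist_one_doubling:
  fixes w :: complex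
  assumes "norm w = 1" "\<And>j. j < n \<Longrightarrow> dist (w ^ (2 ^ j)) 1 < 1"
  shows "dist w 1 \<le> (2/3) ^ n * 2"
  using assms
proof (induction n arbitrary: w)
  case 0
  have "dist w 1 \<le> norm w + norm (1::complex)"
    unfolding dist_norm by (rule norm_triangle_ineq4)
  with 0 show ?case by simp
next
  case (Suc n)
  have "dist (w^2) 1 \<le> (2/3) ^ n * 2"
  proof (rule Suc.IH)
    show "norm (w\<^sup>2) = 1" using Suc.prems by (simp add: norm_power)
    fix j assume "j < n"
    then show "dist ((w\<^sup>2) ^ 2 ^ j) 1 < 1"
      using Suc.prems(2)[of "Suc j"] by (simp add: power_mult)
  qed
  moreover have "dist w 1 \<le> 2/3 * dist (w^2) 1"
    using Suc.prems(2)[of 0] Suc.prems(1) by (intro dist_one_double) auto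
  ultimately show ?case by simp
qed

lemma no_small_subgroup:
  fixes w :: complex
  assumes "norm w = 1" "\<And>n::nat. dist (w ^ n) 1 < 1"
  shows "w = 1"
proof (rule ccontr)
  assume "w \<noteq> 1"
  then have "dist w 1 / 2 > 0" by simp
  then obtain n where "(2/3::real) ^ n < dist w 1 / 2"
    using real_arch_pow_inv[of "dist w 1 / 2" "2/3"] by auto
  with dist_one_doubling[of w n] assms show False by auto
qed

lemma dist_mult_circle:
  fixes a b c d :: complex
  assumes "norm a = 1" "norm d = 1"
  shows "dist (a * b) (c * d) \<le> dist a c + dist b d"
proof -
  have "a * b - c * d = a * (b - d) + (a - c) * d" by (simp add: algebra_simps)
  then have "norm (a * b - c * d) \<le> norm (a * (b - d)) + norm ((a - c) * d)"
    by (metis norm_triangle_ineq)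
  then show ?thesis using assms by (simp add: dist_norm norm_mult)
qed

lemma dist_power_circle:
  fixes w :: complex
  assumes "norm w = 1"
  shows "dist (w ^ n) 1 \<le> n * dist w 1"
proof (induction n)
  case (Suc n)
  have "dist (w * w ^ n) (1 * 1) \<le> dist w 1 + dist (w ^ n) 1"
    using assms by (intro dist_mult_circle) auto
  with Suc show ?case by (simp add: algebra_simps)
qed simp

lemma dist_inverse_circle:
  fixes w :: complex
  assumes "norm w = 1"
  shows "dist (inverse w) 1 = dist w 1"
proof -
  have "w \<noteq> 0" using assms by auto
  then have "inverse w - 1 = inverse w * (1 - w)" by (simp add: field_simps)
  then have "norm (inverse w - 1) = norm (1 - w)"
    using assms by (simp add: norm_mult norm_inverse)
  then show ?thesis by (simp add: dist_norm norm_minus_commute)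
qed

text \<open>The principal root \<open>cis (t / m)\<close> with \<open>t = Arg v\<close> works: the
  chord from 1 to \<open>cis s\<close> has length 2 |sin (s/2)|, which increases with |s| up to
  pi.\<close>

lemma root_near_one:
  fixes v :: complex
  assumes "norm v = 1" "m > 0"
  shows "\<exists>u. norm u = 1 \<and> u ^ m = v \<and> dist u 1 \<le> dist v 1"
proof -
  define t where "t = Arg v"
  have v: "v = cis t" using assms(1) by (metis rcis_cmod_Arg rcis_def t_def mult_1 of_real_1)
  have t: "-pi < t" "t \<le> pi" using Arg_bounded t_def by auto
  have d: "dist (cis s) 1 = 2 * \<bar>sin (s/2)\<bar>" for s
  proof -
    have "(dist (cis s) 1)\<^sup>2 = (cos s - 1)\<^sup>2 + (sin s)\<^sup>2"
      by (simp add: dist_norm cmod_power2)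
    also have "\<dots> = 2 - 2 * cos (2 * (s/2))"
      using sin_cos_squared_add[of s] by (simp add: power2_eq_square algebra_simps)
    also have "\<dots> = (2 * \<bar>sin (s/2)\<bar>)\<^sup>2"
      unfolding cos_double_sin by (simp add: power2_eq_square)
    finally show ?thesis by (metis power2_eq_imp_eq abs_ge_zero zero_le_dist mult_nonneg_nonneg zero_le_numeral)
  qed
  have mono: "\<bar>sin x\<bar> \<le> \<bar>sin y\<bar>" if "\<bar>x\<bar> \<le> \<bar>y\<bar>" "\<bar>y\<bar> \<le> pi/2" for x y :: real
  proof -
    have "\<bar>sin z\<bar> = sin \<bar>z\<bar>" if "\<bar>z\<bar> \<le> pi/2" for z :: real
    proof -
      have "0 \<le> sin \<bar>z\<bar>" using that by (intro sin_ge_zero) auto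
      then show ?thesis by (auto simp: abs_if split: if_splits)
    qed
    moreover have "sin \<bar>x\<bar> \<le> sin \<bar>y\<bar>" using that by (intro sin_monotone_2pi_le) auto
    ultimately show ?thesis using that by simp
  qed
  have "\<bar>t / m\<bar> \<le> \<bar>t\<bar>"
    using assms(2) by (simp add: abs_divide divide_le_eq mult_le_cancel_left1)
  then have "\<bar>t / m / 2\<bar> \<le> \<bar>t / 2\<bar>" by simp
  moreover have "\<bar>t / 2\<bar> \<le> pi / 2" using t by auto
  ultimately have "dist (cis (t / m)) 1 \<le> dist v 1"
    unfolding v d using mono by simp
  moreover have "cis (t / m) ^ m = v"
    unfolding v Complex.DeMoivre using assms(2) by (simp del: of_nat_Suc)
  ultimately show ?thesis by (intro exI[of _ "cis (t/m)"]) simp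
qed

lemma real_additive_continuous_linear:
  fixes h :: "real \<Rightarrow> real"
  assumes add: "\<And>x y. h (x + y) = h x + h y" and cont: "continuous_on UNIV h"
  shows "h t = t * h 1"
proof -
  have nat: "h (real n * x) = n * h x" for n x
  proof (induction n)
    case 0 show ?case using add[of 0 0] by simp
  next
    case (Suc n) then show ?case using add[of x "n * x"] by (simp add: algebra_simps)
  qed
  have neg: "h (-x) = - h x" for x
    using add[of x "-x"] add[of 0 0] by simp
  have int: "h (of_int k * x) = k * h x" for k x
    using nat[of "nat k" x] nat[of "nat (-k)" x] neg[of "of_int k * x"]
    by (cases "k \<ge> 0") auto
  have rat: "h x = x * h 1" if "x \<in> \<rat>" for x
  proof -
    obtain a b :: int where ab: "b > 0" "coprime a b" "x = of_int a / of_int b"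
      by (rule Rats_cases'[OF \<open>x \<in> \<rat>\<close>])
    have "b * h x = h (of_int b * x)" by (simp add: int)
    also have "\<dots> = h (of_int a * 1)" using ab by simp
    also have "\<dots> = a * h 1" by (simp only: int)
    finally have "h x = (a / b) * h 1" using ab(1) by (simp add: field_simps)
    then show ?thesis using ab(3) by simp
  qed
  have "closure (\<rat>::real set) \<subseteq> {x. h x = x * h 1}"
  proof (rule closure_minimal)
    show "closed {x. h x = x * h 1}"
      by (intro closed_Collect_eq cont continuous_intros)
    show "\<rat> \<subseteq> {x. h x = x * h 1}" using rat by blast
  qed
  then show ?thesis by (auto simp: Rats_closure_real)
qed

text \<open>Lift \<psi> along \<open>cis\<close> to a continuous real function \<open>h\<close>. Its
  defect of additivity, divided by 2 pi, is continuous and integer valued, hence constant, so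
  \<open>h\<close> is additive and therefore linear. The period 2 pi of \<open>cis\<close> makes the
  slope an integer.\<close>

lemma hom_circle_power:
  fixes \<psi> :: "complex \<Rightarrow> complex"
  assumes norm: "\<And>z. norm z = 1 \<Longrightarrow> norm (\<psi> z) = 1"
    and mult: "\<And>z w. norm z = 1 \<Longrightarrow> norm w = 1 \<Longrightarrow> \<psi> (z * w) = \<psi> z * \<psi> w"
    and cont: "\<And>e. e > 0 \<Longrightarrow> \<exists>d>0. \<forall>z. norm z = 1 \<and> dist z 1 < d \<longrightarrow> dist (\<psi> z) 1 < e"
  shows "\<exists>k::int. \<forall>z. norm z = 1 \<longrightarrow> \<psi> z = z powi k"
proof -
  define f where "f t = \<psi> (cis t)" for t
  have f_add: "f (s + t) = f s * f t" for s t
    unfolding f_def by (simp flip: cis_mult add: mult)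
  have f_norm: "norm (f t) = 1" for t
    unfolding f_def by (simp add: norm)
  have f0: "f 0 = 1"
    using f_add[of 0 0] f_norm[of 0] by auto
  have "continuous_on UNIV f"
    unfolding continuous_on_iff
  proof (intro ballI allI impI)
    fix t e :: real assume "e > 0"
    then obtain d where d: "d > 0" "\<And>z. norm z = 1 \<Longrightarrow> dist z 1 < d \<Longrightarrow> dist (\<psi> z) 1 < e"
      using cont by meson
    have "continuous_on UNIV cis" by (intro continuous_intros)
    then obtain d' where d': "d' > 0" "\<And>s. dist s 0 < d' \<Longrightarrow> dist (cis s) (cis 0) < d"
      using d(1) unfolding continuous_on_iff by (metis UNIV_I)
    show "\<exists>d>0. \<forall>s\<in>UNIV. dist s t < d \<longrightarrow> dist (f s) (f t) < e"
    proof (intro exI conjI ballI impI)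
      fix s assume "dist s t < d'"
      then have "dist (f (s - t)) 1 < e"
        using d(2)[of "cis (s - t)"] d'(2)[of "s - t"] by (auto simp: f_def dist_norm)
      moreover have "f s - f t = f t * (f (s - t) - 1)"
        using f_add[of t "s - t"] by (simp add: algebra_simps)
      ultimately show "dist (f s) (f t) < e"
        using f_norm[of t] by (simp add: dist_norm norm_mult)
    qed (use d' in auto)
  qed
  then obtain g where g: "continuous_on UNIV g" "\<And>x. f x = exp (g x)"
    using continuous_logarithm_on_contractible[of UNIV f] f_norm
    by (metis UNIV_I convex_UNIV convex_imp_contractible norm_zero zero_neq_one)
  define h where "h t = Im (g t) - Im (g 0)" for t
  have Re: "Re (g t) = 0" for t
    using f_norm[of t] by (simp add: g)
  have fh: "f t = cis (h t)" for t
  proof -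
    have "f t = f t / f 0" by (simp add: f0)
    also have "\<dots> = exp (g t - g 0)" by (simp add: g exp_diff)
    also have "g t - g 0 = \<i> * of_real (h t)" by (auto simp: complex_eq_iff Re h_def)
    finally show ?thesis by (simp add: cis_conv_exp)
  qed
  have h_cont: "continuous_on UNIV h"
    unfolding h_def by (intro continuous_intros g)
  have h_add: "h (s + t) = h s + h t" for s t
  proof -
    define q where "q s = (h (s + t) - h s - h t) / (2 * pi)" for s
    have "q constant_on (UNIV::real set)"
    proof (rule continuous_discrete_range_constant)
      show "connected (UNIV::real set)" by simp
      show "continuous_on UNIV q"
        unfolding q_def
        by (intro continuous_intros continuous_on_compose2[OF h_cont] h_cont) auto
      have "q s \<in> \<int>" for s
      proof -
        have "cis (h (s + t) - h s - h t) = 1"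
          using f_add[of s t] by (simp add: fh flip: cis_divide cis_mult)
        then have "cos (h (s + t) - h s - h t) = 1" by (metis cis.sel(1) one_complex.sel(1))
        then obtain n::int where "h (s + t) - h s - h t = real_of_int n * 2 * pi"
          unfolding cos_one_2pi_int by (rule exE)
        then show ?thesis by (simp add: q_def)
      qed
      then have *: "q x \<noteq> q y \<Longrightarrow> norm (q y - q x) \<ge> 1" for x y
        by (metis Ints_diff Ints_nonzero_abs_ge1 real_norm_def right_minus_eq)
      show "\<exists>e>0. \<forall>y. y \<in> UNIV \<and> q y \<noteq> q x \<longrightarrow> e \<le> norm (q y - q x)" for x
        using * by (intro exI[of _ 1]) fastforce
    qed
    then have "q s = q 0" by (metis UNIV_I constant_on_def)
    then show ?thesis by (simp add: q_def h_def)
  qed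
  have lin: "h t = t * h 1" for t
    by (rule real_additive_continuous_linear[OF h_add h_cont])
  have "cis (2 * pi * h 1) = 1"
  proof -
    have "cis (h (2 * pi)) = f 0" unfolding fh[symmetric] f_def by simp
    then show ?thesis by (simp add: f0 lin[of "2*pi"])
  qed
  then have "cos (2 * pi * h 1) = 1" by (metis cis.sel(1) one_complex.sel(1))
  then obtain n::int where "2 * pi * h 1 = real_of_int n * 2 * pi"
    unfolding cos_one_2pi_int by (rule exE)
  then have n: "h 1 = n" by simp
  have "\<psi> z = z powi n" if "norm z = 1" for z
  proof -
    have z: "z = cis (Arg z)" using that by (metis rcis_cmod_Arg rcis_def mult_1 of_real_1)
    have "\<psi> z = f (Arg z)" by (subst z) (simp add: f_def)
    also have "\<dots> = cis (of_int n * Arg z)" by (simp add: fh lin[of "Arg z"] n mult.commute)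
    also have "\<dots> = z powi n" by (subst (2) z) (simp add: cis_power_int)
    finally show ?thesis .
  qed
  then show ?thesis by blast
qed

lemma root_unity_eq_power:
  fixes w :: complex
  assumes "w ^ m = 1" "m > 0"
  shows "\<exists>j::nat. w = cis (2 * pi / m) ^ j"
proof -
  obtain j where "w = cis (2 * pi * real j / real m)"
    using assms Complex.bij_betw_roots_unity[OF assms(2)] unfolding bij_betw_def by blast
  then show ?thesis by (intro exI[of _ j]) (simp add: Complex.DeMoivre mult_ac)
qed

section \<open>Homomorphisms into the circle\<close>

lemma circle_nat_pow: "x [^]\<^bsub>circle_group\<^esub> (n::nat) = x ^ n"
  by (induction n) (simp_all add: nat_pow_def mult.commute)

lemma circle_inv: "norm x = 1 \<Longrightarrow> inv\<^bsub>circle_group\<^esub> x = inverse x"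
  by (intro group.inv_equality comm_group.axioms(2) comm_group_circle)
     (auto simp: norm_inverse intro!: left_inverse)

lemma circle_int_pow: "norm x = 1 \<Longrightarrow> x [^]\<^bsub>circle_group\<^esub> (k::int) = x powi k"
  by (auto simp: int_pow_def2 circle_nat_pow circle_inv power_int_def norm_power simp flip: power_inverse)

lemma group_circle: "group circle_group"
  using comm_group_circle by (rule comm_group.axioms)

context group
begin

lemma hom_circle_norm: "\<phi> \<in> hom G circle_group \<Longrightarrow> x \<in> carrier G \<Longrightarrow> norm (\<phi> x) = 1"
  by (auto simp: hom_def)

lemma hom_circle_mult:
  "\<phi> \<in> hom G circle_group \<Longrightarrow> x \<in> carrier G \<Longrightarrow> y \<in> carrier G \<Longrightarrow> \<phi> (x \<otimes> y) = \<phi> x * \<phi> y"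
  by (auto simp: hom_def)

lemma hom_circle_one: "\<phi> \<in> hom G circle_group \<Longrightarrow> \<phi> \<one> = 1"
  using hom_one[OF _ is_group group_circle] by simp

lemma hom_circle_nat_pow:
  "\<phi> \<in> hom G circle_group \<Longrightarrow> x \<in> carrier G \<Longrightarrow> \<phi> (x [^] (n::nat)) = \<phi> x ^ n"
  using hom_nat_pow[OF _ _ is_group group_circle] by (simp add: circle_nat_pow)

lemma hom_circle_int_pow:
  "\<phi> \<in> hom G circle_group \<Longrightarrow> x \<in> carrier G \<Longrightarrow> \<phi> (x [^] (k::int)) = \<phi> x powi k"
  using hom_int_pow[OF _ _ is_group group_circle, of \<phi> x k]
  by (simp add: circle_int_pow hom_circle_norm)

lemma hom_circle_inv:
  "\<phi> \<in> hom G circle_group \<Longrightarrow> x \<in> carrier G \<Longrightarrow> \<phi> (inv x) = inverse (\<phi> x)"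
  using hom_circle_int_pow[of \<phi> x "-1"] int_pow_neg[of x 1] by simp

lemma int_pow_DirProd_circle:
  assumes "y \<in> carrier G" "norm u = 1"
  shows "(y, u) [^]\<^bsub>G \<times>\<times> circle_group\<^esub> (k::int) = (y [^] k, u powi k)"
proof -
  have P: "group (G \<times>\<times> circle_group)" using is_group group_circle by (rule DirProd_group)
  have *: "fst \<in> hom (G \<times>\<times> circle_group) G" "snd \<in> hom (G \<times>\<times> circle_group) circle_group"
    by (auto simp: hom_def DirProd_def)
  have yu: "(y, u) \<in> carrier (G \<times>\<times> circle_group)" using assms by (simp add: DirProd_def)
  have "fst ((y, u) [^]\<^bsub>G \<times>\<times> circle_group\<^esub> k) = y [^] k"
    using hom_int_pow[OF *(1) yu P is_group] by simp
  moreover have "snd ((y, u) [^]\<^bsub>G \<times>\<times> circle_group\<^esub> k) = u powi k"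
    using hom_int_pow[OF *(2) yu P group_circle] assms by (simp add: circle_int_pow)
  ultimately show ?thesis by (metis prod.collapse)
qed

end

text \<open>The generator is the least positive element. With \<open>m = 0\<close> the divisibility
  form also covers the trivial subgroup, so the exponents \<open>k\<close> for which a power of an
  element lies in a subgroup need no case distinction here.\<close>

lemma int_subgroup_principal:
  fixes S :: "int set"
  assumes "0 \<in> S" and diff: "\<And>j k. j \<in> S \<Longrightarrow> k \<in> S \<Longrightarrow> j - k \<in> S"
  shows "\<exists>m::nat. \<forall>k. k \<in> S \<longleftrightarrow> int m dvd k"
proof -
  have minus: "- k \<in> S" if "k \<in> S" for k using diff[OF assms(1) that] by simp
  have plus: "j + k \<in> S" if "j \<in> S" "k \<in> S" for j k using diff[OF that(1) minus[OF that(2)]] by simp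
  have mult_nat: "k * int n \<in> S" if "k \<in> S" for k and n :: nat
    by (induction n) (use assms(1) that plus in \<open>auto simp: algebra_simps\<close>)
  have mult: "k * n \<in> S" if "k \<in> S" for k n
    using mult_nat[OF that, of "nat n"] minus[OF mult_nat[OF that, of "nat (-n)"]]
    by (cases "n \<ge> 0") auto
  show ?thesis
  proof (cases "\<exists>m::nat. m > 0 \<and> int m \<in> S")
    case False
    have "k = 0" if "k \<in> S" for k
    proof (rule ccontr)
      assume "k \<noteq> 0"
      then have "0 < nat \<bar>k\<bar>" "int (nat \<bar>k\<bar>) \<in> S" using that minus by (auto simp: abs_if)
      with False show False by blast
    qed
    then show ?thesis using assms(1) by (intro exI[of _ 0]) auto
  next
    case True
    define m where "m = (LEAST m::nat. m > 0 \<and> int m \<in> S)"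
    have m: "m > 0" "int m \<in> S" using LeastI_ex[OF True] unfolding m_def by auto
    have "int m dvd k" if "k \<in> S" for k
    proof -
      have "k mod int m = k - int m * (k div int m)" by (simp add: minus_mult_div_eq_mod)
      then have "k mod int m \<in> S" using diff[OF that mult[OF m(2)]] by simp
      moreover have "0 \<le> k mod int m" "k mod int m < int m" using m by auto
      ultimately have "\<not> 0 < nat (k mod int m)"
        using not_less_Least[of "nat (k mod int m)" "\<lambda>m. m > 0 \<and> int m \<in> S"]
        unfolding m_def[symmetric] by auto
      then show ?thesis using \<open>0 \<le> k mod int m\<close> by (auto simp: dvd_eq_mod_eq_0)
    qed
    then show ?thesis using mult[OF m(2)] by (intro exI[of _ m]) (auto elim!: dvdE)
  qed
qed

context comm_group
begin

text \<open>Partial homomorphisms into the circle are handled through their graphs: single-valued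
  subgroups of \<open>G \<times>\<times> circle_group\<close>.\<close>

definition circle_graph :: "('a \<times> complex) set \<Rightarrow> bool" where
  "circle_graph \<Gamma> \<longleftrightarrow> subgroup \<Gamma> (G \<times>\<times> circle_group) \<and> (\<forall>w. (\<one>, w) \<in> \<Gamma> \<longrightarrow> w = 1)"

lemma circle_graph_subgroup: "circle_graph \<Gamma> \<Longrightarrow> subgroup \<Gamma> (G \<times>\<times> circle_group)"
  by (simp only: circle_graph_def)

lemma circle_graph_unit: "circle_graph \<Gamma> \<Longrightarrow> (\<one>, w) \<in> \<Gamma> \<Longrightarrow> w = 1"
  unfolding circle_graph_def by (elim conjE allE impE)

lemma circle_graph_one:
  assumes "circle_graph \<Gamma>"
  shows "(\<one>, 1) \<in> \<Gamma>"
  using subgroup.one_closed[OF circle_graph_subgroup[OF assms]] by (simp add: DirProd_def)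

lemma circle_graph_mem:
  assumes "circle_graph \<Gamma>" "(g, w) \<in> \<Gamma>"
  shows "g \<in> carrier G \<and> norm w = 1"
  using subgroup.mem_carrier[OF circle_graph_subgroup[OF assms(1)] assms(2)] by (simp add: DirProd_def)

lemma circle_graph_mult:
  assumes "circle_graph \<Gamma>" "(g, w) \<in> \<Gamma>" "(h, v) \<in> \<Gamma>"
  shows "(g \<otimes> h, w * v) \<in> \<Gamma>"
  using subgroup.m_closed[OF circle_graph_subgroup[OF assms(1)] assms(2,3)] by (simp add: DirProd_def)

lemma circle_graph_int_pow:
  fixes k :: int
  assumes "circle_graph \<Gamma>" "(g, w) \<in> \<Gamma>"
  shows "(g [^] k, w powi k) \<in> \<Gamma>"
proof -
  have "(g, w) [^]\<^bsub>G \<times>\<times> circle_group\<^esub> k \<in> \<Gamma>"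
    by (rule group.subgroup_int_pow_closed[OF DirProd_group[OF is_group group_circle]
          circle_graph_subgroup[OF assms(1)] assms(2)])
  then show ?thesis
    using circle_graph_mem[OF assms] int_pow_DirProd_circle by simp
qed

lemmas circle_graph_closed = circle_graph_one circle_graph_mem circle_graph_mult circle_graph_int_pow

lemma circle_graphI:
  assumes "\<And>g w. (g, w) \<in> \<Gamma> \<Longrightarrow> g \<in> carrier G \<and> norm w = 1" "(\<one>, 1) \<in> \<Gamma>"
    and "\<And>g w h v. (g, w) \<in> \<Gamma> \<Longrightarrow> (h, v) \<in> \<Gamma> \<Longrightarrow> (g \<otimes> h, w * v) \<in> \<Gamma>"
    and "\<And>g w. (g, w) \<in> \<Gamma> \<Longrightarrow> (inv g, inverse w) \<in> \<Gamma>"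
    and "\<And>w. (\<one>, w) \<in> \<Gamma> \<Longrightarrow> w = 1"
  shows "circle_graph \<Gamma>"
  unfolding circle_graph_def
proof (intro conjI group.subgroupI DirProd_group group_circle is_group)
  show "inv\<^bsub>G \<times>\<times> circle_group\<^esub> a \<in> \<Gamma>" if "a \<in> \<Gamma>" for a
  proof -
    obtain g w where a: "a = (g, w)" by force
    then have "g \<in> carrier G" "norm w = 1" using assms(1) that by auto
    then have "inv\<^bsub>G \<times>\<times> circle_group\<^esub> (g, w) = (inv g, inverse w)"
      using inv_DirProd[OF is_group group_circle] by (simp add: circle_inv)
    then show ?thesis using assms(4) that a by simp
  qed
qed (use assms in \<open>auto simp: DirProd_def\<close>)

text \<open>The quotient of the two pairs lies over the identity. This is why single-valuedness at
  the identity suffices in \<open>circle_graph\<close>.\<close>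

lemma circle_graph_functional:
  assumes "circle_graph \<Gamma>" "(g, w) \<in> \<Gamma>" "(g, v) \<in> \<Gamma>"
  shows "w = v"
proof -
  note c = circle_graph_closed[OF assms(1)]
  have gv: "g \<in> carrier G" "norm v = 1" using c(2) assms(3) by auto
  have "(g \<otimes> g [^] (-1::int), w * v powi (-1)) \<in> \<Gamma>"
    using c(3)[OF assms(2) c(4)[OF assms(3)]] .
  then have "(\<one>, w * inverse v) \<in> \<Gamma>"
    using gv int_pow_neg[of g 1] by simp
  then have "w * inverse v = 1" using circle_graph_unit[OF assms(1)] by blast
  moreover have "v \<noteq> 0" using gv by auto
  ultimately show ?thesis by (simp add: field_simps)
qed

text \<open>Multiply the graph by the powers of \<open>(y, u)\<close>. The result stays
  single-valued because an element over the identity arises from some \<open>g1\<close> equal to a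
  power of \<open>y\<close>, whose value \<open>compat\<close> prescribes.\<close>

lemma circle_graph_extend:
  assumes \<Gamma>: "circle_graph \<Gamma>" and y: "y \<in> carrier G" and u: "norm u = 1"
    and compat: "\<And>k::int. \<And>w. (y [^] k, w) \<in> \<Gamma> \<Longrightarrow> w = u powi k"
  shows "\<exists>\<Gamma>'. circle_graph \<Gamma>' \<and> \<Gamma> \<subseteq> \<Gamma>' \<and> (y, u) \<in> \<Gamma>'"
proof -
  note c = circle_graph_closed[OF \<Gamma>]
  have u0: "u \<noteq> 0" using u by auto
  define \<Gamma>' where "\<Gamma>' = {(g \<otimes> y [^] k, w * u powi k) | g w (k::int). (g, w) \<in> \<Gamma>}"
  have "circle_graph \<Gamma>'"
  proof (rule circle_graphI)
    show "g \<in> carrier G \<and> norm w = 1" if "(g, w) \<in> \<Gamma>'" for g w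
      using that c(2) y u by (auto simp: \<Gamma>'_def norm_mult norm_power_int)
    show "(\<one>, 1) \<in> \<Gamma>'"
      unfolding \<Gamma>'_def using c(1) by (force intro: exI[of _ 0])
    fix g w h v assume "(g, w) \<in> \<Gamma>'" "(h, v) \<in> \<Gamma>'"
    then obtain g1 w1 k1 h1 v1 k2 where *: "(g1, w1) \<in> \<Gamma>" "g = g1 \<otimes> y [^] (k1::int)" "w = w1 * u powi k1"
      "(h1, v1) \<in> \<Gamma>" "h = h1 \<otimes> y [^] (k2::int)" "v = v1 * u powi k2"
      unfolding \<Gamma>'_def by auto
    have "(g1 \<otimes> h1, w1 * v1) \<in> \<Gamma>" using c(3) * by blast
    moreover have "g \<otimes> h = (g1 \<otimes> h1) \<otimes> y [^] (k1 + k2)"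
      using * y c(2) by (simp add: int_pow_mult m_ac)
    moreover have "w * v = w1 * v1 * u powi (k1 + k2)"
      using * u0 by (simp add: power_int_add)
    ultimately show "(g \<otimes> h, w * v) \<in> \<Gamma>'" unfolding \<Gamma>'_def by blast
  next
    fix g w assume "(g, w) \<in> \<Gamma>'"
    then obtain g1 w1 k1 where *: "(g1, w1) \<in> \<Gamma>" "g = g1 \<otimes> y [^] (k1::int)" "w = w1 * u powi k1"
      unfolding \<Gamma>'_def by auto
    have "(inv g1, inverse w1) \<in> \<Gamma>" using c(4)[OF *(1), of "-1"] c(2)[OF *(1)] int_pow_neg[of g1 1] by simp
    moreover have "inv g = inv g1 \<otimes> y [^] (- k1)"
      using * y c(2) by (simp add: int_pow_neg inv_mult)
    moreover have "inverse w = inverse w1 * u powi (- k1)"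
      using * u0 by (simp add: power_int_minus)
    ultimately show "(inv g, inverse w) \<in> \<Gamma>'" unfolding \<Gamma>'_def by blast
  next
    fix w assume "(\<one>, w) \<in> \<Gamma>'"
    then obtain g1 w1 k1 where *: "(g1, w1) \<in> \<Gamma>" "\<one> = g1 \<otimes> y [^] (k1::int)" "w = w1 * u powi k1"
      unfolding \<Gamma>'_def by auto
    then have "g1 = y [^] (- k1)" using y c(2)
      by (metis int_pow_closed int_pow_neg inv_equality inv_inv)
    then have "w1 = u powi (- k1)" using compat * by blast
    then show "w = 1" using * u0 by (simp add: power_int_minus)
  qed
  moreover have "\<Gamma> \<subseteq> \<Gamma>'"
  proof
    fix p assume "p \<in> \<Gamma>"
    moreover obtain g w where "p = (g, w)" by force
    ultimately show "p \<in> \<Gamma>'" unfolding \<Gamma>'_def using c(2) by (auto intro!: exI[of _ g] exI[of _ w] exI[of _ "0::int"])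
  qed
  moreover have "(y, u) \<in> \<Gamma>'"
    unfolding \<Gamma>'_def using c(1) y by (auto intro!: exI[of _ \<one>] exI[of _ "1::complex"] exI[of _ "1::int"])
  ultimately show ?thesis by blast
qed

text \<open>Divisibility of the circle: the powers of \<open>y\<close> in the domain are those with
  exponent in m Z, so any m-th root of the value at the m-th power of \<open>y\<close> is
  compatible. If \<open>m = 0\<close> there is no constraint and 1 is chosen.\<close>

lemma circle_graph_compatible_value:
  assumes \<Gamma>: "circle_graph \<Gamma>" and y: "y \<in> carrier G"
  shows "\<exists>u. norm u = 1 \<and> (\<forall>(k::int) w. (y [^] k, w) \<in> \<Gamma> \<longrightarrow> w = u powi k)"
proof -
  note c = circle_graph_closed[OF \<Gamma>]
  define S where "S = {k::int. \<exists>v. (y [^] k, v) \<in> \<Gamma>}"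
  have "\<exists>m::nat. \<forall>k. k \<in> S \<longleftrightarrow> int m dvd k"
  proof (rule int_subgroup_principal)
    show "0 \<in> S" using c(1) by (auto simp: S_def)
    fix j k assume "j \<in> S" "k \<in> S"
    then obtain v w where "(y [^] j, v) \<in> \<Gamma>" "(y [^] k, w) \<in> \<Gamma>" by (auto simp: S_def)
    then have "(y [^] j \<otimes> (y [^] k) [^] (-1::int), v * w powi (-1)) \<in> \<Gamma>"
      using c(3,4) by blast
    moreover have "y [^] j \<otimes> (y [^] k) [^] (-1::int) = y [^] (j - k)"
      using y by (simp add: int_pow_pow flip: int_pow_mult)
    ultimately show "j - k \<in> S" unfolding S_def by auto
  qed
  then obtain m :: nat where m: "\<And>k. k \<in> S \<longleftrightarrow> int m dvd k" by blast
  have "int m \<in> S" by (simp add: m)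
  then obtain v where v: "(y [^] int m, v) \<in> \<Gamma>" unfolding S_def by blast
  obtain u where u: "norm u = 1" "u ^ m = v"
  proof (cases "m = 0")
    case True
    then have "v = 1" using v circle_graph_unit[OF \<Gamma>] by simp
    with True show ?thesis using that[of 1] by simp
  next
    case False
    then show ?thesis using root_near_one[of v m] c(2)[OF v] that by blast
  qed
  have "w = u powi k" if kw: "(y [^] k, w) \<in> \<Gamma>" for k :: int and w
  proof -
    have "k \<in> S" unfolding S_def using kw by blast
    then have "int m dvd k" by (simp only: m)
    then obtain q where q: "k = int m * q" by (rule dvdE)
    have "(y [^] k, v powi q) \<in> \<Gamma>"
      using c(4)[OF v, of q] y by (simp add: q int_pow_pow)
    then have "w = v powi q" using circle_graph_functional[OF \<Gamma> kw] by blast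
    then show ?thesis by (simp add: q u(2)[symmetric] power_int_mult)
  qed
  then show ?thesis using u by blast
qed

lemma circle_graph_maximal:
  assumes "circle_graph \<Gamma>0"
  shows "\<exists>\<Gamma>. circle_graph \<Gamma> \<and> \<Gamma>0 \<subseteq> \<Gamma> \<and> (\<forall>\<Gamma>'. circle_graph \<Gamma>' \<and> \<Gamma> \<subseteq> \<Gamma>' \<longrightarrow> \<Gamma>' = \<Gamma>)"
proof -
  have *: "\<exists>M\<in>{\<Gamma>. circle_graph \<Gamma> \<and> \<Gamma>0 \<subseteq> \<Gamma>}. \<forall>X\<in>{\<Gamma>. circle_graph \<Gamma> \<and> \<Gamma>0 \<subseteq> \<Gamma>}. M \<subseteq> X \<longrightarrow> X = M"
  proof (rule subset_Zorn_nonempty)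
    show "{\<Gamma>. circle_graph \<Gamma> \<and> \<Gamma>0 \<subseteq> \<Gamma>} \<noteq> {}" using assms by blast
    fix \<C> assume ne: "\<C> \<noteq> {}" and "subset.chain {\<Gamma>. circle_graph \<Gamma> \<and> \<Gamma>0 \<subseteq> \<Gamma>} \<C>"
    then have C: "\<And>\<Gamma>. \<Gamma> \<in> \<C> \<Longrightarrow> circle_graph \<Gamma>" "\<And>\<Gamma>. \<Gamma> \<in> \<C> \<Longrightarrow> \<Gamma>0 \<subseteq> \<Gamma>"
      and chain: "\<And>X Y. X \<in> \<C> \<Longrightarrow> Y \<in> \<C> \<Longrightarrow> X \<subseteq> Y \<or> Y \<subseteq> X"
      unfolding subset_chain_def by blast+
    have "circle_graph (\<Union>\<C>)"
    proof (rule circle_graphI)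
      show "(\<one>, 1) \<in> \<Union>\<C>" using ne C(1) circle_graph_closed(1) by blast
      show "g \<in> carrier G \<and> norm w = 1" if "(g, w) \<in> \<Union>\<C>" for g w
        using that C(1) circle_graph_closed(2) by blast
      show "(g \<otimes> h, w * v) \<in> \<Union>\<C>" if "(g, w) \<in> \<Union>\<C>" "(h, v) \<in> \<Union>\<C>" for g w h v
      proof -
        from that(1) obtain X where X: "X \<in> \<C>" "(g, w) \<in> X" by blast
        from that(2) obtain Y where Y: "Y \<in> \<C>" "(h, v) \<in> Y" by blast
        from X Y obtain Z where "Z \<in> \<C>" "(g, w) \<in> Z" "(h, v) \<in> Z" using chain by blast
        then show ?thesis using C(1) circle_graph_closed(3) by blast
      qed
      show "(inv g, inverse w) \<in> \<Union>\<C>" if gw: "(g, w) \<in> \<Union>\<C>" for g w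
      proof -
        obtain X where X: "X \<in> \<C>" "(g, w) \<in> X" using gw by blast
        note cX = C(1)[OF X(1)]
        have "(g [^] (-1::int), w powi (-1)) \<in> X" by (rule circle_graph_int_pow[OF cX X(2)])
        moreover have "g \<in> carrier G" using circle_graph_mem[OF cX X(2)] by blast
        ultimately show ?thesis using X int_pow_neg[of g 1] by auto
      qed
      show "w = 1" if "(\<one>, w) \<in> \<Union>\<C>" for w
        using that C(1) circle_graph_unit by blast
    qed
    then show "\<Union>\<C> \<in> {\<Gamma>. circle_graph \<Gamma> \<and> \<Gamma>0 \<subseteq> \<Gamma>}" using ne C(2) by blast
  qed
  from * obtain M where M: "circle_graph M" "\<Gamma>0 \<subseteq> M"
    and max: "\<forall>X\<in>{\<Gamma>. circle_graph \<Gamma> \<and> \<Gamma>0 \<subseteq> \<Gamma>}. M \<subseteq> X \<longrightarrow> X = M"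
    by blast
  show ?thesis
  proof (intro exI[of _ M] conjI allI impI M)
    fix \<Gamma>' assume "circle_graph \<Gamma>' \<and> M \<subseteq> \<Gamma>'"
    then show "\<Gamma>' = M" using max M(2) by (simp add: order.trans[OF M(2)])
  qed
qed

text \<open>Start from the trivial homomorphism on \<open>L\<close>, adjoin \<open>(x, z)\<close>,
  and take a maximal graph. It is total, since any missing element could be adjoined with a
  compatible value.\<close>

theorem hom_circle_extension:
  assumes L: "subgroup L G" and x: "x \<in> carrier G" and z: "norm z = 1"
    and compat: "\<And>k::int. x [^] k \<in> L \<Longrightarrow> z powi k = 1"
  shows "\<exists>\<phi>\<in>hom G circle_group. (\<forall>l\<in>L. \<phi> l = 1) \<and> \<phi> x = z"
proof -
  have "circle_graph (L \<times> {1})"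
    by (rule circle_graphI)
       (use L in \<open>auto simp: subgroup.one_closed subgroup.m_closed subgroup.m_inv_closed subgroup.mem_carrier\<close>)
  then have "\<exists>\<Gamma>'. circle_graph \<Gamma>' \<and> L \<times> {1} \<subseteq> \<Gamma>' \<and> (x, z) \<in> \<Gamma>'"
    by (rule circle_graph_extend[OF _ x z]) (simp add: compat)
  then obtain \<Gamma>0 where \<Gamma>0: "circle_graph \<Gamma>0" "L \<times> {1} \<subseteq> \<Gamma>0" "(x, z) \<in> \<Gamma>0"
    by blast
  obtain \<Gamma> where \<Gamma>: "circle_graph \<Gamma>" "\<Gamma>0 \<subseteq> \<Gamma>" and
    max: "\<forall>\<Gamma>'. circle_graph \<Gamma>' \<and> \<Gamma> \<subseteq> \<Gamma>' \<longrightarrow> \<Gamma>' = \<Gamma>"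
    using circle_graph_maximal[OF \<Gamma>0(1)] by blast
  have total: "\<exists>w. (y, w) \<in> \<Gamma>" if y: "y \<in> carrier G" for y
  proof -
    obtain u where "norm u = 1" "\<forall>(k::int) w. (y [^] k, w) \<in> \<Gamma> \<longrightarrow> w = u powi k"
      using circle_graph_compatible_value[OF \<Gamma>(1) y] by blast
    then obtain \<Gamma>' where "circle_graph \<Gamma>'" "\<Gamma> \<subseteq> \<Gamma>'" "(y, u) \<in> \<Gamma>'"
      using circle_graph_extend[OF \<Gamma>(1) y] by blast
    then show ?thesis using max by blast
  qed
  define \<phi> where "\<phi> y = (THE w. (y, w) \<in> \<Gamma>)" for y
  have \<phi>: "\<phi> y = w" if "(y, w) \<in> \<Gamma>" for y w
    unfolding \<phi>_def by (rule the_equality[of "\<lambda>w. (y, w) \<in> \<Gamma>", OF that circle_graph_functional[OF \<Gamma>(1) _ that]])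
  have "\<phi> \<in> hom G circle_group"
  proof (rule homI)
    fix y y' assume "y \<in> carrier G" "y' \<in> carrier G"
    then obtain w w' where "(y, w) \<in> \<Gamma>" "(y', w') \<in> \<Gamma>" using total by blast
    then show "\<phi> (y \<otimes> y') = \<phi> y \<otimes>\<^bsub>circle_group\<^esub> \<phi> y'"
      using circle_graph_closed(3)[OF \<Gamma>(1)] \<phi> by simp
  next
    fix y assume "y \<in> carrier G"
    then show "\<phi> y \<in> carrier circle_group"
      using total \<phi> circle_graph_closed(2)[OF \<Gamma>(1)] by force
  qed
  moreover have "\<phi> l = 1" if "l \<in> L" for l
    using \<phi>[of l 1] \<Gamma>(2) \<Gamma>0(2) that by blast
  moreover have "\<phi> x = z"
    using \<phi>[of x z] \<Gamma>(2) \<Gamma>0(3) by blast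
  ultimately show ?thesis by blast
qed

text \<open>Were \<open>x\<close> not separated, 1 would be the only value compatible with
  \<open>L\<close>. But the powers of \<open>x\<close> in \<open>L\<close> have exponents m Z with m
  different from 1: for m = 0 the value -1 is compatible, otherwise the primitive m-th root of unity
  is.\<close>

lemma circle_separates_subgroup:
  assumes L: "subgroup L G" and x: "x \<in> carrier G" "x \<notin> L"
  shows "\<exists>\<phi>\<in>hom G circle_group. (\<forall>l\<in>L. \<phi> l = 1) \<and> \<phi> x \<noteq> 1"
proof (rule ccontr)
  assume no: "\<not> ?thesis"
  have one: "z = 1" if "norm z = 1" "\<And>k::int. x [^] k \<in> L \<Longrightarrow> z powi k = 1" for z :: complex
    using hom_circle_extension[OF L x(1) that] no by metis
  have "\<exists>m::nat. \<forall>k. k \<in> {k::int. x [^] k \<in> L} \<longleftrightarrow> int m dvd k"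
  proof (rule int_subgroup_principal)
    show "0 \<in> {k::int. x [^] k \<in> L}" using L by (simp add: subgroup.one_closed)
    fix j k :: int assume "j \<in> {k. x [^] k \<in> L}" "k \<in> {k. x [^] k \<in> L}"
    then show "j - k \<in> {k. x [^] k \<in> L}"
      using L x by (simp add: int_pow_diff subgroup.m_closed subgroup.m_inv_closed)
  qed
  then obtain m :: nat where m: "\<And>k::int. x [^] k \<in> L \<longleftrightarrow> int m dvd k"
    unfolding mem_Collect_eq by (elim exE) blast
  show False
  proof (cases "m = 0")
    case True
    have "(-1::complex) powi k = 1" if "x [^] k \<in> L" for k :: int
      using m[of k] that True by simp
    then have "(-1::complex) = 1" using one[of "-1"] by simp
    then show False by (simp add: complex_eq_iff)
  next
    case False
    have "m \<noteq> 1" using m[of 1] x by auto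
    have root: "cis (2 * pi / m) ^ m = 1" using False by (simp only: Complex.DeMoivre) simp
    have "cis (2 * pi / m) powi k = 1" if "x [^] k \<in> L" for k :: int
    proof -
      have "int m dvd k" using m[of k] that by simp
      then obtain q where "k = int m * q" by (rule dvdE)
      then show ?thesis using root by (simp add: power_int_mult)
    qed
    then have "cis (2 * pi / m) = 1" using one by simp
    then have "cos (2 * pi / m) = 1" by (metis cis.sel(1) one_complex.sel(1))
    then obtain n::int where "2 * pi / m = real_of_int n * 2 * pi"
      unfolding cos_one_2pi_int by (rule exE)
    then have "1 = real_of_int (n * int m)" using False by (simp add: field_simps)
    then have "1 = n * int m" by linarith
    then show False using \<open>m \<noteq> 1\<close> by (metis dvd_triv_right int_dvd_int_iff nat_dvd_1_iff_1 of_nat_1)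
  qed
qed

end

section \<open>Characters controlled by finitely many points\<close>

text \<open>\<open>X\<close> is a group of characters under pointwise operations. The operations are
  written with \<open>restrict\<close> so that they agree with those of \<open>dual_group\<close>,
  whose elements are extensional.\<close>

locale character_family = comm_group G for G (structure) +
  fixes X :: "('a \<Rightarrow> complex) set"
  assumes X_hom: "\<phi> \<in> X \<Longrightarrow> \<phi> \<in> hom G circle_group"
    and X_one: "(\<lambda>x\<in>carrier G. 1) \<in> X"
    and X_mult: "\<phi> \<in> X \<Longrightarrow> \<psi> \<in> X \<Longrightarrow> (\<lambda>x\<in>carrier G. \<phi> x * \<psi> x) \<in> X"
    and X_inverse: "\<phi> \<in> X \<Longrightarrow> (\<lambda>x\<in>carrier G. inverse (\<phi> x)) \<in> X"
begin

abbreviation "char_one \<equiv> \<lambda>x\<in>carrier G. 1 :: complex"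
abbreviation "char_mult \<phi> \<psi> \<equiv> \<lambda>x\<in>carrier G. \<phi> x * \<psi> x :: complex"
abbreviation "char_inverse \<phi> \<equiv> \<lambda>x\<in>carrier G. inverse (\<phi> x) :: complex"
abbreviation "char_power \<phi> n \<equiv> \<lambda>x\<in>carrier G. \<phi> x ^ n :: complex"

lemma X_norm: "\<phi> \<in> X \<Longrightarrow> x \<in> carrier G \<Longrightarrow> norm (\<phi> x) = 1"
  using X_hom hom_circle_norm by blast

lemma X_power: "\<phi> \<in> X \<Longrightarrow> (char_power \<phi> n) \<in> X"
proof (induction n)
  case 0
  then show ?case by (simp only: power_0 X_one)
next
  case (Suc n)
  then have "(char_mult \<phi> (char_power \<phi> n)) \<in> X"
    using X_mult by blast
  also have "(char_mult \<phi> (char_power \<phi> n)) = (\<lambda>x\<in>carrier G. \<phi> x ^ Suc n)"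
    by (rule restrict_ext) simp
  finally show ?case .
qed

text \<open>Algebraic characters of the group \<open>X\<close>; continuity is kept apart as
  \<open>controlled\<close>.\<close>

definition X_char :: "(('a \<Rightarrow> complex) \<Rightarrow> complex) \<Rightarrow> bool" where
  "X_char \<Phi> \<longleftrightarrow> (\<forall>\<phi>\<in>X. norm (\<Phi> \<phi>) = 1) \<and>
     (\<forall>\<phi>\<in>X. \<forall>\<psi>\<in>X. \<Phi> (char_mult \<phi> \<psi>) = \<Phi> \<phi> * \<Phi> \<psi>)"

text \<open>For finite \<open>F\<close> this is continuity at the trivial character for pointwise
  convergence, witnessed on \<open>F\<close>. The fixed bound 1 is enough because the circle has no
  small subgroups.\<close>

definition controlled :: "(('a \<Rightarrow> complex) \<Rightarrow> complex) \<Rightarrow> 'a set \<Rightarrow> bool" where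
  "controlled \<Phi> F \<longleftrightarrow>
     (\<exists>e>0. \<forall>\<phi>\<in>X. (\<forall>x\<in>F. dist (\<phi> x) 1 < e) \<longrightarrow> dist (\<Phi> \<phi>) 1 < 1)"

lemma X_char_norm: "X_char \<Phi> \<Longrightarrow> \<phi> \<in> X \<Longrightarrow> norm (\<Phi> \<phi>) = 1"
  by (simp add: X_char_def)

lemma X_char_mult:
  "X_char \<Phi> \<Longrightarrow> \<phi> \<in> X \<Longrightarrow> \<psi> \<in> X \<Longrightarrow> \<Phi> (char_mult \<phi> \<psi>) = \<Phi> \<phi> * \<Phi> \<psi>"
  by (simp add: X_char_def)

lemma X_char_one:
  assumes "X_char \<Phi>" shows "\<Phi> char_one = 1"
proof -
  have "\<Phi> char_one = \<Phi> char_one * \<Phi> char_one"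
    by (subst X_char_mult[OF assms X_one X_one, symmetric])
      (auto intro!: arg_cong[of _ _ \<Phi>] restrict_ext)
  moreover have "\<Phi> char_one \<noteq> 0" using X_char_norm[OF assms X_one] by auto
  ultimately show ?thesis by simp
qed

lemma X_char_power:
  assumes "X_char \<Phi>" "\<phi> \<in> X" shows "\<Phi> (char_power \<phi> n) = \<Phi> \<phi> ^ n"
proof (induction n)
  case 0
  then show ?case by (simp only: power_0 X_char_one[OF assms(1)])
next
  case (Suc n)
  have "\<Phi> (char_mult \<phi> (char_power \<phi> n)) = \<Phi> \<phi> * \<Phi> \<phi> ^ n"
    using X_char_mult[OF assms(1) assms(2) X_power[OF assms(2)], of n] by (simp only: Suc)
  also have "(char_mult \<phi> (char_power \<phi> n)) = (\<lambda>x\<in>carrier G. \<phi> x ^ Suc n)"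
    by (rule restrict_ext) simp
  finally show ?case by simp
qed

lemma X_char_inverse:
  assumes "X_char \<Phi>" "\<phi> \<in> X" shows "\<Phi> (char_inverse \<phi>) = inverse (\<Phi> \<phi>)"
proof -
  have nz: "\<phi> x \<noteq> 0" if "x \<in> carrier G" for x using X_norm[OF assms(2) that] by auto
  have "\<Phi> \<phi> * \<Phi> (char_inverse \<phi>) = \<Phi> (char_mult \<phi> (char_inverse \<phi>))"
    using X_char_mult[OF assms(1) assms(2) X_inverse[OF assms(2)]] by simp
  also have "(char_mult \<phi> (char_inverse \<phi>)) = char_one"
    using nz by (auto intro!: restrict_ext)
  finally show ?thesis
    using X_char_one[OF assms(1)] by (metis inverse_unique)
qed

text \<open>Apply the control to the powers of \<phi> with exponents 2^j for j < n: the values of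
  \<Phi> at all of them are within 1 of 1, and the doubling estimate shrinks the distance
  geometrically.\<close>

lemma controlled_small:
  assumes \<Phi>: "X_char \<Phi>" "controlled \<Phi> F" and F: "F \<subseteq> carrier G" and d: "d > 0"
  shows "\<exists>e>0. \<forall>\<phi>\<in>X. (\<forall>x\<in>F. dist (\<phi> x) 1 < e) \<longrightarrow> dist (\<Phi> \<phi>) 1 < d"
proof -
  obtain e where e: "e > 0" "\<And>\<phi>. \<phi> \<in> X \<Longrightarrow> (\<forall>x\<in>F. dist (\<phi> x) 1 < e) \<Longrightarrow> dist (\<Phi> \<phi>) 1 < 1"
    using \<Phi>(2) unfolding controlled_def by blast
  obtain n where n: "(2/3::real) ^ n < d / 2"
    using real_arch_pow_inv[of "d / 2" "2/3"] d by auto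
  show ?thesis
  \<comment> \<open>A power with exponent 2^j, j < n, multiplies distances to 1 by at most
    2^n.\<close>
  proof (intro exI[of _ "e / 2 ^ n"] conjI ballI impI)
    show "e / 2 ^ n > 0" using e by simp
    fix \<phi> assume \<phi>: "\<phi> \<in> X" and near: "\<forall>x\<in>F. dist (\<phi> x) 1 < e / 2 ^ n"
    have "dist (\<Phi> \<phi> ^ (2 ^ j)) 1 < 1" if "j < n" for j
    proof -
      have "dist (\<phi> x ^ (2 ^ j)) 1 < e" if "x \<in> F" for x
      proof -
        have "dist (\<phi> x ^ (2 ^ j)) 1 \<le> real (2 ^ j) * dist (\<phi> x) 1"
          by (rule dist_power_circle) (use \<phi> X_norm F that in blast)
        also have "\<dots> < 2 ^ j * (e / 2 ^ n)" using near that
          by (simp add: mult_strict_left_mono del: times_divide_eq_right)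
        also have "\<dots> \<le> 2 ^ n * (e / 2 ^ n)"
          using e \<open>j < n\<close> by (intro mult_right_mono power_increasing) auto
        finally show ?thesis by simp
      qed
      then have "\<forall>x\<in>F. dist ((char_power \<phi> (2 ^ j)) x) 1 < e" using F by auto
      then have "dist (\<Phi> (char_power \<phi> (2 ^ j))) 1 < 1"
        by (intro e(2) X_power \<phi>)
      then show ?thesis by (simp add: X_char_power[OF \<Phi>(1) \<phi>])
    qed
    then have "dist (\<Phi> \<phi>) 1 \<le> (2/3) ^ n * 2"
      by (intro dist_one_doubling X_char_norm[OF \<Phi>(1) \<phi>])
    then show "dist (\<Phi> \<phi>) 1 < d" using n by simp
  qed
qed

text \<open>All powers of \<phi> are 1 on \<open>F\<close>, so all powers of
  \<open>\<Phi> \<phi>\<close> lie within distance 1 of 1.\<close>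

lemma controlled_kernel:
  assumes \<Phi>: "X_char \<Phi>" "controlled \<Phi> F" and F: "F \<subseteq> carrier G"
    and \<phi>: "\<phi> \<in> X" and one: "\<And>x. x \<in> F \<Longrightarrow> \<phi> x = 1"
  shows "\<Phi> \<phi> = 1"
proof (rule no_small_subgroup)
  show "norm (\<Phi> \<phi>) = 1" by (rule X_char_norm[OF \<Phi>(1) \<phi>])
  fix n :: nat
  obtain e where e: "e > 0" "\<And>\<phi>. \<phi> \<in> X \<Longrightarrow> (\<forall>x\<in>F. dist (\<phi> x) 1 < e) \<Longrightarrow> dist (\<Phi> \<phi>) 1 < 1"
    using \<Phi>(2) unfolding controlled_def by blast
  have "\<forall>x\<in>F. dist ((char_power \<phi> n) x) 1 < e" using F one e(1) by auto
  then have "dist (\<Phi> (char_power \<phi> n)) 1 < 1"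
    by (intro e(2) X_power \<phi>)
  then show "dist (\<Phi> \<phi> ^ n) 1 < 1" by (simp add: X_char_power[OF \<Phi>(1) \<phi>])
qed

lemma controlled_eq:
  assumes \<Phi>: "X_char \<Phi>" "controlled \<Phi> F" and F: "F \<subseteq> carrier G"
    and \<phi>: "\<phi> \<in> X" "\<psi> \<in> X" and eq: "\<And>x. x \<in> F \<Longrightarrow> \<phi> x = \<psi> x"
  shows "\<Phi> \<phi> = \<Phi> \<psi>"
proof -
  define \<psi>' where "\<psi>' = (char_inverse \<psi>)"
  have \<psi>': "\<psi>' \<in> X" unfolding \<psi>'_def by (rule X_inverse[OF \<phi>(2)])
  have "\<Phi> (char_mult \<phi> \<psi>') = 1"
  proof (rule controlled_kernel[OF \<Phi> F X_mult[OF \<phi>(1) \<psi>']])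
    fix x assume "x \<in> F"
    then have "x \<in> carrier G" using F by blast
    then have "\<psi> x \<noteq> 0" using X_norm[OF \<phi>(2)] by fastforce
    then show "(char_mult \<phi> \<psi>') x = 1"
      using \<open>x \<in> carrier G\<close> eq[OF \<open>x \<in> F\<close>] by (simp add: \<psi>'_def)
  qed
  then have "\<Phi> \<phi> * inverse (\<Phi> \<psi>) = 1"
    using X_char_mult[OF \<Phi>(1) \<phi>(1) \<psi>'] X_char_inverse[OF \<Phi>(1) \<phi>(2)] by (simp add: \<psi>'_def)
  moreover have "\<Phi> \<psi> \<noteq> 0" using X_char_norm[OF \<Phi>(1) \<phi>(2)] by auto
  ultimately show ?thesis by (simp add: field_simps)
qed

text \<open>Carries smallness on \<open>F\<close> over to the subgroup it generates, in particular
  to the power of \<open>x\<close> that falls into this subgroup in the torsion step below.\<close>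

lemma generate_small:
  assumes F: "F \<subseteq> carrier G" and h: "h \<in> generate G F" and d: "d > 0"
  shows "\<exists>e>0. \<forall>\<phi>\<in>X. (\<forall>x\<in>F. dist (\<phi> x) 1 < e) \<longrightarrow> dist (\<phi> h) 1 < d"
  using h d
proof (induction arbitrary: d rule: generate.induct)
  case one
  have "dist (\<phi> \<one>) 1 < d" if "\<phi> \<in> X" for \<phi>
    using hom_circle_one[OF X_hom[OF that]] one by simp
  then show ?case by (intro exI[of _ 1]) simp
next
  case (incl h)
  then show ?case by blast
next
  case (inv h)
  have "dist (\<phi> (inv h)) 1 = dist (\<phi> h) 1" if "\<phi> \<in> X" for \<phi>
    using inv F hom_circle_inv[OF X_hom[OF that]] dist_inverse_circle X_norm[OF that] by (metis subsetD)
  then show ?case using inv by (intro exI[of _ d]) auto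
next
  case (eng h1 h2)
  obtain e1 where e1: "e1 > 0" "\<forall>\<phi>\<in>X. (\<forall>x\<in>F. dist (\<phi> x) 1 < e1) \<longrightarrow> dist (\<phi> h1) 1 < d/2"
    using eng.IH(1)[of "d/2"] eng.prems by auto
  obtain e2 where e2: "e2 > 0" "\<forall>\<phi>\<in>X. (\<forall>x\<in>F. dist (\<phi> x) 1 < e2) \<longrightarrow> dist (\<phi> h2) 1 < d/2"
    using eng.IH(2)[of "d/2"] eng.prems by auto
  have c: "h1 \<in> carrier G" "h2 \<in> carrier G" using eng.hyps generate_in_carrier[OF F] by auto
  show ?case
  proof (intro exI[of _ "min e1 e2"] conjI ballI impI)
    fix \<phi> assume \<phi>: "\<phi> \<in> X" "\<forall>x\<in>F. dist (\<phi> x) 1 < min e1 e2"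
    have "dist (\<phi> h1 * \<phi> h2) (1 * 1) \<le> dist (\<phi> h1) 1 + dist (\<phi> h2) 1"
      by (rule dist_mult_circle) (use X_norm[OF \<phi>(1)] c in auto)
    moreover have "dist (\<phi> h1) 1 < d/2" "dist (\<phi> h2) 1 < d/2" using e1 e2 \<phi> by auto
    ultimately show "dist (\<phi> (h1 \<otimes> h2)) 1 < d"
      using hom_circle_mult[OF X_hom[OF \<phi>(1)] c] by simp
  qed (use e1 e2 in auto)
qed

end

text \<open>\<open>X\<close> realises every value at \<open>x\<close> that the algebra permits for a
  homomorphism trivial on \<open>F\<close>. This is what allows a point to be removed from a
  controlling set.\<close>

locale rich_character_family = character_family +
  assumes rich: "\<And>F x z. finite F \<Longrightarrow> F \<subseteq> carrier G \<Longrightarrow> x \<in> carrier G \<Longrightarrow> norm z = 1 \<Longrightarrow>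
     (\<And>k::int. x [^] k \<in> generate G F \<Longrightarrow> z powi k = 1) \<Longrightarrow>
     \<exists>\<phi>\<in>X. (\<forall>y\<in>F. \<phi> y = 1) \<and> \<phi> x = z"
begin

text \<open>Let \<open>c z\<close> in \<open>X\<close> be trivial on \<open>F\<close> with value
  \<open>z\<close> at \<open>x\<close>. Then z \<mapsto> \<Phi> (c z) is a continuous endomorphism
  of the circle, hence a k-th power. Multiplying \<phi> by \<open>c z\<close> for z = 1 / \<phi> x
  makes the value at \<open>x\<close> equal to 1 without changing \<phi> on \<open>F\<close>, and
  multiplies \<open>\<Phi> \<phi>\<close> by z^k.\<close>

lemma controlled_step_free:
  assumes \<Phi>: "X_char \<Phi>" "controlled \<Phi> (insert x F)" and F: "finite F" "F \<subseteq> carrier G"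
    and x: "x \<in> carrier G" and free: "\<And>k::int. x [^] k \<in> generate G F \<Longrightarrow> k = 0"
  shows "\<exists>k::int. controlled (\<lambda>\<phi>. \<Phi> \<phi> * inverse (\<phi> x) powi k) F"
proof -
  have xF: "insert x F \<subseteq> carrier G" using x F by auto
  have "\<exists>\<phi>\<in>X. (\<forall>y\<in>F. \<phi> y = 1) \<and> \<phi> x = z" if "norm z = 1" for z
    using rich[OF F x that] free by force
  then have "\<forall>z. \<exists>\<phi>. norm z = 1 \<longrightarrow> \<phi> \<in> X \<and> (\<forall>y\<in>F. \<phi> y = 1) \<and> \<phi> x = z"
    by blast
  then obtain c where c: "\<And>z. norm z = 1 \<Longrightarrow> c z \<in> X" "\<And>z y. norm z = 1 \<Longrightarrow> y \<in> F \<Longrightarrow> c z y = 1"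
    "\<And>z. norm z = 1 \<Longrightarrow> c z x = z"
    by metis
  have "\<exists>k::int. \<forall>z. norm z = 1 \<longrightarrow> \<Phi> (c z) = z powi k"
  proof (rule hom_circle_power)
    show "norm (\<Phi> (c z)) = 1" if "norm z = 1" for z
      using X_char_norm[OF \<Phi>(1) c(1)[OF that]] .
    show "\<Phi> (c (z * w)) = \<Phi> (c z) * \<Phi> (c w)" if "norm z = 1" "norm w = 1" for z w
    proof -
      have zw: "norm (z * w) = 1" using that by (simp add: norm_mult)
      \<comment> \<open>The choice \<open>c\<close> need not be multiplicative, but \<Phi> depends
        only on values on \<open>insert x F\<close>, and there it is.\<close>
      have "\<Phi> (c (z * w)) = \<Phi> (char_mult (c z) (c w))"
      proof (rule controlled_eq[OF \<Phi> xF c(1)[OF zw] X_mult[OF c(1)[OF that(1)] c(1)[OF that(2)]]])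
        fix y assume y: "y \<in> insert x F"
        then have "y \<in> carrier G" using xF by blast
        then show "c (z * w) y = (char_mult (c z) (c w)) y"
          using c(2,3)[OF zw] c(2,3)[OF that(1)] c(2,3)[OF that(2)] y by auto
      qed
      then show ?thesis using X_char_mult[OF \<Phi>(1) c(1)[OF that(1)] c(1)[OF that(2)]] by simp
    qed
    show "\<exists>d>0. \<forall>z. norm z = 1 \<and> dist z 1 < d \<longrightarrow> dist (\<Phi> (c z)) 1 < e" if "e > 0" for e
    proof -
      obtain d where d: "d > 0" "\<forall>\<phi>\<in>X. (\<forall>x\<in>insert x F. dist (\<phi> x) 1 < d) \<longrightarrow> dist (\<Phi> \<phi>) 1 < e"
        using controlled_small[OF \<Phi> xF \<open>e > 0\<close>] by blast
      have "dist (\<Phi> (c z)) 1 < e" if "norm z = 1" "dist z 1 < d" for z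
      proof -
        have "\<forall>y\<in>insert x F. dist (c z y) 1 < d"
          using c(2,3)[OF that(1)] that(2) d(1) by auto
        then show ?thesis using d(2) c(1)[OF that(1)] by blast
      qed
      then show ?thesis using d(1) by blast
    qed
  qed
  then obtain k :: int where k: "\<And>z. norm z = 1 \<Longrightarrow> \<Phi> (c z) = z powi k" by blast
  obtain e where e: "e > 0" "\<And>\<phi>. \<phi> \<in> X \<Longrightarrow> (\<forall>x\<in>insert x F. dist (\<phi> x) 1 < e) \<Longrightarrow> dist (\<Phi> \<phi>) 1 < 1"
    using \<Phi>(2) unfolding controlled_def by blast
  have "controlled (\<lambda>\<phi>. \<Phi> \<phi> * inverse (\<phi> x) powi k) F"
    unfolding controlled_def
  proof (intro exI[of _ e] conjI ballI impI e(1))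
    fix \<phi> assume \<phi>: "\<phi> \<in> X" "\<forall>x\<in>F. dist (\<phi> x) 1 < e"
    define z where "z = inverse (\<phi> x)"
    have \<phi>x: "norm (\<phi> x) = 1" using X_norm \<phi>(1) x by blast
    then have z: "norm z = 1" "\<phi> x * z = 1" by (auto simp: z_def norm_inverse intro!: right_inverse)
    have "dist ((char_mult \<phi> (c z)) y) 1 < e" if "y \<in> insert x F" for y
    proof (cases "y = x")
      case True
      then show ?thesis using x z e(1) c(3)[OF z(1)] by simp
    next
      case False
      then show ?thesis using that xF \<phi>(2) c(2)[OF z(1)] by auto
    qed
    then have "dist (\<Phi> (char_mult \<phi> (c z))) 1 < 1"
      by (intro e(2) X_mult \<phi>(1) c(1) z(1)) blast
    then show "dist (\<Phi> \<phi> * inverse (\<phi> x) powi k) 1 < 1"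
      using X_char_mult[OF \<Phi>(1) \<phi>(1) c(1)[OF z(1)]] k[OF z(1)] by (simp add: z_def)
  qed
  then show ?thesis ..
qed

text \<open>Now only m-th roots of unity can be prescribed at \<open>x\<close> while being trivial
  on \<open>F\<close>. If \<phi> is small on \<open>F\<close>, then (\<phi> x)^m is near 1, so
  \<phi> x differs from a root \<open>u\<close> near 1 by a power of \<zeta>. Multiplying \<phi> by
  a power of \<open>c\<close> moves its value at \<open>x\<close> to \<open>u\<close>; since \<Phi>
  sends \<open>c\<close> to \<zeta>^k, the twist by the k-th power absorbs this change up to
  u^k.\<close>

lemma controlled_step_torsion:
  assumes \<Phi>: "X_char \<Phi>" "controlled \<Phi> (insert x F)" and F: "finite F" "F \<subseteq> carrier G"
    and x: "x \<in> carrier G" and m: "m > 0" "\<And>k::int. x [^] k \<in> generate G F \<longleftrightarrow> int m dvd k"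
  shows "\<exists>k::int. controlled (\<lambda>\<phi>. \<Phi> \<phi> * inverse (\<phi> x) powi k) F"
proof -
  have xF: "insert x F \<subseteq> carrier G" using x F by auto
  define \<zeta> where "\<zeta> = cis (2 * pi / m)"
  have \<zeta>: "norm \<zeta> = 1" by (simp add: \<zeta>_def)
  have \<zeta>m: "\<zeta> ^ m = 1" using m(1) unfolding \<zeta>_def by (simp only: Complex.DeMoivre) simp
  have "\<zeta> powi k = 1" if "x [^] k \<in> generate G F" for k :: int
  proof -
    have "int m dvd k" using m(2)[of k] that by simp
    then obtain q where "k = int m * q" by (rule dvdE)
    then show ?thesis using \<zeta>m by (simp add: power_int_mult)
  qed
  then obtain c where c: "c \<in> X" "\<And>y. y \<in> F \<Longrightarrow> c y = 1" "c x = \<zeta>"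
    using rich[OF F x \<zeta>] by blast
  have "\<Phi> c ^ m = 1"
  proof -
    have "\<Phi> (char_power c m) = 1"
      by (rule controlled_kernel[OF \<Phi> xF X_power[OF c(1)]]) (use xF c \<zeta>m in auto)
    then show ?thesis by (simp add: X_char_power[OF \<Phi>(1) c(1)])
  qed
  then obtain k :: nat where k: "\<Phi> c = \<zeta> ^ k"
    using root_unity_eq_power[OF _ m(1)] unfolding \<zeta>_def by blast
  obtain e1 where e1: "e1 > 0" "\<forall>\<phi>\<in>X. (\<forall>x\<in>insert x F. dist (\<phi> x) 1 < e1) \<longrightarrow> dist (\<Phi> \<phi>) 1 < 1/2"
    using controlled_small[OF \<Phi> xF, of "1/2"] by auto
  \<comment> \<open>Chosen so that u^k stays within 1/2 of 1; together with the bound 1/2 obtained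
    for \<Phi> this gives the required 1.\<close>
  define d where "d = min e1 (1 / (2 * (real k + 1)))"
  have d: "d > 0" "d \<le> e1" "real k * d < 1/2"
  proof -
    show "d > 0" "d \<le> e1" using e1(1) by (auto simp: d_def)
    have "real k * d \<le> real k * (1 / (2 * (real k + 1)))"
      by (rule mult_left_mono) (auto simp: d_def)
    also have "\<dots> < 1/2" by (simp add: field_simps)
    finally show "real k * d < 1/2" .
  qed
  have "x [^] int m \<in> generate G F" using m(2)[of "int m"] by simp
  then obtain e2 where e2: "e2 > 0"
    "\<forall>\<phi>\<in>X. (\<forall>x\<in>F. dist (\<phi> x) 1 < e2) \<longrightarrow> dist (\<phi> (x [^] int m)) 1 < d"
    using generate_small[OF F(2) _ d(1)] by blast
  have "controlled (\<lambda>\<phi>. \<Phi> \<phi> * inverse (\<phi> x) powi int k) F"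
    unfolding controlled_def
  proof (intro exI[of _ "min e1 e2"] conjI ballI impI)
    show "min e1 e2 > 0" using e1 e2 by simp
    fix \<phi> assume \<phi>: "\<phi> \<in> X" "\<forall>x\<in>F. dist (\<phi> x) 1 < min e1 e2"
    define w where "w = \<phi> x"
    have w: "norm w = 1" unfolding w_def using X_norm \<phi>(1) x by blast
    have "dist (w ^ m) 1 < d"
      using e2(2) \<phi> hom_circle_nat_pow[OF X_hom[OF \<phi>(1)] x, of m] by (auto simp: w_def int_pow_int)
    moreover obtain u where u: "norm u = 1" "u ^ m = w ^ m" "dist u 1 \<le> dist (w ^ m) 1"
      using root_near_one[of "w ^ m" m] w m(1) by (auto simp: norm_power)
    ultimately have ud: "dist u 1 < d" by simp
    have nz: "u \<noteq> 0" "w \<noteq> 0" "\<zeta> \<noteq> 0" using u w \<zeta> by auto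
    have "(u / w) ^ m = 1" using u(2) nz by (simp add: power_divide)
    then obtain j where j: "u / w = \<zeta> ^ j"
      using root_unity_eq_power[OF _ m(1)] unfolding \<zeta>_def by blast
    then have u_eq: "u = w * \<zeta> ^ j" using nz by (simp add: field_simps)
    define \<psi> where "\<psi> = (char_mult \<phi> (char_power c j))"
    have \<psi>: "\<psi> \<in> X" unfolding \<psi>_def by (intro X_mult \<phi> X_power c(1))
    have "\<forall>y\<in>insert x F. dist (\<psi> y) 1 < e1"
    proof
      fix y assume y: "y \<in> insert x F"
      show "dist (\<psi> y) 1 < e1"
      proof (cases "y = x")
        case True
        then have "\<psi> y = u" using x c(3) u_eq by (simp add: \<psi>_def w_def)
        then show ?thesis using ud d by simp
      next
        case False
        then have "\<psi> y = \<phi> y" using y xF c(2) by (auto simp: \<psi>_def)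
        then show ?thesis using False y \<phi>(2) by auto
      qed
    qed
    then have 1: "dist (\<Phi> \<psi>) 1 < 1/2" using e1(2) \<psi> by blast
    have "\<Phi> \<psi> = \<Phi> \<phi> * (\<zeta> ^ k) ^ j"
      unfolding \<psi>_def using X_char_mult[OF \<Phi>(1) \<phi>(1) X_power[OF c(1)]] X_char_power[OF \<Phi>(1) c(1)] k
      by simp
    then have "\<Phi> \<phi> * inverse w ^ k = \<Phi> \<psi> * inverse u ^ k"
      using nz by (simp add: u_eq field_simps power_mult_distrib flip: power_mult)
    moreover have "dist (\<Phi> \<psi> * inverse u ^ k) (1 * 1) \<le> dist (\<Phi> \<psi>) 1 + dist (inverse u ^ k) 1"
      by (rule dist_mult_circle) (use X_char_norm[OF \<Phi>(1) \<psi>] in auto)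
    moreover have "dist (inverse u ^ k) 1 < 1/2"
    proof -
      have "dist (inverse u ^ k) 1 \<le> real k * dist (inverse u) 1"
        by (rule dist_power_circle) (simp add: u norm_inverse)
      also have "\<dots> \<le> real k * d" using ud by (intro mult_left_mono) (auto simp: dist_inverse_circle u)
      finally show ?thesis using d by simp
    qed
    ultimately show "dist (\<Phi> \<phi> * inverse (\<phi> x) powi int k) 1 < 1" using 1 by (simp add: w_def)
  qed
  then show ?thesis by blast
qed

text \<open>Each step removes a point \<open>x\<close> from the controlling set at the price of
  twisting \<Phi> by evaluation at a power of \<open>x\<close>, which is put back into
  \<open>a\<close> afterwards. A \<Phi> controlled by the empty set is trivial, that is, evaluation
  at the identity.\<close>

theorem controlled_is_evaluation:
  assumes "finite F" "F \<subseteq> carrier G" "X_char \<Phi>" "controlled \<Phi> F"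
  shows "\<exists>a\<in>carrier G. \<forall>\<phi>\<in>X. \<Phi> \<phi> = \<phi> a"
  using assms
proof (induction F arbitrary: \<Phi> rule: finite_induct)
  case empty
  have "\<Phi> \<phi> = \<phi> \<one>" if "\<phi> \<in> X" for \<phi>
    using controlled_kernel[OF empty(2,3,1) that] hom_circle_one[OF X_hom[OF that]] by simp
  then show ?case by blast
next
  case (insert x F)
  have F: "finite F" "F \<subseteq> carrier G" and x: "x \<in> carrier G" using insert by auto
  have sg: "subgroup (generate G F) G" by (rule generate_is_subgroup[OF F(2)])
  have "\<exists>m::nat. \<forall>k. k \<in> {k::int. x [^] k \<in> generate G F} \<longleftrightarrow> int m dvd k"
  proof (rule int_subgroup_principal)
    show "0 \<in> {k::int. x [^] k \<in> generate G F}" using sg by (simp add: subgroup.one_closed)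
    fix j k :: int assume "j \<in> {k. x [^] k \<in> generate G F}" "k \<in> {k. x [^] k \<in> generate G F}"
    then show "j - k \<in> {k. x [^] k \<in> generate G F}"
      using sg x by (simp add: int_pow_diff subgroup.m_closed subgroup.m_inv_closed)
  qed
  then obtain m :: nat where m: "\<And>k::int. x [^] k \<in> generate G F \<longleftrightarrow> int m dvd k"
    unfolding mem_Collect_eq by (elim exE) blast
  have "\<exists>k::int. controlled (\<lambda>\<phi>. \<Phi> \<phi> * inverse (\<phi> x) powi k) F"
  proof (cases "m = 0")
    case True
    show ?thesis
    proof (rule controlled_step_free[OF insert.prems(2,3) F x])
      fix k :: int assume "x [^] k \<in> generate G F"
      then have "int m dvd k" by (simp only: m)
      then show "k = 0" using True by simp
    qed
  next
    case False
    then show ?thesis using controlled_step_torsion[OF insert.prems(2,3) F x _ m] by blast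
  qed
  then obtain k :: int where k: "controlled (\<lambda>\<phi>. \<Phi> \<phi> * inverse (\<phi> x) powi k) F" by blast
  have \<phi>x: "norm (\<phi> x) = 1" if "\<phi> \<in> X" for \<phi> using X_norm x that by blast
  have "X_char (\<lambda>\<phi>. \<Phi> \<phi> * inverse (\<phi> x) powi k)"
    unfolding X_char_def
  proof (intro conjI ballI)
    show "norm (\<Phi> \<phi> * inverse (\<phi> x) powi k) = 1" if "\<phi> \<in> X" for \<phi>
      using X_char_norm[OF insert.prems(2) that] \<phi>x[OF that]
      by (simp add: norm_mult norm_power_int norm_inverse)
    fix \<phi> \<psi> assume "\<phi> \<in> X" "\<psi> \<in> X"
    then show "\<Phi> (char_mult \<phi> \<psi>) * inverse ((char_mult \<phi> \<psi>) x) powi k =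
      \<Phi> \<phi> * inverse (\<phi> x) powi k * (\<Phi> \<psi> * inverse (\<psi> x) powi k)"
      using x by (simp add: X_char_mult[OF insert.prems(2)] power_int_mult_distrib)
  qed
  then obtain a where a: "a \<in> carrier G" "\<forall>\<phi>\<in>X. \<Phi> \<phi> * inverse (\<phi> x) powi k = \<phi> a"
    using insert.IH[OF F(2) _ k] by blast
  have "\<Phi> \<phi> = \<phi> (a \<otimes> x [^] k)" if "\<phi> \<in> X" for \<phi>
  proof -
    have "\<phi> (a \<otimes> x [^] k) = \<Phi> \<phi> * inverse (\<phi> x) powi k * \<phi> x powi k"
      using hom_circle_mult[OF X_hom[OF that]] hom_circle_int_pow[OF X_hom[OF that]] a x that by simp
    also have "\<dots> = \<Phi> \<phi> * (inverse (\<phi> x) * \<phi> x) powi k" by (simp add: power_int_mult_distrib)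
    also have "inverse (\<phi> x) * \<phi> x = 1" using \<phi>x[OF that] by (intro left_inverse) auto
    finally show ?thesis by simp
  qed
  then show ?case using a x by (intro bexI[of _ "a \<otimes> x [^] k"]) auto
qed

end

section \<open>Duality for P-groups\<close>

lemma (in comm_group) subgroup_product:
  assumes "subgroup H G" "subgroup N G"
  shows "subgroup {h \<otimes> n | h n. h \<in> H \<and> n \<in> N} G"
proof (rule subgroupI)
  note c = subgroup.mem_carrier[OF assms(1)] subgroup.mem_carrier[OF assms(2)]
  show "{h \<otimes> n | h n. h \<in> H \<and> n \<in> N} \<subseteq> carrier G" using c by auto
  show "{h \<otimes> n | h n. h \<in> H \<and> n \<in> N} \<noteq> {}"
    using assms subgroup.one_closed by blast
  fix a assume "a \<in> {h \<otimes> n | h n. h \<in> H \<and> n \<in> N}"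
  then obtain h n where a: "a = h \<otimes> n" "h \<in> H" "n \<in> N" by blast
  have "inv a = inv h \<otimes> inv n" using a c by (simp add: inv_mult)
  then show "inv a \<in> {h \<otimes> n | h n. h \<in> H \<and> n \<in> N}"
    using subgroup.m_inv_closed[OF assms(1) a(2)] subgroup.m_inv_closed[OF assms(2) a(3)] by blast
  fix b assume "b \<in> {h \<otimes> n | h n. h \<in> H \<and> n \<in> N}"
  then obtain h' n' where b: "b = h' \<otimes> n'" "h' \<in> H" "n' \<in> N" by blast
  have "a \<otimes> b = (h \<otimes> h') \<otimes> (n \<otimes> n')" using a b c by (simp add: m_ac)
  then show "a \<otimes> b \<in> {h \<otimes> n | h n. h \<in> H \<and> n \<in> N}"
    using subgroup.m_closed[OF assms(1) a(2) b(2)] subgroup.m_closed[OF assms(2) a(3) b(3)] by blast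
qed

text \<open>The elements are finite words in \<open>S\<close> and its inverses. Countability allows
  a P-group to separate a finitely generated subgroup from an open one.\<close>

lemma (in group) countable_generate:
  assumes "countable S" "S \<subseteq> carrier G"
  shows "countable (generate G S)"
proof -
  define g where "g xs = foldr (\<otimes>) xs \<one>" for xs
  have g_closed: "g xs \<in> carrier G" if "set xs \<subseteq> carrier G" for xs
    using that by (induction xs) (auto simp: g_def)
  have g_append: "g (xs @ ys) = g xs \<otimes> g ys" if "set xs \<subseteq> carrier G" "set ys \<subseteq> carrier G" for xs ys
    using that
  proof (induction xs)
    case Nil
    then show ?case using g_closed[of ys] by (simp add: g_def)
  next
    case (Cons x xs)
    have *: "g (a # zs) = a \<otimes> g zs" for a zs by (simp add: g_def)
    from Cons show ?case using g_closed[of xs] g_closed[of ys] by (simp add: * m_assoc)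
  qed
  define S' where "S' = S \<union> (\<lambda>x. inv x) ` S"
  have S': "S' \<subseteq> carrier G" "countable S'" using assms by (auto simp: S'_def)
  have "h \<in> g ` lists S'" if "h \<in> generate G S" for h
    using that
  proof induction
    case one
    show ?case by (rule image_eqI[of _ _ "[]"]) (auto simp: g_def)
  next
    case (incl h)
    then show ?case using assms(2) by (intro image_eqI[of _ _ "[h]"]) (auto simp: g_def S'_def)
  next
    case (inv h)
    then show ?case using assms(2) by (intro image_eqI[of _ _ "[inv h]"]) (auto simp: g_def S'_def)
  next
    case (eng h1 h2)
    then obtain xs ys where "xs \<in> lists S'" "h1 = g xs" "ys \<in> lists S'" "h2 = g ys" by auto
    moreover from this have "g (xs @ ys) = g xs \<otimes> g ys"
      using S'(1) by (intro g_append) auto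
    ultimately show ?case by (intro image_eqI[of _ _ "xs @ ys"]) auto
  qed
  then have "generate G S \<subseteq> g ` lists S'" by blast
  then show ?thesis using S'(2) by (meson countable_image countable_lists countable_subset)
qed

context topological_abelian_group
begin

lemma openin_carrier: "openin T U \<Longrightarrow> U \<subseteq> carrier G"
  using openin_subset topspace_eq by blast

lemma openin_carrier_self: "openin T (carrier G)"
  using openin_topspace[of T] by (simp add: topspace_eq)

lemma continuous_translate: "a \<in> carrier G \<Longrightarrow> continuous_map T T (\<lambda>x. a \<otimes> x)"
proof -
  assume a: "a \<in> carrier G"
  have "continuous_map T (prod_topology T T) (\<lambda>x. (a, x))"
    using a by (intro continuous_map_pairedI) (auto simp: topspace_eq)
  from continuous_map_compose[OF this continuous_mult] show ?thesis
    by (simp add: comp_def)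
qed

lemma openin_translate:
  assumes "openin T U" "a \<in> carrier G"
  shows "openin T {x \<in> carrier G. a \<otimes> x \<in> U}"
  using openin_continuous_map_preimage[OF continuous_translate[OF assms(2)] assms(1)]
  by (simp add: topspace_eq)

lemma continuous_division: "continuous_map (prod_topology T T) T (\<lambda>(x, y). x \<otimes> inv y)"
proof -
  have "continuous_map (prod_topology T T) (prod_topology T T) (\<lambda>p. (fst p, inv (snd p)))"
    by (intro continuous_map_pairedI continuous_map_fst
        continuous_map_compose[OF continuous_map_snd continuous_inv, unfolded comp_def])
  from continuous_map_compose[OF this continuous_mult] show ?thesis
    by (simp add: comp_def case_prod_unfold)
qed

lemma open_division:
  assumes "openin T U" "\<one> \<in> U"
  shows "\<exists>V. openin T V \<and> \<one> \<in> V \<and> (\<forall>x\<in>V. \<forall>y\<in>V. x \<otimes> inv y \<in> U)"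
proof -
  let ?S = "{p \<in> topspace (prod_topology T T). (\<lambda>(x, y). x \<otimes> inv y) p \<in> U}"
  have "openin (prod_topology T T) ?S"
    using openin_continuous_map_preimage[OF continuous_division assms(1)] .
  moreover have "(\<one>, \<one>) \<in> ?S" using assms(2) by (simp add: topspace_eq)
  ultimately obtain A B where "openin T A" "openin T B" "\<one> \<in> A" "\<one> \<in> B" "A \<times> B \<subseteq> ?S"
    unfolding openin_prod_topology_alt by meson
  then show ?thesis by (intro exI[of _ "A \<inter> B"]) auto
qed

text \<open>The quotients of \<open>V (Suc n)\<close> lie in \<open>V n\<close>, so the intersection
  of the sequence is a subgroup and the closures are nested as well.\<close>

lemma division_sequence:
  assumes "\<And>n::nat. openin T (Q n)" "\<And>n. \<one> \<in> Q n"
  shows "\<exists>V. (\<forall>n. openin T (V n) \<and> \<one> \<in> V n \<and> V n \<subseteq> Q n) \<and>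
    (\<forall>n. \<forall>x\<in>V (Suc n). \<forall>y\<in>V (Suc n). x \<otimes> inv y \<in> V n)"
proof -
  have "\<exists>V. \<forall>n. (openin T (V n) \<and> \<one> \<in> V n \<and> V n \<subseteq> Q n) \<and>
    (\<forall>x\<in>V (Suc n). \<forall>y\<in>V (Suc n). x \<otimes> inv y \<in> V n)"
  proof (rule dependent_nat_choice)
    show "\<exists>V. openin T V \<and> \<one> \<in> V \<and> V \<subseteq> Q 0" using assms by blast
    fix V and n :: nat assume V: "openin T V \<and> \<one> \<in> V \<and> V \<subseteq> Q n"
    then have "openin T V" "\<one> \<in> V" by simp_all
    from open_division[OF this] obtain W
      where W: "openin T W" "\<one> \<in> W" "\<forall>x\<in>W. \<forall>y\<in>W. x \<otimes> inv y \<in> V"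
      by (elim exE conjE)
    have "openin T (W \<inter> Q (Suc n))" "\<one> \<in> W \<inter> Q (Suc n)" using W assms by (auto intro: openin_Int)
    then show "\<exists>W. (openin T W \<and> \<one> \<in> W \<and> W \<subseteq> Q (Suc n)) \<and> (\<forall>x\<in>W. \<forall>y\<in>W. x \<otimes> inv y \<in> V)"
      using W(3) by (intro exI[of _ "W \<inter> Q (Suc n)"] conjI) simp_all
  qed
  then show ?thesis by (simp only: all_conj_distrib)
qed

text \<open>A closure point \<open>p\<close> has some \<open>v\<close> in V with
  \<open>inv p \<otimes> v\<close> in V as well, and \<open>p\<close> is the quotient of these
  two.\<close>

lemma closure_division:
  assumes "openin T V" "\<one> \<in> V" "\<forall>x\<in>V. \<forall>y\<in>V. x \<otimes> inv y \<in> U"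
  shows "T closure_of V \<subseteq> U"
proof
  fix p assume p: "p \<in> T closure_of V"
  then have pc: "p \<in> carrier G" by (simp add: in_closure_of topspace_eq)
  have "openin T {x \<in> carrier G. inv p \<otimes> x \<in> V}"
    using assms(1) pc by (intro openin_translate) auto
  moreover have "p \<in> {x \<in> carrier G. inv p \<otimes> x \<in> V}" using pc assms(2) by simp
  ultimately obtain v where v: "v \<in> V" "v \<in> carrier G" "inv p \<otimes> v \<in> V"
    using p[unfolded in_closure_of, THEN conjunct2, rule_format, of "{x \<in> carrier G. inv p \<otimes> x \<in> V}"]
    by auto
  have "v \<otimes> inv (inv p \<otimes> v) = p"
    using pc v by (simp add: inv_mult m_ac)
  then show "p \<in> U" using assms(3)[rule_format, OF v(1,3)] by simp
qed

lemma division_sequence_subgroup: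
  assumes V: "\<And>n::nat. openin T (V n)" "\<And>n. \<one> \<in> V n"
    and div: "\<And>n x y. x \<in> V (Suc n) \<Longrightarrow> y \<in> V (Suc n) \<Longrightarrow> x \<otimes> inv y \<in> V n"
  shows "subgroup (\<Inter>n. V n) G"
proof (rule subgroupI)
  have div': "x \<otimes> inv y \<in> (\<Inter>n. V n)" if "x \<in> (\<Inter>n. V n)" "y \<in> (\<Inter>n. V n)" for x y
    using that div by blast
  show sub: "(\<Inter>n. V n) \<subseteq> carrier G" using V(1) openin_carrier by blast
  show "(\<Inter>n. V n) \<noteq> {}" using V(2) by blast
  show inv: "inv a \<in> (\<Inter>n. V n)" if "a \<in> (\<Inter>n. V n)" for a
    using div'[OF _ that, of \<one>] V(2) sub that by (metis INT_I inv_closed l_one subsetD)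
  show "a \<otimes> b \<in> (\<Inter>n. V n)" if "a \<in> (\<Inter>n. V n)" "b \<in> (\<Inter>n. V n)" for a b
    using div'[OF that(1) inv[OF that(2)]] sub that by (metis inv_inv subsetD)
qed

end

lemma characters_iff:
  "\<phi> \<in> characters G T \<longleftrightarrow> \<phi> \<in> extensional (carrier G) \<and> \<phi> \<in> hom G circle_group \<and>
     continuous_map T circle_topology \<phi>"
  by (simp add: characters_def)

lemma topspace_circle [simp]: "topspace circle_topology = sphere 0 1"
  by (simp add: circle_topology_def)

text \<open>The family must be nonempty because the empty intersection is \<open>UNIV\<close> rather
  than the carrier.\<close>

locale P_group = topological_abelian_group +
  assumes openin_countable_Inter:
    "countable \<U> \<Longrightarrow> \<U> \<noteq> {} \<Longrightarrow> (\<And>U. U \<in> \<U> \<Longrightarrow> openin T U) \<Longrightarrow> openin T (\<Inter>\<U>)"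
begin

lemma openin_INT_nat: "(\<And>n::nat. openin T (V n)) \<Longrightarrow> openin T (\<Inter>n. V n)"
  by (rule openin_countable_Inter) auto

lemma openin_remove_point: "a \<in> carrier G \<Longrightarrow> openin T (carrier G - {a})"
  using closedin_Hausdorff_singleton[OF Hausdorff, of a] by (simp add: closedin_def topspace_eq)

lemma openin_remove_countable:
  assumes "countable S" "S \<subseteq> carrier G"
  shows "openin T (carrier G - S)"
proof -
  have "openin T (\<Inter>(insert (carrier G) ((\<lambda>a. carrier G - {a}) ` S)))"
    by (rule openin_countable_Inter) (use assms openin_remove_point openin_carrier_self in auto)
  moreover have "\<Inter>(insert (carrier G) ((\<lambda>a. carrier G - {a}) ` S)) = carrier G - S" by auto
  ultimately show ?thesis by simp
qed

text \<open>Countable sets are closed. For a countably infinite subset \<open>S\<close> of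
  \<open>K\<close>, the open sets \<open>carrier G - (S - {s})\<close> cover \<open>K\<close> and
  contain one point of \<open>S\<close> each, so no finite subfamily covers
  \<open>K\<close>.\<close>

lemma compactin_finite:
  assumes "compactin T K" shows "finite K"
proof (rule ccontr)
  assume "infinite K"
  then obtain S where S: "S \<subseteq> K" "countable S" "infinite S"
    using infinite_countable_subset' by blast
  have Kc: "K \<subseteq> carrier G" using compactin_subset_topspace[OF assms] by (simp add: topspace_eq)
  let ?\<U> = "(\<lambda>s. carrier G - (S - {s})) ` S"
  have "\<forall>U\<in>?\<U>. openin T U"
    using S Kc by (auto intro!: openin_remove_countable)
  moreover have "K \<subseteq> \<Union>?\<U>"
  proof
    fix x assume x: "x \<in> K"
    obtain s where "s \<in> S" using S(3) by fastforce
    then show "x \<in> \<Union>?\<U>" using x Kc by (cases "x \<in> S") auto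
  qed
  ultimately obtain \<F> where \<F>: "finite \<F>" "\<F> \<subseteq> ?\<U>" "K \<subseteq> \<Union>\<F>"
    using assms unfolding compactin_def by meson
  obtain S0 where S0: "finite S0" "S0 \<subseteq> S" "\<F> = (\<lambda>s. carrier G - (S - {s})) ` S0"
    using finite_subset_image[OF \<F>(1,2)] by blast
  have "S \<subseteq> S0"
  proof
    fix s assume s: "s \<in> S"
    then obtain t where "t \<in> S0" "s \<in> carrier G - (S - {t})" using S(1) \<F>(3) S0(3) by blast
    then show "s \<in> S0" using s by blast
  qed
  then show False using S0(1) S(3) finite_subset by blast
qed

lemma open_subgroup_inside:
  assumes "openin T U" "\<one> \<in> U"
  shows "\<exists>N. subgroup N G \<and> openin T N \<and> N \<subseteq> U"
proof -
  obtain V where V: "\<forall>n::nat. openin T (V n) \<and> \<one> \<in> V n \<and> V n \<subseteq> U"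
    "\<forall>n. \<forall>x\<in>V (Suc n). \<forall>y\<in>V (Suc n). x \<otimes> inv y \<in> V n"
    using division_sequence[of "\<lambda>_. U"] assms by blast
  have "subgroup (\<Inter>n. V n) G" using V by (intro division_sequence_subgroup) auto
  moreover have "openin T (\<Inter>n. V n)" using V by (intro openin_INT_nat) auto
  moreover have "(\<Inter>n. V n) \<subseteq> U" using V(1) by blast
  ultimately show ?thesis by blast
qed

text \<open>The point 1 of the circle is a \<open>G\<^sub>\<delta>\<close>, so the kernel of a
  continuous character is open. Conversely, a homomorphism trivial near the identity is locally
  constant.\<close>

lemma continuous_character_iff:
  assumes "\<phi> \<in> hom G circle_group"
  shows "continuous_map T circle_topology \<phi> \<longleftrightarrow> (\<exists>N. openin T N \<and> \<one> \<in> N \<and> (\<forall>x\<in>N. \<phi> x = 1))"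
proof
  assume cont: "continuous_map T circle_topology \<phi>"
  let ?V = "\<lambda>n. {x \<in> topspace T. \<phi> x \<in> sphere 0 1 \<inter> ball 1 (inverse (real (Suc n)))}"
  have "openin T (?V n)" for n
    by (rule openin_continuous_map_preimage[OF cont])
       (auto simp: circle_topology_def openin_open intro!: exI[of _ "ball 1 (inverse (real (Suc n)))"])
  then have "openin T (\<Inter>n. ?V n)" by (rule openin_INT_nat)
  moreover have "\<one> \<in> (\<Inter>n. ?V n)"
    using hom_circle_one[OF assms] by (auto simp: topspace_eq)
  moreover have "\<phi> x = 1" if "x \<in> (\<Inter>n. ?V n)" for x
  proof (rule ccontr)
    assume "\<phi> x \<noteq> 1"
    then obtain n where "inverse (real (Suc n)) < dist 1 (\<phi> x)"
      using reals_Archimedean[of "dist 1 (\<phi> x)"] by auto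
    moreover have "dist 1 (\<phi> x) < inverse (real (Suc n))" using that by auto
    ultimately show False by simp
  qed
  ultimately show "\<exists>N. openin T N \<and> \<one> \<in> N \<and> (\<forall>x\<in>N. \<phi> x = 1)" by blast
next
  assume "\<exists>N. openin T N \<and> \<one> \<in> N \<and> (\<forall>x\<in>N. \<phi> x = 1)"
  then obtain N where N: "openin T N" "\<one> \<in> N" "\<And>x. x \<in> N \<Longrightarrow> \<phi> x = 1" by blast
  show "continuous_map T circle_topology \<phi>"
    unfolding continuous_map_def
  proof (intro conjI allI impI)
    show "\<phi> \<in> topspace T \<rightarrow> topspace circle_topology"
      using hom_circle_norm[OF assms] by (auto simp: topspace_eq)
    fix U
    show "openin T {x \<in> topspace T. \<phi> x \<in> U}"
    proof (subst openin_subopen, intro ballI)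
      fix x assume x: "x \<in> {x \<in> topspace T. \<phi> x \<in> U}"
      then have xc: "x \<in> carrier G" by (simp add: topspace_eq)
      let ?W = "{y \<in> carrier G. inv x \<otimes> y \<in> N}"
      have "openin T ?W" by (rule openin_translate[OF N(1)]) (simp add: xc)
      moreover have "x \<in> ?W" using xc N(2) by simp
      moreover have "?W \<subseteq> {x \<in> topspace T. \<phi> x \<in> U}"
      proof
        fix y assume y: "y \<in> ?W"
        have "\<phi> (x \<otimes> (inv x \<otimes> y)) = \<phi> x * \<phi> (inv x \<otimes> y)"
          using xc y by (intro hom_circle_mult[OF assms]) auto
        then have "\<phi> y = \<phi> x" using N(3) y xc by (simp flip: m_assoc)
        then show "y \<in> {x \<in> topspace T. \<phi> x \<in> U}" using x y by (simp add: topspace_eq)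
      qed
      ultimately show "\<exists>W. openin T W \<and> x \<in> W \<and> W \<subseteq> {x \<in> topspace T. \<phi> x \<in> U}" by blast
    qed
  qed
qed

lemma characters_trivial_near_one:
  "\<phi> \<in> characters G T \<longleftrightarrow> \<phi> \<in> extensional (carrier G) \<and> \<phi> \<in> hom G circle_group \<and>
    (\<exists>N. openin T N \<and> \<one> \<in> N \<and> (\<forall>x\<in>N. \<phi> x = 1))"
  using continuous_character_iff by (auto simp: characters_iff)

lemma restrict_hom_circle:
  assumes "\<phi> \<in> hom G circle_group"
  shows "restrict \<phi> (carrier G) \<in> hom G circle_group"
  using assms by (auto simp: hom_def)

text \<open>The subgroup generated by \<open>F\<close> and \<open>x\<close> is countable, so some
  open subgroup \<open>N\<close> meets it only in the identity. Requiring triviality on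
  \<open>N\<close> too then adds no relation on the powers of \<open>x\<close>, and it makes the
  extended homomorphism continuous.\<close>

lemma rich_characters: "rich_character_family G (characters G T)"
proof unfold_locales
  show "\<phi> \<in> hom G circle_group" if "\<phi> \<in> characters G T" for \<phi> using that by (simp add: characters_iff)
  show "(\<lambda>x\<in>carrier G. 1) \<in> characters G T"
    unfolding characters_trivial_near_one
    using openin_carrier_self by (auto simp: hom_def intro!: exI[of _ "carrier G"])
  show "(\<lambda>x\<in>carrier G. \<phi> x * \<psi> x) \<in> characters G T"
    if \<phi>: "\<phi> \<in> characters G T" and \<psi>: "\<psi> \<in> characters G T" for \<phi> \<psi>
  proof -
    from \<phi> obtain N where N: "openin T N" "\<one> \<in> N" "\<forall>x\<in>N. \<phi> x = 1" "\<phi> \<in> hom G circle_group"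
      unfolding characters_trivial_near_one by blast
    from \<psi> obtain M where M: "openin T M" "\<one> \<in> M" "\<forall>x\<in>M. \<psi> x = 1" "\<psi> \<in> hom G circle_group"
      unfolding characters_trivial_near_one by blast
    have "(\<lambda>x\<in>carrier G. \<phi> x * \<psi> x) \<in> hom G circle_group"
      using N(4) M(4) by (auto simp: hom_def norm_mult Pi_iff mult_ac)
    then show ?thesis
      unfolding characters_trivial_near_one
      using N M openin_carrier[OF N(1)] by (auto intro!: exI[of _ "N \<inter> M"])
  qed
  show "(\<lambda>x\<in>carrier G. inverse (\<phi> x)) \<in> characters G T" if \<phi>: "\<phi> \<in> characters G T" for \<phi>
  proof -
    from \<phi> obtain N where N: "openin T N" "\<one> \<in> N" "\<forall>x\<in>N. \<phi> x = 1" "\<phi> \<in> hom G circle_group"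
      unfolding characters_trivial_near_one by blast
    have "(\<lambda>x\<in>carrier G. inverse (\<phi> x)) \<in> hom G circle_group"
      using N(4) by (auto simp: hom_def norm_inverse Pi_iff)
    then show ?thesis
      unfolding characters_trivial_near_one
      using N openin_carrier[OF N(1)] by (auto intro!: exI[of _ N])
  qed
next
  fix F x and z :: complex
  assume F: "finite F" "F \<subseteq> carrier G" and x: "x \<in> carrier G" and z: "norm z = 1"
    and compat: "\<And>k::int. x [^] k \<in> generate G F \<Longrightarrow> z powi k = 1"
  let ?H = "generate G (insert x F)"
  have xF: "insert x F \<subseteq> carrier G" using F x by simp
  have H: "subgroup ?H G" by (rule generate_is_subgroup[OF xF])
  have "openin T (carrier G - (?H - {\<one>}))"
    using countable_generate[of "insert x F"] F x subgroup.subset[OF H]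
    by (intro openin_remove_countable) (auto intro: countable_finite)
  then obtain N where N: "subgroup N G" "openin T N" "N \<subseteq> carrier G - (?H - {\<one>})"
    using open_subgroup_inside by fastforce
  have gF: "subgroup (generate G F) G" by (rule generate_is_subgroup[OF F(2)])
  let ?L = "{h \<otimes> n | h n. h \<in> generate G F \<and> n \<in> N}"
  have sub: "generate G F \<subseteq> ?H" by (rule mono_generate) auto
  have "\<exists>\<phi>\<in>hom G circle_group. (\<forall>l\<in>?L. \<phi> l = 1) \<and> \<phi> x = z"
  proof (rule hom_circle_extension[OF subgroup_product[OF gF N(1)] x z])
    fix k :: int assume "x [^] k \<in> ?L"
    then obtain h n where hn: "x [^] k = h \<otimes> n" "h \<in> generate G F" "n \<in> N" by blast
    have c: "h \<in> carrier G" "n \<in> carrier G"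
      using hn subgroup.mem_carrier[OF gF] subgroup.mem_carrier[OF N(1)] by auto
    have "n = inv h \<otimes> x [^] k" using hn(1) c by (simp add: m_assoc[symmetric])
    moreover have "x [^] k \<in> ?H"
      by (rule subgroup_int_pow_closed[OF H]) (simp add: generate.incl)
    ultimately have "n \<in> ?H"
      using hn(2) sub subgroup.m_closed[OF H] subgroup.m_inv_closed[OF H] by blast
    then have "n = \<one>" using hn(3) N(3) by blast
    then have "x [^] k = h" using hn(1) c by simp
    then show "z powi k = 1" using compat[of k] hn(2) by simp
  qed
  then obtain \<phi> where \<phi>: "\<phi> \<in> hom G circle_group" "\<And>l. l \<in> ?L \<Longrightarrow> \<phi> l = 1" "\<phi> x = z" by blast
  have NL: "n \<in> ?L" if "n \<in> N" for n
    using that generate.one[of G F] subgroup.mem_carrier[OF N(1)] by force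
  have FL: "y \<in> ?L" if "y \<in> F" for y
    using that generate.incl[of y F G] F(2) subgroup.one_closed[OF N(1)] by force
  have "restrict \<phi> (carrier G) \<in> characters G T"
    unfolding characters_trivial_near_one
    using restrict_hom_circle[OF \<phi>(1)] N(1,2) \<phi>(2)[OF NL] subgroup.one_closed[OF N(1)]
      subgroup.mem_carrier[OF N(1)]
    by (auto intro!: exI[of _ N])
  moreover have "restrict \<phi> (carrier G) y = 1" if "y \<in> F" for y
    using \<phi>(2)[OF FL[OF that]] F that by auto
  ultimately show "\<exists>\<phi>\<in>characters G T. (\<forall>y\<in>F. \<phi> y = 1) \<and> \<phi> x = z"
    using \<phi>(3) x by (intro bexI[of _ "restrict \<phi> (carrier G)"]) auto
qed

sublocale rich_character_family G "characters G T"
  by (rule rich_characters)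

abbreviation "dualT \<equiv> dual_topology G T"

lemma openin_dual_pointwise:
  "openin dualT U \<longleftrightarrow> U \<subseteq> characters G T \<and>
     (\<forall>\<phi>\<in>U. \<exists>F e. finite F \<and> F \<subseteq> carrier G \<and> e > 0 \<and>
        {\<psi> \<in> characters G T. \<forall>x\<in>F. dist (\<psi> x) (\<phi> x) < e} \<subseteq> U)"
proof -
  have "compactin T K \<longleftrightarrow> finite K \<and> K \<subseteq> carrier G" for K
    using compactin_finite finite_imp_compactin_eq[of K T] by (auto simp: topspace_eq)
  then show ?thesis unfolding openin_dual_topology by (simp add: conj_assoc)
qed

definition annihilator :: "'a set \<Rightarrow> ('a \<Rightarrow> complex) set" where
  "annihilator N = {\<phi> \<in> characters G T. \<forall>x\<in>N. \<phi> x = 1}"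

text \<open>Continuity is automatic for homomorphisms trivial on the open set \<open>N\<close>, so
  the annihilator is cut out of the compact product of circles by equations alone and is closed
  there.\<close>

lemma compactin_annihilator:
  assumes N: "openin T N" "\<one> \<in> N"
  shows "compactin dualT (annihilator N)"
proof -
  let ?P = "product_topology (\<lambda>_. circle_topology) (carrier G)"
  let ?PN = "subtopology ?P (annihilator N)"
  have proj: "continuous_map ?P euclidean (\<lambda>f. f x)" if "x \<in> carrier G" for x
  proof -
    have "continuous_map ?P circle_topology (\<lambda>f. f x)"
      using that by (rule continuous_map_product_projection)
    then show ?thesis unfolding circle_topology_def by (rule continuous_map_into_fulltopology)
  qed
  have mult: "continuous_map ?P euclidean (\<lambda>f. f x * f y)" if "x \<in> carrier G" "y \<in> carrier G" for x y
  proof -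
    have "continuous_map ?P (prod_topology euclidean euclidean) (\<lambda>f. (f x, f y))"
      using that by (intro continuous_map_pairedI proj)
    moreover have "continuous_map (prod_topology euclidean euclidean) euclidean (\<lambda>p :: complex \<times> complex. fst p * snd p)"
      by (simp add: euclidean_product_topology) (intro continuous_intros)
    ultimately have "continuous_map ?P euclidean ((\<lambda>p. fst p * snd p) \<circ> (\<lambda>f. (f x, f y)))"
      by (rule continuous_map_compose)
    then show ?thesis by (simp add: comp_def)
  qed
  define A where "A x y = {f \<in> topspace ?P. f (x \<otimes> y) = f x * f y}" for x y
  define B where "B x = {f \<in> topspace ?P. f x = 1}" for x
  have A: "closedin ?P (A x y)" if "x \<in> carrier G" "y \<in> carrier G" for x y
    unfolding A_def using that
    by (intro closedin_continuous_maps_eq[where Y = euclidean] Hausdorff_space_euclidean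
        mult proj) auto
  have B: "closedin ?P (B x)" if "x \<in> carrier G" for x
    unfolding B_def using that
    by (intro closedin_continuous_maps_eq[where Y = euclidean] Hausdorff_space_euclidean proj) auto
  have Nc: "N \<subseteq> carrier G" using N openin_carrier by blast
  let ?S = "(\<Inter>x\<in>carrier G. \<Inter>y\<in>carrier G. A x y) \<inter> (\<Inter>x\<in>N. B x)"
  have "closedin ?P ?S"
    using A B Nc N(2) one_closed by (intro closedin_Int closedin_Inter) (blast+)
  moreover have "compact_space ?P"
    by (auto simp: compact_space_product_topology circle_topology_def compact_space_subtopology)
  ultimately have comp: "compactin ?P ?S" by (simp add: closedin_compact_space)
  have S: "?S = annihilator N"
  proof (intro subset_antisym subsetI)
    fix f assume f: "f \<in> ?S"
    then have "f \<in> topspace ?P" unfolding A_def by blast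
    then have "f \<in> extensional (carrier G)" "\<And>x. x \<in> carrier G \<Longrightarrow> f x \<in> sphere 0 1"
      by (auto simp: PiE_def)
    moreover have "f \<in> hom G circle_group"
    proof (rule homI)
      fix x y assume "x \<in> carrier G" "y \<in> carrier G"
      then have "f \<in> A x y" using f by blast
      then show "f (x \<otimes> y) = f x \<otimes>\<^bsub>circle_group\<^esub> f y" by (simp add: A_def)
    qed (use calculation(2) in simp)
    moreover have "\<forall>x\<in>N. f x = 1" using f unfolding B_def by blast
    ultimately show "f \<in> annihilator N"
      using N by (auto simp: annihilator_def characters_trivial_near_one)
  next
    fix f assume f: "f \<in> annihilator N"
    then have "f \<in> extensional (carrier G)" "f \<in> hom G circle_group" "\<forall>x\<in>N. f x = 1"
      by (auto simp: annihilator_def characters_iff)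
    then show "f \<in> ?S" by (auto simp: A_def B_def PiE_def hom_def)
  qed
  \<comment> \<open>Compact subsets of a P-group are finite, so uniform convergence on them is no
    finer than coordinatewise convergence.\<close>
  have "continuous_map ?PN dualT id"
    unfolding continuous_map_def
  proof (intro conjI allI impI)
    show "id \<in> topspace ?PN \<rightarrow> topspace dualT"
      by (auto simp: annihilator_def)
    fix U assume U: "openin dualT U"
    show "openin ?PN {f \<in> topspace ?PN. id f \<in> U}"
    proof (subst openin_subopen, intro ballI)
      fix f assume f: "f \<in> {f \<in> topspace ?PN. id f \<in> U}"
      then obtain F e where F: "finite F" "F \<subseteq> carrier G" "e > 0"
        "{\<psi> \<in> characters G T. \<forall>x\<in>F. dist (\<psi> x) (f x) < e} \<subseteq> U"
        using U unfolding openin_dual_pointwise by force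
      define W where "W = topspace ?P \<inter> (\<Inter>x\<in>F. {g \<in> topspace ?P. g x \<in> ball (f x) e})"
      have o: "openin ?P {g \<in> topspace ?P. g x \<in> ball (f x) e}" if "x \<in> F" for x
        by (rule openin_continuous_map_preimage[OF proj]) (use that F in auto)
      have "openin ?P W"
      proof (cases "F = {}")
        case True
        then have "W = topspace ?P" by (simp only: W_def image_empty Inter_empty Int_UNIV_right)
        then show ?thesis by (simp only: openin_topspace)
      next
        case False
        have "openin ?P (\<Inter>x\<in>F. {g \<in> topspace ?P. g x \<in> ball (f x) e})"
          by (rule openin_Inter) (use F(1) False o in blast)+
        then show ?thesis unfolding W_def by (rule openin_Int[OF openin_topspace])
      qed
      then have "openin ?PN (annihilator N \<inter> W)"
        by (rule openin_subtopology_Int2)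
      moreover have "f \<in> annihilator N \<inter> W" using f F by (auto simp: W_def)
      moreover have "annihilator N \<inter> W \<subseteq> {f \<in> topspace ?PN. id f \<in> U}"
        using F(4) by (auto simp: W_def annihilator_def dist_commute subset_iff)
      ultimately show "\<exists>V. openin ?PN V \<and> f \<in> V \<and>
        V \<subseteq> {f \<in> topspace ?PN. id f \<in> U}" by blast
    qed
  qed
  moreover have "compactin ?PN (annihilator N)"
    using comp S by (simp add: compactin_subtopology)
  ultimately have "compactin dualT (id ` annihilator N)"
    by (intro image_compactin)
  then show ?thesis by simp
qed

lemma dual_group_simps [simp]:
  "carrier (dual_group G T) = characters G T"
  "\<phi> \<otimes>\<^bsub>dual_group G T\<^esub> \<psi> = (\<lambda>x\<in>carrier G. \<phi> x * \<psi> x)"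
  "\<one>\<^bsub>dual_group G T\<^esub> = (\<lambda>x\<in>carrier G. 1)"
  by (simp_all add: dual_group_def)

abbreviation "bidual \<equiv> characters (dual_group G T) dualT"

abbreviation "ev \<equiv> evaluation G T"

lemma evaluation_in_bidual:
  assumes a: "a \<in> carrier G"
  shows "ev a \<in> bidual"
proof -
  have "ev a \<in> hom (dual_group G T) circle_group"
    using a X_mult by (auto simp: hom_def evaluation_def X_norm)
  moreover have "continuous_map dualT circle_topology (ev a)"
    unfolding continuous_map_def
  proof (intro conjI allI impI)
    show "ev a \<in> topspace dualT \<rightarrow> topspace circle_topology"
      using a X_norm by (auto simp: evaluation_def)
    fix V assume "openin circle_topology V"
    then obtain W where W: "open W" "V = sphere 0 1 \<inter> W"
      unfolding circle_topology_def openin_open by auto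
    show "openin dualT {\<phi> \<in> topspace dualT. ev a \<phi> \<in> V}"
      unfolding openin_dual_pointwise
    proof (intro conjI ballI)
      fix \<phi> assume "\<phi> \<in> {\<phi> \<in> topspace dualT. ev a \<phi> \<in> V}"
      then have "\<phi> a \<in> W" using a W by (auto simp: evaluation_def)
      then obtain e where e: "e > 0" "\<And>z. dist z (\<phi> a) < e \<Longrightarrow> z \<in> W"
        using W(1) unfolding open_dist by blast
      show "\<exists>F e. finite F \<and> F \<subseteq> carrier G \<and> e > 0 \<and> {\<psi> \<in> characters G T. \<forall>x\<in>F. dist (\<psi> x) (\<phi> x) < e}
         \<subseteq> {\<phi> \<in> topspace dualT. ev a \<phi> \<in> V}"
        using e a W X_norm
        by (intro exI[of _ "{a}"] exI[of _ e]) (auto simp: evaluation_def)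
    qed auto
  qed
  ultimately show ?thesis using a by (auto simp: characters_iff evaluation_def)
qed

text \<open>The preimage of the unit ball about 1 is a pointwise neighbourhood of the trivial
  character, so \<Phi> is controlled by finitely many points.\<close>

lemma evaluation_surj:
  assumes \<Phi>: "\<Phi> \<in> bidual"
  shows "\<exists>a\<in>carrier G. \<Phi> = ev a"
proof -
  have hom: "\<Phi> \<in> hom (dual_group G T) circle_group" and ext: "\<Phi> \<in> extensional (characters G T)"
    and cont: "continuous_map dualT circle_topology \<Phi>"
    using \<Phi> by (auto simp: characters_iff)
  have XX: "X_char \<Phi>" using hom by (auto simp: X_char_def hom_def)
  let ?U = "{\<phi> \<in> topspace dualT. \<Phi> \<phi> \<in> sphere 0 1 \<inter> ball 1 1}"
  have "openin dualT ?U"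
    by (rule openin_continuous_map_preimage[OF cont])
       (auto simp: circle_topology_def openin_open)
  moreover have "(\<lambda>x\<in>carrier G. 1) \<in> ?U" using X_one X_char_one[OF XX] by simp
  ultimately obtain F e where F: "finite F" "F \<subseteq> carrier G" "e > 0"
     "{\<psi> \<in> characters G T. \<forall>x\<in>F. dist (\<psi> x) ((\<lambda>x\<in>carrier G. 1) x) < e} \<subseteq> ?U"
    unfolding openin_dual_pointwise by meson
  have "controlled \<Phi> F"
    unfolding controlled_def
  proof (intro exI[of _ e] conjI ballI impI F(3))
    fix \<phi> assume "\<phi> \<in> characters G T" "\<forall>x\<in>F. dist (\<phi> x) 1 < e"
    then have "\<phi> \<in> ?U" using F(2,4) by (auto simp: subset_iff)
    then show "dist (\<Phi> \<phi>) 1 < 1" by (simp add: dist_commute)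
  qed
  then obtain a where a: "a \<in> carrier G" "\<forall>\<phi>\<in>characters G T. \<Phi> \<phi> = \<phi> a"
    using controlled_is_evaluation[OF F(1,2) XX] by blast
  have "\<Phi> = ev a"
    by (rule extensionalityI[OF ext]) (use a in \<open>auto simp: evaluation_def\<close>)
  then show ?thesis using a(1) by blast
qed

lemma characters_separate_subgroup:
  assumes N: "subgroup N G" "openin T N" and x: "x \<in> carrier G" "x \<notin> N"
  shows "\<exists>\<phi>\<in>annihilator N. \<phi> x \<noteq> 1"
proof -
  obtain \<phi> where \<phi>: "\<phi> \<in> hom G circle_group" "\<forall>l\<in>N. \<phi> l = 1" "\<phi> x \<noteq> 1"
    using circle_separates_subgroup[OF N(1) x] by blast
  have "restrict \<phi> (carrier G) \<in> annihilator N"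
    unfolding annihilator_def characters_trivial_near_one
    using \<phi> restrict_hom_circle[OF \<phi>(1)] N subgroup.one_closed[OF N(1)] subgroup.mem_carrier[OF N(1)]
    by (auto intro!: exI[of _ N])
  then show ?thesis using \<phi>(3) x by (intro bexI[of _ "restrict \<phi> (carrier G)"]) auto
qed

lemma evaluation_inj: "inj_on (ev) (carrier G)"
proof (rule inj_onI, rule ccontr)
  fix x y assume xy: "x \<in> carrier G" "y \<in> carrier G" "ev x = ev y" "x \<noteq> y"
  let ?a = "x \<otimes> inv y"
  have a: "?a \<in> carrier G" "?a \<noteq> \<one>" using xy by (auto simp: inv_equality dest: inv_equality)
  then obtain N where N: "subgroup N G" "openin T N" "N \<subseteq> carrier G - {?a}"
    using open_subgroup_inside[OF openin_remove_point[OF a(1)]] by auto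
  then obtain \<phi> where \<phi>: "\<phi> \<in> annihilator N" "\<phi> ?a \<noteq> 1"
    using characters_separate_subgroup[OF N(1,2) a(1)] by blast
  then have ch: "\<phi> \<in> characters G T" by (simp add: annihilator_def)
  have "\<phi> x = \<phi> y" using fun_cong[OF xy(3), of \<phi>] ch xy by (simp add: evaluation_def)
  moreover have "\<phi> ?a = \<phi> x * inverse (\<phi> y)"
    using hom_circle_mult[OF X_hom[OF ch]] hom_circle_inv[OF X_hom[OF ch]] xy by simp
  moreover have "\<phi> y \<noteq> 0" using X_norm[OF ch xy(2)] by auto
  ultimately show False using \<phi>(2) by simp
qed

lemma evaluation_iso: "ev \<in> iso G (dual_group (dual_group G T) dualT)"
proof -
  have "ev \<in> hom G (dual_group (dual_group G T) dualT)"
  proof (rule homI)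
    fix x y assume xy: "x \<in> carrier G" "y \<in> carrier G"
    show "ev (x \<otimes> y) =
      ev x \<otimes>\<^bsub>dual_group (dual_group G T) dualT\<^esub> ev y"
      using xy by (auto simp: dual_group_def[of "dual_group G T"] evaluation_def
          hom_circle_mult[OF X_hom])
  qed (simp add: dual_group_def[of "dual_group G T"] evaluation_in_bidual)
  moreover have "ev ` carrier G = bidual"
    using evaluation_in_bidual evaluation_surj by blast
  ultimately show ?thesis
    using evaluation_inj by (simp add: iso_def bij_betw_def dual_group_def[of "dual_group G T"])
qed

text \<open>The hypothesis serves the continuity of \<open>ev\<close>. Openness comes from
  compactness of annihilators: if \<open>ev y\<close> is within 1 of \<open>ev x\<close> on the
  annihilator of an open subgroup \<open>N\<close>, every character in it sends
  \<open>inv x \<otimes> y\<close> to 1, so this element lies in \<open>N\<close>.\<close>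

theorem reflexive_if_compact_equicontinuous:
  assumes equi: "\<And>C. compactin dualT C \<Longrightarrow>
    \<exists>U. openin T U \<and> \<one> \<in> U \<and> (\<forall>\<phi>\<in>C. \<forall>x\<in>U. \<phi> x = 1)"
  shows "reflexive G T"
proof -
  let ?B = "dual_topology (dual_group G T) dualT"
  have top: "topspace ?B = bidual" by simp
  have img: "ev ` carrier G = bidual"
    using evaluation_in_bidual evaluation_surj by blast
  have "homeomorphic_map T ?B (ev)"
  proof (rule bijective_open_imp_homeomorphic_map)
    show "ev ` topspace T = topspace ?B" using img by (simp add: topspace_eq)
    show "inj_on (ev) (topspace T)" using evaluation_inj by (simp add: topspace_eq)
    show "continuous_map T ?B (ev)"
      unfolding continuous_map_def
    proof (intro conjI allI impI)
      show "ev \<in> topspace T \<rightarrow> topspace ?B" using img by (auto simp: topspace_eq)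
      fix U assume U: "openin ?B U"
      show "openin T {x \<in> topspace T. ev x \<in> U}"
      proof (subst openin_subopen, intro ballI)
        fix x assume x: "x \<in> {x \<in> topspace T. ev x \<in> U}"
        then have xc: "x \<in> carrier G" by (simp add: topspace_eq)
        obtain C e where C: "compactin dualT C" "e > 0"
          "{\<Psi> \<in> bidual. \<forall>\<phi>\<in>C. dist (\<Psi> \<phi>) (ev x \<phi>) < e} \<subseteq> U"
          using U x unfolding openin_dual_topology[of "dual_group G T"] by blast
        obtain W where W: "openin T W" "\<one> \<in> W" "\<forall>\<phi>\<in>C. \<forall>x\<in>W. \<phi> x = 1"
          using equi[OF C(1)] by blast
        have Cc: "C \<subseteq> characters G T" using compactin_subset_topspace[OF C(1)] by simp
        let ?V = "{y \<in> carrier G. inv x \<otimes> y \<in> W}"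
        have "openin T ?V" by (rule openin_translate[OF W(1)]) (simp add: xc)
        moreover have "x \<in> ?V" using xc W(2) by simp
        moreover have "ev y \<in> U" if y: "y \<in> ?V" for y
        proof -
          have "\<phi> y = \<phi> x" if "\<phi> \<in> C" for \<phi>
          proof -
            have "\<phi> (x \<otimes> (inv x \<otimes> y)) = \<phi> x * \<phi> (inv x \<otimes> y)"
              using that Cc xc y by (intro hom_circle_mult[OF X_hom]) auto
            then show ?thesis using W(3) that y xc by (simp add: m_assoc[symmetric])
          qed
          then have "ev y \<phi> = ev x \<phi>" if "\<phi> \<in> C" for \<phi>
            using that Cc xc y by (auto simp: evaluation_def)
          then have "\<forall>\<phi>\<in>C. dist (ev y \<phi>) (ev x \<phi>) < e"
            using C(2) by simp
          then show ?thesis using C(3) y evaluation_in_bidual by blast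
        qed
        ultimately show "\<exists>V. openin T V \<and> x \<in> V \<and> V \<subseteq> {x \<in> topspace T. ev x \<in> U}"
          by (intro exI[of _ ?V]) (auto simp: topspace_eq)
      qed
    qed
    show "open_map T ?B (ev)"
      unfolding open_map_def
    proof (intro allI impI)
      fix U assume U: "openin T U"
      have Uc: "U \<subseteq> carrier G" by (rule openin_carrier[OF U])
      show "openin ?B (ev ` U)"
        unfolding openin_dual_topology[of "dual_group G T"]
      proof (intro conjI ballI)
        show "ev ` U \<subseteq> bidual" using Uc evaluation_in_bidual by blast
        fix \<Phi> assume "\<Phi> \<in> ev ` U"
        then obtain x where x: "x \<in> U" "\<Phi> = ev x" by blast
        have xc: "x \<in> carrier G" using x Uc by blast
        have "openin T {y \<in> carrier G. x \<otimes> y \<in> U}" by (rule openin_translate[OF U xc])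
        moreover have "\<one> \<in> {y \<in> carrier G. x \<otimes> y \<in> U}" using x xc by simp
        ultimately obtain N where N: "subgroup N G" "openin T N" "N \<subseteq> {y \<in> carrier G. x \<otimes> y \<in> U}"
          using open_subgroup_inside by meson
        have N1: "\<one> \<in> N" by (rule subgroup.one_closed[OF N(1)])
        have "{\<Psi> \<in> bidual. \<forall>\<phi>\<in>annihilator N. dist (\<Psi> \<phi>) (\<Phi> \<phi>) < 1} \<subseteq> ev ` U"
        proof
          fix \<Psi> assume \<Psi>: "\<Psi> \<in> {\<Psi> \<in> bidual. \<forall>\<phi>\<in>annihilator N. dist (\<Psi> \<phi>) (\<Phi> \<phi>) < 1}"
          then obtain y where y: "y \<in> carrier G" "\<Psi> = ev y"
            using evaluation_surj by blast
          have near: "dist (\<phi> y) (\<phi> x) < 1" if "\<phi> \<in> annihilator N" for \<phi>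
            using \<Psi> that y x xc by (auto simp: evaluation_def annihilator_def)
          have "inv x \<otimes> y \<in> N"
          proof (rule ccontr)
            assume "inv x \<otimes> y \<notin> N"
            then obtain \<phi> where \<phi>: "\<phi> \<in> annihilator N" "\<phi> (inv x \<otimes> y) \<noteq> 1"
              using characters_separate_subgroup[OF N(1,2)] xc y by blast
            have ch: "\<phi> \<in> characters G T" using \<phi> by (simp add: annihilator_def)
            have w: "\<phi> (inv x \<otimes> y) = inverse (\<phi> x) * \<phi> y"
              using hom_circle_mult[OF X_hom[OF ch]] hom_circle_inv[OF X_hom[OF ch]] xc y by simp
            have n: "norm (\<phi> x) = 1" "norm (\<phi> y) = 1" using X_norm[OF ch] xc y by auto
            then have nz: "\<phi> x \<noteq> 0" by auto
            have "\<phi> (inv x \<otimes> y) = 1"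
            proof (rule no_small_subgroup)
              show "norm (\<phi> (inv x \<otimes> y)) = 1" using X_norm[OF ch] xc y by simp
              fix k :: nat
              \<comment> \<open>The annihilator is closed under powers, so the single radius 1
                bounds all powers of the value at once.\<close>
              have "(\<lambda>x\<in>carrier G. \<phi> x ^ k) \<in> annihilator N"
                using X_power[OF ch] \<phi>(1) openin_carrier[OF N(2)] by (auto simp: annihilator_def)
              from near[OF this] have d: "norm (\<phi> y ^ k - \<phi> x ^ k) < 1" using xc y by (simp add: dist_norm)
              have "\<phi> (inv x \<otimes> y) ^ k - 1 = inverse (\<phi> x) ^ k * (\<phi> y ^ k - \<phi> x ^ k)"
                using nz by (simp add: w power_mult_distrib field_simps)
              then have "norm (\<phi> (inv x \<otimes> y) ^ k - 1) = norm (\<phi> y ^ k - \<phi> x ^ k)"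
                using n by (simp add: norm_mult norm_power norm_inverse)
              then show "dist (\<phi> (inv x \<otimes> y) ^ k) 1 < 1" using d by (simp add: dist_norm)
            qed
            then show False using \<phi>(2) by simp
          qed
          then have "x \<otimes> (inv x \<otimes> y) \<in> U" using N(3) by blast
          then have "y \<in> U" using xc y by (simp add: m_assoc[symmetric])
          then show "\<Psi> \<in> ev ` U" using y by blast
        qed
        then show "\<exists>K e. compactin dualT K \<and> e > 0 \<and>
          {\<Psi> \<in> bidual. \<forall>\<phi>\<in>K. dist (\<Psi> \<phi>) (\<Phi> \<phi>) < e} \<subseteq> ev ` U"
          using compactin_annihilator[OF N(2) N1] zero_less_one by blast
      qed
    qed
  qed
  then show ?thesis
    unfolding reflexive_def using evaluation_iso topological_abelian_group_axioms by blast
qed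

end

section \<open>The P-modification\<close>

text \<open>\<open>R\<close> is the strict part of \<open>cardSuc natLeq\<close>, a copy of
  \<open>\<omega>\<^sub>1\<close> on sets of naturals. Its proper initial segments have cardinality
  below the successor of \<open>natLeq\<close>, hence are countable.\<close>

lemma uncountable_wellorder_countable_segments:
  includes cardinal_syntax
  shows "\<exists>(W :: nat set set) R. wf R \<and> total_on W R \<and> trans R \<and>
     (\<forall>a. countable {b. (b, a) \<in> R} \<and> {b. (b, a) \<in> R} \<subseteq> W) \<and> uncountable W \<and> |W| \<le>o cardSuc natLeq"
proof -
  let ?r = "cardSuc natLeq"
  have c: "Card_order ?r" by (simp add: cardSuc_Card_order natLeq_Card_order)
  have wo: "Well_order ?r" using c by (simp add: card_order_on_well_order_on)
  have W: "|Field ?r| =o ?r" by (rule card_of_Field_ordIso[OF c])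
  let ?R = "?r - Id"
  have under: "{b. (b, a) \<in> ?R} = underS ?r a" for a by (auto simp: underS_def)
  show ?thesis
  proof (intro exI[of _ "Field ?r"] exI[of _ ?R] conjI allI)
    show "wf ?R" using wo by (simp add: well_order_on_def)
    have lin: "Linear_order ?r" using wo by (simp add: well_order_on_def)
    then show "total_on (Field ?r) ?R" by (simp add: linear_order_on_def)
    have "Partial_order ?r" using lin by (simp add: linear_order_on_def)
    then have "trans ?r" "antisym ?r" by (auto simp: partial_order_on_def preorder_on_def)
    then show "trans ?R" by (rule trans_diff_Id)
    show "countable {b. (b, a) \<in> ?R}" for a
    proof (cases "a \<in> Field ?r")
      case True
      have "|underS ?r a| <o ?r" by (rule card_of_underS[OF c True])
      then have "|underS ?r a| \<le>o natLeq"
        by (simp only: cardSuc_ordLeq_ordLess[OF natLeq_Card_order card_of_Card_order])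
      then show ?thesis by (simp only: under countable_card_le_natLeq)
    next
      case False
      then have "underS ?r a = {}" by (auto simp: underS_def Field_def)
      then show ?thesis unfolding under by simp
    qed
    show "{b. (b, a) \<in> ?R} \<subseteq> Field ?r" for a by (auto simp: Field_def)
    show "uncountable (Field ?r)"
    proof
      assume "countable (Field ?r)"
      then have "|Field ?r| \<le>o natLeq" by (simp only: countable_card_le_natLeq)
      moreover have "natLeq <o ?r" by (simp add: cardSuc_greater natLeq_Card_order)
      ultimately have "|Field ?r| <o ?r" by (rule ordLeq_ordLess_trans)
      then show False using W not_ordLess_ordIso by blast
    qed
    show "|Field ?r| \<le>o ?r" using W ordIso_imp_ordLeq by blast
  qed
qed

lemma openin_P_modification_iff:
  "openin (P_modification T) U \<longleftrightarrow> (\<forall>x\<in>U. \<exists>S. gdelta_in T S \<and> x \<in> S \<and> S \<subseteq> U)"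
  by (simp add: openin_P_modification arbitrary_union_of_alt)

lemma gdelta_in_imp_openin_P_modification: "gdelta_in T S \<Longrightarrow> openin (P_modification T) S"
  by (auto simp: openin_P_modification_iff)

lemma openin_imp_openin_P_modification: "openin T U \<Longrightarrow> openin (P_modification T) U"
  by (intro gdelta_in_imp_openin_P_modification open_imp_gdelta_in)

lemma openin_P_modification_countable_Inter:
  assumes "countable \<U>" "\<U> \<noteq> {}" "\<And>U. U \<in> \<U> \<Longrightarrow> openin (P_modification T) U"
  shows "openin (P_modification T) (\<Inter>\<U>)"
  unfolding openin_P_modification_iff
proof
  fix x assume x: "x \<in> \<Inter>\<U>"
  have "\<forall>U\<in>\<U>. \<exists>S. gdelta_in T S \<and> x \<in> S \<and> S \<subseteq> U"
    using assms(3) x unfolding openin_P_modification_iff by blast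
  then obtain S where S: "\<And>U. U \<in> \<U> \<Longrightarrow> gdelta_in T (S U) \<and> x \<in> S U \<and> S U \<subseteq> U" by metis
  have "gdelta_in T (\<Inter>(S ` \<U>))"
    by (rule gdelta_in_Inter) (use assms S in auto)
  moreover have "x \<in> \<Inter>(S ` \<U>)" "\<Inter>(S ` \<U>) \<subseteq> \<Inter>\<U>" using S by auto
  ultimately show "\<exists>S. gdelta_in T S \<and> x \<in> S \<and> S \<subseteq> \<Inter>\<U>" by blast
qed

lemma gdelta_in_preimage:
  assumes f: "continuous_map X Y f" and S: "gdelta_in Y S"
  shows "gdelta_in X {x \<in> topspace X. f x \<in> S}"
proof -
  obtain C where C: "\<And>n::nat. openin Y (C n)" "\<Inter>(range C) = S"
    using S unfolding gdelta_in_descending by blast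
  have "gdelta_in X (\<Inter>n. {x \<in> topspace X. f x \<in> C n})"
    by (rule gdelta_in_Inter) (auto intro!: open_imp_gdelta_in openin_continuous_map_preimage[OF f] C)
  moreover have "(\<Inter>n. {x \<in> topspace X. f x \<in> C n}) = {x \<in> topspace X. f x \<in> S}"
    using C(2) by auto
  ultimately show ?thesis by simp
qed

lemma continuous_map_P_modification:
  assumes f: "continuous_map X Y f"
  shows "continuous_map (P_modification X) (P_modification Y) f"
  unfolding continuous_map_def
proof (intro conjI allI impI)
  show "f \<in> topspace (P_modification X) \<rightarrow> topspace (P_modification Y)"
    using f by (auto simp: continuous_map_def)
  fix U assume U: "openin (P_modification Y) U"
  show "openin (P_modification X) {x \<in> topspace (P_modification X). f x \<in> U}"
    unfolding openin_P_modification_iff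
  proof
    fix x assume x: "x \<in> {x \<in> topspace (P_modification X). f x \<in> U}"
    then obtain S where S: "gdelta_in Y S" "f x \<in> S" "S \<subseteq> U"
      using U unfolding openin_P_modification_iff by blast
    then show "\<exists>S. gdelta_in X S \<and> x \<in> S \<and> S \<subseteq> {x \<in> topspace (P_modification X). f x \<in> U}"
      using gdelta_in_preimage[OF f S(1)] x
      by (intro exI[of _ "{x \<in> topspace X. f x \<in> S}"]) auto
  qed
qed

text \<open>Choose an open rectangle inside each of the countably many open sets that define a
  \<open>G\<^sub>\<delta>\<close>; their intersection is again a rectangle, with P-open sides. This
  makes multiplication continuous after the modification.\<close>

lemma openin_prod_P_modification:
  assumes W: "openin (P_modification (prod_topology X Y)) W"
  shows "openin (prod_topology (P_modification X) (P_modification Y)) W"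
  unfolding openin_prod_topology_alt
proof (intro allI impI)
  fix x y assume "(x, y) \<in> W"
  then obtain S where S: "gdelta_in (prod_topology X Y) S" "(x, y) \<in> S" "S \<subseteq> W"
    using W unfolding openin_P_modification_iff by blast
  then obtain C where C: "\<And>n::nat. openin (prod_topology X Y) (C n)" "\<Inter>(range C) = S"
    unfolding gdelta_in_descending by blast
  have "\<exists>A B. openin X A \<and> openin Y B \<and> x \<in> A \<and> y \<in> B \<and> A \<times> B \<subseteq> C n" for n
    using C(1)[of n] C(2) S(2) unfolding openin_prod_topology_alt by blast
  then obtain A B where AB: "\<And>n. openin X (A n) \<and> openin Y (B n) \<and> x \<in> A n \<and> y \<in> B n \<and> A n \<times> B n \<subseteq> C n"
    by metis
  have "openin (P_modification X) (\<Inter>n. A n)" "openin (P_modification Y) (\<Inter>n. B n)"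
    by (rule openin_P_modification_countable_Inter; use AB openin_imp_openin_P_modification in blast)+
  moreover have "(\<Inter>n. A n) \<times> (\<Inter>n. B n) \<subseteq> W"
  proof
    fix q assume q: "q \<in> (\<Inter>n. A n) \<times> (\<Inter>n. B n)"
    have "q \<in> C n" for n
    proof -
      have "q \<in> A n \<times> B n" using q by auto
      then show ?thesis using AB[of n] by blast
    qed
    then show "q \<in> W" using C(2) S(3) by blast
  qed
  moreover have "x \<in> (\<Inter>n. A n)" "y \<in> (\<Inter>n. B n)" using AB by auto
  ultimately show "\<exists>U V. openin (P_modification X) U \<and> openin (P_modification Y) V \<and> x \<in> U \<and> y \<in> V \<and> U \<times> V \<subseteq> W"
    by blast
qed

lemma continuous_map_from_prod_P_modification:
  assumes f: "continuous_map (P_modification (prod_topology X Y)) Z f"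
  shows "continuous_map (prod_topology (P_modification X) (P_modification Y)) Z f"
  unfolding continuous_map_def
proof (intro conjI allI impI)
  show "f \<in> topspace (prod_topology (P_modification X) (P_modification Y)) \<rightarrow> topspace Z"
    using f by (simp add: continuous_map_def)
  fix U assume "openin Z U"
  from openin_prod_P_modification[OF openin_continuous_map_preimage[OF f this]]
  show "openin (prod_topology (P_modification X) (P_modification Y))
      {x \<in> topspace (prod_topology (P_modification X) (P_modification Y)). f x \<in> U}" by simp
qed

context topological_abelian_group
begin

lemma P_modification_topological_group: "topological_abelian_group G (P_modification T)"
proof unfold_locales
  show "topspace (P_modification T) = carrier G" by (simp add: topspace_eq)
  show "Hausdorff_space (P_modification T)"
    using Hausdorff openin_imp_openin_P_modification unfolding Hausdorff_space_def
    by (metis topspace_P_modification)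
  show "continuous_map (P_modification T) (P_modification T) (\<lambda>x. inv x)"
    by (rule continuous_map_P_modification[OF continuous_inv])
  have "continuous_map (P_modification (prod_topology T T)) (P_modification T) (\<lambda>(x, y). x \<otimes> y)"
    by (rule continuous_map_P_modification[OF continuous_mult])
  then show "continuous_map (prod_topology (P_modification T) (P_modification T)) (P_modification T) (\<lambda>(x, y). x \<otimes> y)"
    by (rule continuous_map_from_prod_P_modification)
qed

lemma subgroup_topological_group:
  assumes H: "subgroup H G"
  shows "topological_abelian_group (G\<lparr>carrier := H\<rparr>) (subtopology T H)"
proof -
  interpret H: comm_group "G\<lparr>carrier := H\<rparr>"
  proof (rule group.group_comm_groupI[OF subgroup_imp_group[OF H]])
    fix x y assume "x \<in> carrier (G\<lparr>carrier := H\<rparr>)" "y \<in> carrier (G\<lparr>carrier := H\<rparr>)"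
    then show "x \<otimes>\<^bsub>G\<lparr>carrier := H\<rparr>\<^esub> y = y \<otimes>\<^bsub>G\<lparr>carrier := H\<rparr>\<^esub> x"
      using H by (simp add: m_comm subgroup.mem_carrier)
  qed
  have Hc: "H \<subseteq> carrier G" using H by (rule subgroup.subset)
  show ?thesis
  proof unfold_locales
    show "topspace (subtopology T H) = carrier (G\<lparr>carrier := H\<rparr>)" using Hc by (auto simp: topspace_eq)
    show "Hausdorff_space (subtopology T H)" by (rule Hausdorff_space_subtopology[OF Hausdorff])
    have "continuous_map (subtopology T H) (subtopology T H) (\<lambda>x. inv x)"
      using continuous_map_from_subtopology[OF continuous_inv] H
      by (auto simp: continuous_map_in_subtopology subgroup.m_inv_closed)
    then show "continuous_map (subtopology T H) (subtopology T H) (\<lambda>x. inv\<^bsub>G\<lparr>carrier := H\<rparr>\<^esub> x)"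
      by (rule continuous_map_eq) (use H m_inv_consistent in auto)
    have "continuous_map (prod_topology (subtopology T H) (subtopology T H)) T (\<lambda>(x, y). x \<otimes> y)"
      unfolding prod_topology_subtopology subtopology_subtopology
      by (intro continuous_map_from_subtopology continuous_mult)
    then show "continuous_map (prod_topology (subtopology T H) (subtopology T H)) (subtopology T H)
        (\<lambda>(x, y). x \<otimes>\<^bsub>G\<lparr>carrier := H\<rparr>\<^esub> y)"
      using H by (auto simp: continuous_map_in_subtopology subgroup.m_closed)
  qed
qed

lemma P_group_subgroup_P_modification:
  assumes H: "subgroup H G"
  shows "P_group (G\<lparr>carrier := H\<rparr>) (subtopology (P_modification T) H)"
proof -
  interpret P: topological_abelian_group G "P_modification T"
    by (rule P_modification_topological_group)
  interpret H: topological_abelian_group "G\<lparr>carrier := H\<rparr>" "subtopology (P_modification T) H"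
    by (rule P.subgroup_topological_group[OF H])
  show ?thesis
  proof unfold_locales
    fix \<U> assume \<U>: "countable \<U>" "\<U> \<noteq> {}" "\<And>U. U \<in> \<U> \<Longrightarrow> openin (subtopology (P_modification T) H) U"
    have "\<forall>U\<in>\<U>. \<exists>V. openin (P_modification T) V \<and> U = V \<inter> H"
      using \<U>(3) by (auto simp: openin_subtopology)
    then obtain V where V: "\<And>U. U \<in> \<U> \<Longrightarrow> openin (P_modification T) (V U) \<and> U = V U \<inter> H" by metis
    have "openin (P_modification T) (\<Inter>(V ` \<U>))"
      by (rule openin_P_modification_countable_Inter) (use \<U> V in auto)
    moreover have "\<Inter>\<U> = \<Inter>(V ` \<U>) \<inter> H"
    proof (intro subset_antisym subsetI)
      fix x assume "x \<in> \<Inter>\<U>"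
      then show "x \<in> \<Inter>(V ` \<U>) \<inter> H" using V \<U>(2) by blast
    next
      fix x assume "x \<in> \<Inter>(V ` \<U>) \<inter> H"
      then show "x \<in> \<Inter>\<U>" using V by blast
    qed
    ultimately show "openin (subtopology (P_modification T) H) (\<Inter>\<U>)"
      unfolding openin_subtopology by blast
  qed
qed

definition good_subgroup :: "'a set \<Rightarrow> bool" where
  "good_subgroup N \<longleftrightarrow> subgroup N G \<and> (N = carrier G \<or> compactin T N \<and>
     (\<exists>V::nat \<Rightarrow> 'a set. (\<forall>n. openin T (V n) \<and> \<one> \<in> V n \<and> T closure_of V (Suc n) \<subseteq> V n) \<and> N = (\<Inter>n. V n)))"

lemma good_subgroup_carrier: "good_subgroup (carrier G)"
  by (simp add: good_subgroup_def subgroup_self)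

lemma good_subgroup_subgroup: "good_subgroup N \<Longrightarrow> subgroup N G"
  by (simp add: good_subgroup_def)

lemma good_subgroup_compactin: "good_subgroup N \<Longrightarrow> N \<noteq> carrier G \<Longrightarrow> compactin T N"
  by (auto simp: good_subgroup_def)

lemma good_subgroup_gdelta: "good_subgroup N \<Longrightarrow> gdelta_in T N"
  unfolding good_subgroup_def
proof (elim conjE disjE exE)
  assume "N = carrier G"
  then show ?thesis using openin_carrier_self open_imp_gdelta_in by blast
next
  fix V assume V: "\<forall>n. openin T (V n) \<and> \<one> \<in> V n \<and> T closure_of V (Suc n) \<subseteq> V n" "N = (\<Inter>n::nat. V n)"
  show ?thesis unfolding V(2) by (rule gdelta_in_Inter) (use V(1) open_imp_gdelta_in in auto)
qed

text \<open>Translate a countable base at \<open>K\<close> back by a point \<open>k\<close> of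
  \<open>K\<close> and refine it, together with the \<open>Q n\<close>, to a division sequence. Its
  intersection is a closed subgroup inside the compact translate of \<open>K\<close>.\<close>

lemma feathered_good_subgroup:
  assumes f: "feathered T" and Q: "\<And>n::nat. openin T (Q n)" "\<And>n. \<one> \<in> Q n"
  shows "\<exists>N. good_subgroup N \<and> N \<subseteq> (\<Inter>n. Q n)"
proof -
  obtain K \<B> where K: "K \<noteq> {}" "compactin T K" and B: "countable \<B>" "\<And>U. U \<in> \<B> \<Longrightarrow> openin T U \<and> K \<subseteq> U"
    "\<And>V. openin T V \<Longrightarrow> K \<subseteq> V \<Longrightarrow> \<exists>U\<in>\<B>. U \<subseteq> V"
    using f unfolding feathered_def by metis
  have Kc: "K \<subseteq> carrier G" using compactin_subset_topspace[OF K(2)] by (simp add: topspace_eq)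
  obtain k where k: "k \<in> K" using K(1) by blast
  then have kc: "k \<in> carrier G" using Kc by blast
  have "\<B> \<noteq> {}" using B(3)[OF openin_carrier_self Kc] by blast
  define b where "b = from_nat_into \<B>"
  have b: "range b = \<B>" unfolding b_def by (rule range_from_nat_into[OF \<open>\<B> \<noteq> {}\<close> B(1)])
  define A where "A n = {x \<in> carrier G. k \<otimes> x \<in> b n} \<inter> Q n" for n
  have A: "openin T (A n)" "\<one> \<in> A n" for n
  proof -
    have "b n \<in> \<B>" using b by blast
    then have "openin T (b n)" "k \<in> b n" using B(2)[of "b n"] k by auto
    then show "openin T (A n)" "\<one> \<in> A n"
      using openin_translate[of "b n" k] kc Q by (auto simp: A_def)
  qed
  have "\<exists>V. (\<forall>n. openin T (V n) \<and> \<one> \<in> V n \<and> V n \<subseteq> A n) \<and>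
      (\<forall>n. \<forall>x\<in>V (Suc n). \<forall>y\<in>V (Suc n). x \<otimes> inv y \<in> V n)"
    by (rule division_sequence[OF A])
  then obtain V where V': "\<forall>n. openin T (V n) \<and> \<one> \<in> V n \<and> V n \<subseteq> A n"
    and div: "\<forall>n. \<forall>x\<in>V (Suc n). \<forall>y\<in>V (Suc n). x \<otimes> inv y \<in> V n"
    by (elim exE conjE)
  have V: "\<And>n. openin T (V n)" "\<And>n. \<one> \<in> V n" "\<And>n. V n \<subseteq> A n" using V' by simp_all
  let ?N = "\<Inter>n. V n"
  have cl: "T closure_of V (Suc n) \<subseteq> V n" for n
    by (rule closure_division) (use V div in auto)
  have sg: "subgroup ?N G" by (rule division_sequence_subgroup) (use V div in auto)
  \<comment> \<open>The sets \<open>V n\<close> and their closures interlace, so both families have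
    the same intersection.\<close>
  have "closedin T ?N"
  proof -
    have "closedin T (\<Inter>n. T closure_of V n)" by (rule closedin_Inter) auto
    moreover have "(\<Inter>n. T closure_of V n) = ?N"
    proof (intro subset_antisym subsetI)
      fix x assume "x \<in> (\<Inter>n. T closure_of V n)"
      then show "x \<in> ?N" using cl by blast
    next
      fix x assume "x \<in> ?N"
      then show "x \<in> (\<Inter>n. T closure_of V n)"
        using closure_of_subset[OF openin_subset[OF V(1)]] by blast
    qed
    ultimately show ?thesis by simp
  qed
  moreover have "compactin T {x \<in> carrier G. k \<otimes> x \<in> K}"
  proof -
    have "compactin T ((\<lambda>x. inv k \<otimes> x) ` K)"
      by (rule image_compactin[OF K(2) continuous_translate]) (simp add: kc)
    moreover have "(\<lambda>x. inv k \<otimes> x) ` K = {x \<in> carrier G. k \<otimes> x \<in> K}"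
    proof (intro subset_antisym subsetI)
      fix x assume "x \<in> (\<lambda>x. inv k \<otimes> x) ` K"
      then show "x \<in> {x \<in> carrier G. k \<otimes> x \<in> K}" using Kc kc by (auto simp flip: m_assoc)
    next
      fix x assume "x \<in> {x \<in> carrier G. k \<otimes> x \<in> K}"
      then show "x \<in> (\<lambda>x. inv k \<otimes> x) ` K"
        using kc by (intro image_eqI[of _ _ "k \<otimes> x"]) (auto simp flip: m_assoc)
    qed
    ultimately show ?thesis by simp
  qed
  \<comment> \<open>For a point outside \<open>K\<close>, some member of the base at
    \<open>K\<close> avoids it, and \<open>?N\<close> lies in the translate of every member.\<close>
  moreover have "?N \<subseteq> {x \<in> carrier G. k \<otimes> x \<in> K}"
  proof
    fix x assume x: "x \<in> ?N"
    then have xc: "x \<in> carrier G" using subgroup.mem_carrier[OF sg] by blast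
    have "k \<otimes> x \<in> K"
    proof (rule ccontr)
      assume no: "k \<otimes> x \<notin> K"
      have "openin T (topspace T - {k \<otimes> x})"
        using closedin_Hausdorff_singleton[OF Hausdorff, of "k \<otimes> x"] kc xc
        by (simp add: closedin_def topspace_eq)
      moreover have "K \<subseteq> topspace T - {k \<otimes> x}" using no Kc by (auto simp: topspace_eq)
      ultimately obtain U where "U \<in> \<B>" "U \<subseteq> topspace T - {k \<otimes> x}" using B(3) by meson
      then obtain n where "b n \<subseteq> topspace T - {k \<otimes> x}" unfolding b[symmetric] by blast
      moreover have "x \<in> A n" using x V(3) by blast
      ultimately show False by (auto simp: A_def)
    qed
    then show "x \<in> {x \<in> carrier G. k \<otimes> x \<in> K}" using xc by simp
  qed
  ultimately have "compactin T ?N" by (blast intro: closed_compactin)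
  then have "good_subgroup ?N"
    unfolding good_subgroup_def
    by (intro conjI disjI2 exI[of _ V] allI sg V(1,2) cl refl)
  moreover have "?N \<subseteq> (\<Inter>n. Q n)" using V(3) unfolding A_def by blast
  ultimately show ?thesis by blast
qed

lemma continuous_right_translate: "a \<in> carrier G \<Longrightarrow> continuous_map T T (\<lambda>x. x \<otimes> a)"
  by (rule continuous_map_eq[OF continuous_translate]) (auto simp: topspace_eq m_comm)

lemma coset_image:
  assumes "L \<subseteq> carrier G" "a \<in> carrier G"
  shows "(\<lambda>x. x \<otimes> a) ` L = {x \<in> carrier G. x \<otimes> inv a \<in> L}"
proof (intro subset_antisym subsetI)
  fix x assume "x \<in> (\<lambda>x. x \<otimes> a) ` L"
  then show "x \<in> {x \<in> carrier G. x \<otimes> inv a \<in> L}" using assms by (auto simp: m_assoc)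
next
  fix x assume "x \<in> {x \<in> carrier G. x \<otimes> inv a \<in> L}"
  then show "x \<in> (\<lambda>x. x \<otimes> a) ` L"
    using assms by (intro image_eqI[of _ _ "x \<otimes> inv a"]) (auto simp: m_assoc)
qed

lemma compactin_coset:
  assumes "compactin T L" "a \<in> carrier G"
  shows "compactin T {x \<in> carrier G. x \<otimes> inv a \<in> L}"
proof -
  have "L \<subseteq> carrier G" using compactin_subset_topspace[OF assms(1)] by (simp only: topspace_eq)
  from coset_image[OF this assms(2)] show ?thesis
    using image_compactin[OF assms(1) continuous_right_translate[OF assms(2)]] by (simp only:)
qed

text \<open>The cosets of \<open>L \<beta>\<close> through \<open>z \<beta>\<close> decrease along
  \<open>R\<close>, so a finite subfamily has a least member, containing its own \<open>z\<close>.
  One compact coset then gives a common point. The last conjunct keeps supports small when this is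
  applied in every coordinate of a product.\<close>

lemma nested_cosets_meet:
  assumes tot: "total_on S R"
    and L: "\<And>\<alpha>. \<alpha> \<in> S \<Longrightarrow> subgroup (L \<alpha>) G" "\<And>\<alpha>. \<alpha> \<in> S \<Longrightarrow> L \<alpha> = carrier G \<or> compactin T (L \<alpha>)"
    and z: "\<And>\<alpha>. \<alpha> \<in> S \<Longrightarrow> z \<alpha> \<in> carrier G"
    and nested: "\<And>\<alpha> \<beta>. \<alpha> \<in> S \<Longrightarrow> \<beta> \<in> S \<Longrightarrow> (\<beta>, \<alpha>) \<in> R \<Longrightarrow> L \<alpha> \<subseteq> L \<beta> \<and> z \<alpha> \<otimes> inv (z \<beta>) \<in> L \<beta>"
  shows "\<exists>w\<in>carrier G. (\<forall>\<beta>\<in>S. w \<otimes> inv (z \<beta>) \<in> L \<beta>) \<and> ((\<forall>\<beta>\<in>S. L \<beta> = carrier G) \<longrightarrow> w = \<one>)"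
proof (cases "\<forall>\<beta>\<in>S. L \<beta> = carrier G")
  case True
  then show ?thesis using z by (intro bexI[of _ \<one>]) auto
next
  case False
  then obtain \<beta>0 where \<beta>0: "\<beta>0 \<in> S" "L \<beta>0 \<noteq> carrier G" by blast
  define C where "C \<beta> = {x \<in> carrier G. x \<otimes> inv (z \<beta>) \<in> L \<beta>}" for \<beta>
  have Lc: "L \<beta> \<subseteq> carrier G" if "\<beta> \<in> S" for \<beta> using subgroup.subset[OF L(1)[OF that]] .
  have C_comp: "compactin T (C \<beta>)" if "\<beta> \<in> S" "L \<beta> \<noteq> carrier G" for \<beta>
    unfolding C_def using L(2)[OF that(1)] that z by (intro compactin_coset) auto
  have C_closed: "closedin T (C \<beta>)" if \<beta>: "\<beta> \<in> S" for \<beta>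
  proof (cases "L \<beta> = carrier G")
    case True
    then have "C \<beta> = topspace T" using z[OF \<beta>] by (auto simp: C_def topspace_eq)
    then show ?thesis by simp
  next
    case False
    then show ?thesis using C_comp[OF \<beta>] compactin_imp_closedin Hausdorff by blast
  qed
  have zC: "z \<beta> \<in> C \<beta>" if "\<beta> \<in> S" for \<beta>
    using z[OF that] subgroup.one_closed[OF L(1)[OF that]] by (simp add: C_def)
  have C_mono: "C \<alpha> \<subseteq> C \<beta>" if ab: "\<alpha> \<in> S" "\<beta> \<in> S" "(\<beta>, \<alpha>) \<in> R" for \<alpha> \<beta>
  proof
    fix x assume x: "x \<in> C \<alpha>"
    then have xc: "x \<in> carrier G" and "x \<otimes> inv (z \<alpha>) \<in> L \<beta>" using nested[OF ab] by (auto simp: C_def)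
    then have "(x \<otimes> inv (z \<alpha>)) \<otimes> (z \<alpha> \<otimes> inv (z \<beta>)) \<in> L \<beta>"
      using nested[OF ab] subgroup.m_closed[OF L(1)[OF ab(2)]] by blast
    moreover have "(x \<otimes> inv (z \<alpha>)) \<otimes> (z \<alpha> \<otimes> inv (z \<beta>)) = x \<otimes> inv (z \<beta>)"
      using xc z[OF ab(1)] z[OF ab(2)] by (simp add: inv_solve_right m_assoc)
    ultimately show "x \<in> C \<beta>" using xc by (simp add: C_def)
  qed
  have least: "\<exists>\<gamma>\<in>F. \<forall>\<beta>\<in>F. C \<gamma> \<subseteq> C \<beta>" if "finite F" "F \<noteq> {}" "F \<subseteq> S" for F
    using that
  proof (induction F rule: finite_ne_induct)
    case (singleton x)
    then show ?case by simp
  next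
    case (insert x F)
    then obtain \<gamma> where \<gamma>: "\<gamma> \<in> F" "\<forall>\<beta>\<in>F. C \<gamma> \<subseteq> C \<beta>" by auto
    have "C x \<subseteq> C \<gamma> \<or> C \<gamma> \<subseteq> C x"
    proof (cases "x = \<gamma>")
      case False
      then have "(x, \<gamma>) \<in> R \<or> (\<gamma>, x) \<in> R"
        using tot insert.prems \<gamma>(1) unfolding total_on_def by blast
      then show ?thesis using C_mono[of x \<gamma>] C_mono[of \<gamma> x] insert.prems \<gamma>(1) by blast
    qed simp
    then show ?case
    proof
      assume "C x \<subseteq> C \<gamma>"
      then show ?thesis using \<gamma> by (intro bexI[of _ x]) auto
    next
      assume "C \<gamma> \<subseteq> C x"
      then show ?thesis using \<gamma> by (intro bexI[of _ \<gamma>]) auto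
    qed
  qed
  have "C \<beta>0 \<inter> \<Inter>(C ` S) \<noteq> {}"
  proof (rule C_comp[OF \<beta>0, unfolded compactin_fip, THEN conjunct2, rule_format], intro conjI ballI allI impI)
    show "closedin T X" if "X \<in> C ` S" for X using that C_closed by blast
    fix \<F> assume "finite \<F> \<and> \<F> \<subseteq> C ` S"
    then obtain F where F: "finite F" "F \<subseteq> S" "\<F> = C ` F" using finite_subset_image[of \<F> C S] by blast
    then obtain \<gamma> where \<gamma>: "\<gamma> \<in> insert \<beta>0 F" "\<forall>\<beta>\<in>insert \<beta>0 F. C \<gamma> \<subseteq> C \<beta>"
      using least[of "insert \<beta>0 F"] \<beta>0(1) by auto
    then have "z \<gamma> \<in> C \<beta>0 \<inter> \<Inter>\<F>" using zC[of \<gamma>] F \<beta>0(1) by blast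
    then show "C \<beta>0 \<inter> \<Inter>\<F> \<noteq> {}" by blast
  qed
  then obtain w where w: "w \<in> C \<beta>0" "\<forall>\<beta>\<in>S. w \<in> C \<beta>" by blast
  then show ?thesis using False by (intro bexI[of _ w]) (auto simp: C_def)
qed

text \<open>The stabilisation step: modulo a compact \<open>G\<^sub>\<delta>\<close>-subgroup \<open>N\<close> a decreasing transfinite sequence of
  compact subgroups can drop only countably often, since the witnesses \<open>p \<alpha>\<close> of a drop avoiding a
  fixed neighbourhood of \<open>N\<close> are uniformly separated inside a compact set.\<close>

lemma countable_drops:
  assumes R: "wf R" "total_on W R"
    and L: "\<And>\<alpha>. \<alpha> \<in> W \<Longrightarrow> subgroup (L \<alpha>) G" "\<And>\<alpha>. \<alpha> \<in> W \<Longrightarrow> L \<alpha> = carrier G \<or> compactin T (L \<alpha>)"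
    and p: "\<And>\<alpha>. \<alpha> \<in> W \<Longrightarrow> p \<alpha> \<in> carrier G"
      "\<And>\<alpha> \<beta>. \<alpha> \<in> W \<Longrightarrow> \<beta> \<in> W \<Longrightarrow> (\<beta>, \<alpha>) \<in> R \<Longrightarrow> p \<alpha> \<in> L \<beta>"
    and N: "good_subgroup N"
  shows "countable {\<alpha>\<in>W. \<forall>n\<in>N. n \<otimes> inv (p \<alpha>) \<notin> L \<alpha>}" (is "countable ?Bad")
proof (cases "N = carrier G")
  case True
  have "p \<alpha> \<otimes> inv (p \<alpha>) \<in> L \<alpha>" if "\<alpha> \<in> W" for \<alpha>
    using p(1)[OF that] subgroup.one_closed[OF L(1)[OF that]] by simp
  then have "?Bad = {}" using True p(1) by blast
  then show ?thesis by (simp only: countable_empty)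
next
  case False
  then obtain V where V: "\<And>n::nat. openin T (V n)" "\<And>n. \<one> \<in> V n" "\<And>n. T closure_of V (Suc n) \<subseteq> V n"
    "N = (\<Inter>n. V n)"
    using N unfolding good_subgroup_def by blast
  have V_cl: "V n \<subseteq> T closure_of V n" for n by (rule closure_of_subset[OF openin_subset[OF V(1)]])
  have V_dec: "V n \<subseteq> V m" if "m \<le> n" for m n
    by (rule lift_Suc_antimono_le[OF _ that]) (rule order.trans[OF V_cl V(3)])
  \<comment> \<open>A stage is bad exactly when the coset of \<open>L \<alpha>\<close> through
    \<open>p \<alpha>\<close> misses \<open>N\<close>.\<close>
  define C where "C \<alpha> = {x \<in> carrier G. x \<otimes> inv (p \<alpha>) \<in> L \<alpha>}" for \<alpha>
  have Nc: "N \<subseteq> carrier G" using good_subgroup_subgroup[OF N] by (rule subgroup.subset)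
  have bad_comp: "compactin T (L \<alpha>)" if "\<alpha> \<in> ?Bad" for \<alpha>
  proof -
    have "\<one> \<in> N" using good_subgroup_subgroup[OF N] by (rule subgroup.one_closed)
    then have "\<one> \<otimes> inv (p \<alpha>) \<notin> L \<alpha>" using that by blast
    then have "L \<alpha> \<noteq> carrier G" using p(1) that by auto
    then show ?thesis using L(2) that by blast
  qed
  have ex_n: "\<exists>n. C \<alpha> \<inter> V n = {}" if \<alpha>: "\<alpha> \<in> ?Bad" for \<alpha>
  proof (rule ccontr)
    assume "\<nexists>n. C \<alpha> \<inter> V n = {}"
    then have ne: "C \<alpha> \<inter> V n \<noteq> {}" for n by blast
    have "compactin T (C \<alpha>)" unfolding C_def using bad_comp[OF \<alpha>] p(1) \<alpha> by (intro compactin_coset) auto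
    then have "C \<alpha> \<inter> \<Inter>(range (\<lambda>n. T closure_of V n)) \<noteq> {}"
    proof (rule compactin_fip[THEN iffD1, THEN conjunct2, rule_format], intro conjI ballI allI impI)
      show "closedin T X" if "X \<in> range (\<lambda>n. T closure_of V n)" for X using that by auto
      fix \<F> assume "finite \<F> \<and> \<F> \<subseteq> range (\<lambda>n. T closure_of V n)"
      then obtain F where F: "finite F" "\<F> = (\<lambda>n. T closure_of V n) ` F"
        using finite_subset_image[of \<F> "\<lambda>n. T closure_of V n" UNIV] by blast
      obtain m where m: "\<forall>n\<in>F. n \<le> m" using F(1) finite_nat_set_iff_bounded_le by blast
      obtain x where "x \<in> C \<alpha>" "x \<in> V m" using ne[of m] by blast
      moreover have "V m \<subseteq> T closure_of V n" if "n \<in> F" for n using V_dec[of n m] V_cl[of n] m that by blast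
      ultimately have "x \<in> C \<alpha> \<inter> \<Inter>\<F>" using F(2) by blast
      then show "C \<alpha> \<inter> \<Inter>\<F> \<noteq> {}" by blast
    qed
    then obtain x where x: "x \<in> C \<alpha>" "\<And>n. x \<in> T closure_of V n" by blast
    then have "x \<in> N" using V(3,4) by blast
    then show False using x(1) \<alpha> by (auto simp: C_def)
  qed
  \<comment> \<open>All later points lie in the compact group \<open>L \<alpha>0\<close> of the
    first such stage. Finitely many small translates cover it, and by \<open>sep\<close> each of
    them contains the point of at most one later stage.\<close>
  have fin: "finite {\<alpha>\<in>?Bad. C \<alpha> \<inter> V n = {}}" for n
  proof (cases "{\<alpha>\<in>?Bad. C \<alpha> \<inter> V n = {}} = {}")
    case True
    then show ?thesis by (simp only: finite.emptyI)
  next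
    case False
    let ?B = "{\<alpha>\<in>?Bad. C \<alpha> \<inter> V n = {}}"
    obtain \<alpha>0 where \<alpha>0: "\<alpha>0 \<in> ?B" "\<And>\<beta>. (\<beta>, \<alpha>0) \<in> R \<Longrightarrow> \<beta> \<notin> ?B"
      using wfE_min'[OF R(1) False] by blast
    \<comment> \<open>The later point \<open>p \<beta>\<close> lies in \<open>L \<alpha>\<close>, so
      the quotient belongs to the coset \<open>C \<alpha>\<close>, which misses
      \<open>V n\<close>.\<close>
    have sep: "p \<alpha> \<otimes> inv (p \<beta>) \<notin> V n" if "\<alpha> \<in> ?B" "\<beta> \<in> ?B" "(\<alpha>, \<beta>) \<in> R" for \<alpha> \<beta>
    proof -
      have W: "\<alpha> \<in> W" "\<beta> \<in> W" using that by auto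
      have "inv (p \<beta>) \<in> L \<alpha>"
        using p(2)[OF W(2,1) that(3)] subgroup.m_inv_closed[OF L(1)[OF W(1)]] by blast
      moreover have "(p \<alpha> \<otimes> inv (p \<beta>)) \<otimes> inv (p \<alpha>) = inv (p \<beta>)"
        using p(1)[OF W(1)] p(1)[OF W(2)] by (simp add: m_comm[of "p \<alpha>"] m_assoc)
      ultimately have "p \<alpha> \<otimes> inv (p \<beta>) \<in> C \<alpha>" using p(1)[OF W(1)] p(1)[OF W(2)] by (simp add: C_def)
      then show ?thesis using that(1) by blast
    qed
    obtain U where U: "openin T U" "\<one> \<in> U" "\<forall>x\<in>U. \<forall>y\<in>U. x \<otimes> inv y \<in> V n"
      using open_division[OF V(1)[of n] V(2)[of n]] by (elim exE conjE)
    define O' where "O' q = {x \<in> carrier G. inv q \<otimes> x \<in> U}" for q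
    have "\<forall>X\<in>O' ` L \<alpha>0. openin T X"
    proof
      fix X assume "X \<in> O' ` L \<alpha>0"
      then obtain q where "X = O' q" "q \<in> carrier G"
        using compactin_subset_topspace[OF bad_comp[of \<alpha>0]] \<alpha>0(1) by (auto simp: topspace_eq)
      then show "openin T X" unfolding O'_def using openin_translate[OF U(1), of "inv q"] by simp
    qed
    moreover have "L \<alpha>0 \<subseteq> \<Union>(O' ` L \<alpha>0)"
    proof
      fix q assume q: "q \<in> L \<alpha>0"
      then have "q \<in> carrier G" using compactin_subset_topspace[OF bad_comp[of \<alpha>0]] \<alpha>0(1) by (auto simp: topspace_eq)
      then have "q \<in> O' q" using U(2) by (simp add: O'_def)
      then show "q \<in> \<Union>(O' ` L \<alpha>0)" using q by blast
    qed
    ultimately obtain \<F> where \<F>: "finite \<F>" "\<F> \<subseteq> O' ` L \<alpha>0" "L \<alpha>0 \<subseteq> \<Union>\<F>"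
      using bad_comp[of \<alpha>0] \<alpha>0(1) unfolding compactin_def by (metis (no_types, lifting) mem_Collect_eq)
    have "\<forall>\<alpha>\<in>?B - {\<alpha>0}. \<exists>X\<in>\<F>. p \<alpha> \<in> X"
    proof
      fix \<alpha> assume \<alpha>: "\<alpha> \<in> ?B - {\<alpha>0}"
      then have "(\<alpha>0, \<alpha>) \<in> R" using \<alpha>0 R(2) unfolding total_on_def by blast
      then have "p \<alpha> \<in> L \<alpha>0" using p(2) \<alpha> \<alpha>0(1) by blast
      then show "\<exists>X\<in>\<F>. p \<alpha> \<in> X" using \<F>(3) by blast
    qed
    then have "\<forall>\<alpha>\<in>?B - {\<alpha>0}. \<exists>X. X \<in> \<F> \<and> p \<alpha> \<in> X" unfolding Bex_def .
    from bchoice[OF this] obtain h where h': "\<forall>\<alpha>\<in>?B - {\<alpha>0}. h \<alpha> \<in> \<F> \<and> p \<alpha> \<in> h \<alpha>" by (rule exE)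
    note h = h'[rule_format]
    have close: "x \<otimes> inv y \<in> V n" if X: "X \<in> \<F>" "x \<in> X" "y \<in> X" for X x y
    proof -
      obtain q where q: "q \<in> L \<alpha>0" "X = O' q" using X(1) \<F>(2) by blast
      have qc: "q \<in> carrier G"
        using q compactin_subset_topspace[OF bad_comp[of \<alpha>0]] \<alpha>0(1) by (auto simp: topspace_eq)
      have xy: "x \<in> carrier G" "y \<in> carrier G" "inv q \<otimes> x \<in> U" "inv q \<otimes> y \<in> U"
        using X q by (auto simp: O'_def)
      have "(inv q \<otimes> x) \<otimes> inv (inv q \<otimes> y) = (inv q \<otimes> q) \<otimes> (x \<otimes> inv y)"
        using xy(1,2) qc by (simp add: inv_mult m_ac del: l_inv r_inv Units_l_inv Units_r_inv)
      also have "\<dots> = x \<otimes> inv y" using xy(1,2) qc by simp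
      finally have "(inv q \<otimes> x) \<otimes> inv (inv q \<otimes> y) = x \<otimes> inv y" .
      then show ?thesis using U(3)[rule_format, OF xy(3,4)] by simp
    qed
    have "inj_on h (?B - {\<alpha>0})"
    proof (rule inj_onI, rule ccontr)
      fix \<alpha> \<beta> assume ab: "\<alpha> \<in> ?B - {\<alpha>0}" "\<beta> \<in> ?B - {\<alpha>0}" "h \<alpha> = h \<beta>" "\<alpha> \<noteq> \<beta>"
      have "(\<alpha>, \<beta>) \<in> R \<or> (\<beta>, \<alpha>) \<in> R" using R(2) ab unfolding total_on_def by blast
      moreover have "p \<alpha> \<otimes> inv (p \<beta>) \<in> V n" "p \<beta> \<otimes> inv (p \<alpha>) \<in> V n"
        using close[of "h \<alpha>" "p \<alpha>" "p \<beta>"] close[of "h \<alpha>" "p \<beta>" "p \<alpha>"] h[OF ab(1)] h[OF ab(2)]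
        by (simp_all only: ab(3))
      ultimately show False using sep ab by blast
    qed
    moreover have "h ` (?B - {\<alpha>0}) \<subseteq> \<F>" using h by blast
    ultimately have "finite (?B - {\<alpha>0})" using \<F>(1) inj_on_finite by blast
    then show ?thesis by simp
  qed
  have "countable (\<Union>n. {\<alpha>\<in>?Bad. C \<alpha> \<inter> V n = {}})"
    by (intro countable_UN countable_finite[OF fin] countableI_type)
  moreover have "?Bad \<subseteq> (\<Union>n. {\<alpha>\<in>?Bad. C \<alpha> \<inter> V n = {}})"
  proof
    fix \<alpha> assume \<alpha>: "\<alpha> \<in> ?Bad"
    from ex_n[OF this] obtain n where "C \<alpha> \<inter> V n = {}" by (rule exE)
    then show "\<alpha> \<in> (\<Union>n. {\<alpha>\<in>?Bad. C \<alpha> \<inter> V n = {}})"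
      by (intro UN_I[OF UNIV_I, of _ _ n] CollectI conjI \<alpha>)
  qed
  ultimately show ?thesis by (rule countable_subset[rotated])
qed

end

lemma topological_abelian_group_product:
  assumes "\<And>i. i \<in> I \<Longrightarrow> topological_abelian_group (D i) (T i)"
  shows "topological_abelian_group (product_group I D) (product_topology T I)"
proof -
  have tg: "comm_group (D i)" "group (D i)" "topspace (T i) = carrier (D i)" "Hausdorff_space (T i)"
    "continuous_map (prod_topology (T i) (T i)) (T i) (\<lambda>(x, y). x \<otimes>\<^bsub>D i\<^esub> y)"
    "continuous_map (T i) (T i) (\<lambda>x. inv\<^bsub>D i\<^esub> x)" if "i \<in> I" for i
  proof -
    interpret topological_abelian_group "D i" "T i" by (rule assms[OF that])
    show "comm_group (D i)" "group (D i)" "topspace (T i) = carrier (D i)" "Hausdorff_space (T i)"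
      "continuous_map (prod_topology (T i) (T i)) (T i) (\<lambda>(x, y). x \<otimes>\<^bsub>D i\<^esub> y)"
      "continuous_map (T i) (T i) (\<lambda>x. inv\<^bsub>D i\<^esub> x)"
      using comm_group_axioms is_group topspace_eq Hausdorff continuous_mult continuous_inv by auto
  qed
  have ts: "topspace (product_topology T I) = carrier (product_group I D)"
    using tg(3) by (auto intro!: PiE_cong)
  have "comm_group (product_group I D)"
  proof (rule group.group_comm_groupI)
    show "group (product_group I D)" using tg(2) by (rule product_group)
    fix x y assume "x \<in> carrier (product_group I D)" "y \<in> carrier (product_group I D)"
    then show "x \<otimes>\<^bsub>product_group I D\<^esub> y = y \<otimes>\<^bsub>product_group I D\<^esub> x"
      using tg(1) by (auto intro!: restrict_ext comm_monoid.m_comm[OF comm_group.axioms(1)])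
  qed
  then interpret P: comm_group "product_group I D" .
  let ?P = "product_topology T I"
  show ?thesis
  proof unfold_locales
    show "topspace ?P = carrier (product_group I D)" by (rule ts)
    show "Hausdorff_space ?P" using tg(4) by (auto simp: Hausdorff_space_product_topology)
    have "continuous_map ?P ?P (\<lambda>x. \<lambda>i\<in>I. inv\<^bsub>D i\<^esub> x i)"
      unfolding continuous_map_componentwise
    proof (intro conjI ballI)
      fix i assume i: "i \<in> I"
      have "continuous_map ?P (T i) (\<lambda>x. inv\<^bsub>D i\<^esub> x i)"
        using continuous_map_compose[OF continuous_map_product_projection[OF i, of T] tg(6)[OF i]]
        by (simp add: comp_def)
      then show "continuous_map ?P (T i) (\<lambda>x. (\<lambda>i\<in>I. inv\<^bsub>D i\<^esub> x i) i)" using i by simp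
    qed auto
    then show "continuous_map ?P ?P (\<lambda>x. inv\<^bsub>product_group I D\<^esub> x)"
      by (rule continuous_map_eq) (use ts tg(2) in auto)
    have "continuous_map (prod_topology ?P ?P) ?P (\<lambda>p. \<lambda>i\<in>I. fst p i \<otimes>\<^bsub>D i\<^esub> snd p i)"
      unfolding continuous_map_componentwise
    proof (intro conjI ballI)
      fix i assume i: "i \<in> I"
      have "continuous_map (prod_topology ?P ?P) (prod_topology (T i) (T i)) (\<lambda>p. (fst p i, snd p i))"
        using continuous_map_compose[OF continuous_map_fst continuous_map_product_projection[OF i, of T], of ?P]
          continuous_map_compose[OF continuous_map_snd continuous_map_product_projection[OF i, of T], of ?P]
        by (intro continuous_map_pairedI) (simp_all add: comp_def)
      from continuous_map_compose[OF this tg(5)[OF i]]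
      show "continuous_map (prod_topology ?P ?P) (T i) (\<lambda>p. (\<lambda>i\<in>I. fst p i \<otimes>\<^bsub>D i\<^esub> snd p i) i)"
        using i by (simp add: comp_def)
    qed auto
    then show "continuous_map (prod_topology ?P ?P) ?P (\<lambda>(x, y). x \<otimes>\<^bsub>product_group I D\<^esub> y)"
      by (rule continuous_map_eq) auto
  qed
qed

section \<open>Products of feathered groups\<close>

lemma aleph1_infinite_Card_order:
  "Card_order (cardSuc natLeq)" "\<not> finite (Field (cardSuc natLeq))"
   apply (rule cardSuc_Card_order[OF natLeq_Card_order])
  apply (simp only: cardSuc_finite[OF natLeq_Card_order] Field_natLeq infinite_UNIV_nat not_False_eq_True)
  done

locale feathered_product =
  fixes I :: "'i set" and D :: "'i \<Rightarrow> ('a, 'b) monoid_scheme" and T :: "'i \<Rightarrow> 'a topology"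
  assumes factor_group: "i \<in> I \<Longrightarrow> topological_abelian_group (D i) (T i)"
    and factor_feathered: "i \<in> I \<Longrightarrow> feathered (T i)"
begin

abbreviation "DD \<equiv> product_group I D"
abbreviation "TT \<equiv> product_topology T I"

lemma factor_is_group: "i \<in> I \<Longrightarrow> group (D i)"
  using factor_group topological_abelian_group.axioms(1) comm_group.axioms(2) by blast

lemma factor_topspace: "i \<in> I \<Longrightarrow> topspace (T i) = carrier (D i)"
  by (rule topological_abelian_group.topspace_eq[OF factor_group])

sublocale Prod: topological_abelian_group DD TT
  by (rule topological_abelian_group_product[OF factor_group])

lemma inv_DD: "x \<in> carrier DD \<Longrightarrow> inv\<^bsub>DD\<^esub> x = (\<lambda>i\<in>I. inv\<^bsub>D i\<^esub> x i)"
  using inv_product_group[of x I D] factor_is_group by simp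

lemma Sigma_aleph1_countableI:
  assumes "x \<in> carrier DD" "countable (supp I D x)"
  shows "x \<in> Sigma_aleph1 I D"
proof -
  include cardinal_syntax
  have "|supp I D x| \<le>o natLeq" using assms(2) by (simp only: countable_card_le_natLeq)
  then have "|supp I D x| \<le>o cardSuc natLeq"
    using cardSuc_ordLeq[OF natLeq_Card_order] ordLeq_transitive by blast
  then show ?thesis using assms(1) by (simp only: Sigma_aleph1_def mem_Collect_eq)
qed

lemma subgroup_Sigma_aleph1: "subgroup (Sigma_aleph1 I D) DD"
proof (rule Prod.subgroupI)
  include cardinal_syntax
  note c = aleph1_infinite_Card_order
  show "Sigma_aleph1 I D \<subseteq> carrier DD" unfolding Sigma_aleph1_def by blast
  have "supp I D \<one>\<^bsub>DD\<^esub> = {}" by (auto simp: supp_def)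
  then have "\<one>\<^bsub>DD\<^esub> \<in> Sigma_aleph1 I D" by (intro Sigma_aleph1_countableI Prod.one_closed) simp
  then show "Sigma_aleph1 I D \<noteq> {}" by blast
  fix x assume x: "x \<in> Sigma_aleph1 I D"
  then have xc: "x \<in> carrier DD" and xs: "|supp I D x| \<le>o cardSuc natLeq"
    unfolding Sigma_aleph1_def by blast+
  have "supp I D (inv\<^bsub>DD\<^esub> x) \<subseteq> supp I D x"
    using factor_is_group by (auto simp: inv_DD[OF xc] supp_def group.is_monoid monoid.inv_one)
  then have "|supp I D (inv\<^bsub>DD\<^esub> x)| \<le>o cardSuc natLeq"
    using card_of_mono1 xs ordLeq_transitive by blast
  then show "inv\<^bsub>DD\<^esub> x \<in> Sigma_aleph1 I D"
    unfolding Sigma_aleph1_def using Prod.inv_closed[OF xc] by blast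
  fix y assume y: "y \<in> Sigma_aleph1 I D"
  then have yc: "y \<in> carrier DD" and ys: "|supp I D y| \<le>o cardSuc natLeq"
    unfolding Sigma_aleph1_def by blast+
  have "supp I D (x \<otimes>\<^bsub>DD\<^esub> y) \<subseteq> supp I D x \<union> supp I D y"
    using factor_is_group by (auto simp: supp_def group.is_monoid monoid.l_one)
  moreover have "|supp I D x \<union> supp I D y| \<le>o cardSuc natLeq"
    by (rule card_of_Un_ordLeq_infinite_Field[OF c(2) xs ys c(1)])
  ultimately have "|supp I D (x \<otimes>\<^bsub>DD\<^esub> y)| \<le>o cardSuc natLeq"
    using card_of_mono1 ordLeq_transitive by blast
  then show "x \<otimes>\<^bsub>DD\<^esub> y \<in> Sigma_aleph1 I D"
    unfolding Sigma_aleph1_def using Prod.m_closed[OF xc yc] by blast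
qed

abbreviation "quo i a b \<equiv> a \<otimes>\<^bsub>D i\<^esub> inv\<^bsub>D i\<^esub> b"
abbreviation "good i \<equiv> topological_abelian_group.good_subgroup (D i) (T i)"

definition basic :: "('i \<Rightarrow> 'a set) \<Rightarrow> bool" where
  "basic N \<longleftrightarrow> (\<forall>i\<in>I. good i (N i)) \<and>
     countable {i\<in>I. N i \<noteq> carrier (D i)}"

lemma basic_good: "basic N \<Longrightarrow> i \<in> I \<Longrightarrow> good i (N i)"
  by (simp add: basic_def)

lemma basic_countable: "basic N \<Longrightarrow> countable {i\<in>I. N i \<noteq> carrier (D i)}"
  by (simp add: basic_def)

lemma basic_subgroup: "basic N \<Longrightarrow> i \<in> I \<Longrightarrow> subgroup (N i) (D i)"
  by (rule topological_abelian_group.good_subgroup_subgroup[OF factor_group basic_good])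

lemma basic_compactin: "basic N \<Longrightarrow> i \<in> I \<Longrightarrow> N i \<noteq> carrier (D i) \<Longrightarrow> compactin (T i) (N i)"
  by (rule topological_abelian_group.good_subgroup_compactin[OF factor_group basic_good])

lemma box_subgroup: "basic N \<Longrightarrow> subgroup (PiE I N) DD"
  using PiE_subgroup_product_group[of I D N] factor_is_group basic_subgroup by blast

lemma box_gdelta:
  assumes N: "basic N"
  shows "gdelta_in TT (PiE I N)"
proof -
  let ?J = "{i\<in>I. N i \<noteq> carrier (D i)}"
  \<comment> \<open>The whole space is included for the case that no coordinate is
    restricted.\<close>
  let ?\<S> = "insert (topspace TT) ((\<lambda>i. {x \<in> topspace TT. x i \<in> N i}) ` ?J)"
  have "gdelta_in TT (\<Inter>?\<S>)"
  proof (rule gdelta_in_Inter)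
    show "countable ?\<S>" using basic_countable[OF N] by (intro countable_insert countable_image)
    show "?\<S> \<noteq> {}" by blast
    fix S assume "S \<in> ?\<S>"
    then consider "S = topspace TT" | i where "i \<in> I" "S = {x \<in> topspace TT. x i \<in> N i}" by blast
    then show "gdelta_in TT S"
    proof cases
      case 2
      then show ?thesis
        using gdelta_in_preimage[OF continuous_map_product_projection[of i I T]
            topological_abelian_group.good_subgroup_gdelta[OF factor_group[of i] basic_good[OF N, of i]]]
        by simp
    qed (simp only: gdelta_in_topspace)
  qed
  moreover have "\<Inter>?\<S> = PiE I N"
  proof (intro subset_antisym subsetI)
    fix x assume x: "x \<in> \<Inter>?\<S>"
    have "x \<in> topspace TT" using x by blast
    then have xc: "x \<in> (\<Pi>\<^sub>E i\<in>I. carrier (D i))" using Prod.topspace_eq by simp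
    have "x i \<in> N i" if "i \<in> I" for i
    proof (cases "N i = carrier (D i)")
      case True
      then show ?thesis using xc that by auto
    next
      case False
      then have "{x \<in> topspace TT. x i \<in> N i} \<in> ?\<S>" using that by blast
      then show ?thesis using x by blast
    qed
    then show "x \<in> PiE I N" using xc by (auto simp: PiE_iff)
  next
    fix x assume x: "x \<in> PiE I N"
    then have "x \<in> carrier DD" using subgroup.mem_carrier[OF box_subgroup[OF N]] by blast
    then have "x \<in> topspace TT" using Prod.topspace_eq by simp
    then show "x \<in> \<Inter>?\<S>" using x by (auto simp del: topspace_product_topology)
  qed
  ultimately show ?thesis by simp
qed

text \<open>A \<open>G\<^sub>\<delta>\<close> around the identity contains a countable intersection
  of standard boxes, which restricts a countable set \<open>J\<close> of coordinates. In each of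
  these, featheredness gives a compact good subgroup inside the countably many open sets that
  occur.\<close>

lemma basic_base:
  assumes U: "openin (P_modification TT) U" "\<one>\<^bsub>DD\<^esub> \<in> U"
  shows "\<exists>N. basic N \<and> PiE I N \<subseteq> U"
proof -
  let ?e = "\<one>\<^bsub>DD\<^esub>"
  obtain S where S: "gdelta_in TT S" "?e \<in> S" "S \<subseteq> U"
    using U unfolding openin_P_modification_iff by blast
  then obtain C where C: "\<And>n::nat. openin TT (C n)" "\<Inter>(range C) = S"
    unfolding gdelta_in_descending by blast
  have "\<forall>n. \<exists>B. finite {i\<in>I. B i \<noteq> topspace (T i)} \<and> (\<forall>i\<in>I. openin (T i) (B i)) \<and> ?e \<in> PiE I B \<and> PiE I B \<subseteq> C n"
  proof
    fix n
    have "?e \<in> C n" using S(2) C(2) by blast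
    then show "\<exists>B. finite {i\<in>I. B i \<noteq> topspace (T i)} \<and> (\<forall>i\<in>I. openin (T i) (B i)) \<and> ?e \<in> PiE I B \<and> PiE I B \<subseteq> C n"
      using C(1)[of n] unfolding openin_product_topology_alt by (rule bspec[rotated])
  qed
  from choice[OF this] obtain B where B0: "\<forall>n. finite {i\<in>I. B n i \<noteq> topspace (T i)} \<and>
      (\<forall>i\<in>I. openin (T i) (B n i)) \<and> ?e \<in> PiE I (B n) \<and> PiE I (B n) \<subseteq> C n" by (rule exE)
  have B: "finite {i\<in>I. B n i \<noteq> topspace (T i)}" "i \<in> I \<Longrightarrow> openin (T i) (B n i)"
    "?e \<in> PiE I (B n)" "PiE I (B n) \<subseteq> C n" for n i
    using B0[THEN spec, of n] by simp_all
  define J where "J = (\<Union>n. {i\<in>I. B n i \<noteq> topspace (T i)})"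
  have J: "countable J" unfolding J_def by (intro countable_UN countable_finite B(1) countableI_type)
  have ex: "\<exists>N. good i N \<and> N \<subseteq> (\<Inter>n. B n i)" if i: "i \<in> I" for i
  proof (rule topological_abelian_group.feathered_good_subgroup[OF factor_group[OF i] factor_feathered[OF i]])
    show "openin (T i) (B n i)" for n using B(2)[OF i] .
    show "\<one>\<^bsub>D i\<^esub> \<in> B n i" for n using B(3)[of n] i by (auto simp: PiE_iff)
  qed
  from ex have "\<forall>i\<in>I. \<exists>N. good i N \<and> N \<subseteq> (\<Inter>n. B n i)"
    by (rule ballI)
  from bchoice[OF this] obtain M
    where M0: "\<forall>i\<in>I. good i (M i) \<and> M i \<subseteq> (\<Inter>n. B n i)"
    by (rule exE)
  have M: "good i (M i)" "M i \<subseteq> (\<Inter>n. B n i)" if "i \<in> I" for i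
    using bspec[OF M0 that] by simp_all
  define N where "N i = (if i \<in> J then M i else carrier (D i))" for i
  have "basic N"
    unfolding basic_def
  proof (intro conjI ballI)
    show "good i (N i)" if "i \<in> I" for i
      using M(1)[OF that] topological_abelian_group.good_subgroup_carrier[OF factor_group[OF that]]
      by (simp add: N_def)
    show "countable {i\<in>I. N i \<noteq> carrier (D i)}"
      by (rule countable_subset[OF _ J]) (auto simp: N_def)
  qed
  moreover have "PiE I N \<subseteq> U"
  proof
    fix x assume x: "x \<in> PiE I N"
    have "x \<in> C n" for n
    proof -
      have "x i \<in> B n i" if i: "i \<in> I" for i
      proof (cases "i \<in> J")
        case True
        then have "x i \<in> M i" using x i by (auto simp: N_def PiE_iff)
        then show ?thesis using M(2)[OF i] by blast
      next
        case False
        then have "B n i = carrier (D i)" using i factor_topspace[OF i] unfolding J_def by auto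
        moreover have "x i \<in> carrier (D i)" using False x i by (auto simp: N_def PiE_iff)
        ultimately show ?thesis by simp
      qed
      then have "x \<in> PiE I (B n)" using x by (auto simp: PiE_iff)
      then show ?thesis using B(4) by blast
    qed
    then show "x \<in> U" using C(2) S(3) by blast
  qed
  ultimately show ?thesis by blast
qed

text \<open>Solve coordinatewise, taking the identity where no \<open>L \<beta>\<close> is
  restricted. The support is then covered by at most \<open>\<aleph>\<^sub>1\<close> countable sets,
  so the solution stays in the \<Sigma>-product.\<close>

lemma product_cosets_meet:
  includes cardinal_syntax
  fixes S :: "'k set"
  assumes R: "total_on S R" and S: "|S| \<le>o cardSuc natLeq"
    and L: "\<And>\<alpha> i. \<alpha> \<in> S \<Longrightarrow> i \<in> I \<Longrightarrow> subgroup (L \<alpha> i) (D i)"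
      "\<And>\<alpha> i. \<alpha> \<in> S \<Longrightarrow> i \<in> I \<Longrightarrow> L \<alpha> i = carrier (D i) \<or> compactin (T i) (L \<alpha> i)"
      "\<And>\<alpha>. \<alpha> \<in> S \<Longrightarrow> countable {i\<in>I. L \<alpha> i \<noteq> carrier (D i)}"
    and z: "\<And>\<alpha>. \<alpha> \<in> S \<Longrightarrow> z \<alpha> \<in> carrier DD"
    and nested: "\<And>\<alpha> \<beta> i. \<alpha> \<in> S \<Longrightarrow> \<beta> \<in> S \<Longrightarrow> (\<beta>, \<alpha>) \<in> R \<Longrightarrow> i \<in> I \<Longrightarrow>
      L \<alpha> i \<subseteq> L \<beta> i \<and> quo i (z \<alpha> i) (z \<beta> i) \<in> L \<beta> i"
  shows "\<exists>w\<in>Sigma_aleph1 I D. \<forall>\<beta>\<in>S. \<forall>i\<in>I. quo i (w i) (z \<beta> i) \<in> L \<beta> i"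
proof -
  have "\<forall>i\<in>I. \<exists>w. w \<in> carrier (D i) \<and> (\<forall>\<beta>\<in>S. quo i w (z \<beta> i) \<in> L \<beta> i) \<and>
      ((\<forall>\<beta>\<in>S. L \<beta> i = carrier (D i)) \<longrightarrow> w = \<one>\<^bsub>D i\<^esub>)"
  proof
    fix i assume i: "i \<in> I"
    have "z \<alpha> i \<in> carrier (D i)" if "\<alpha> \<in> S" for \<alpha> using z[OF that] i by (auto simp: PiE_iff)
    from topological_abelian_group.nested_cosets_meet[OF factor_group[OF i] R, of "\<lambda>\<alpha>. L \<alpha> i" "\<lambda>\<alpha>. z \<alpha> i",
        OF L(1)[OF _ i] L(2)[OF _ i] this nested[OF _ _ _ i]]
    show "\<exists>w. w \<in> carrier (D i) \<and> (\<forall>\<beta>\<in>S. quo i w (z \<beta> i) \<in> L \<beta> i) \<and>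
      ((\<forall>\<beta>\<in>S. L \<beta> i = carrier (D i)) \<longrightarrow> w = \<one>\<^bsub>D i\<^esub>)"
      unfolding Bex_def .
  qed
  from bchoice[OF this] obtain w where w: "\<forall>i\<in>I. w i \<in> carrier (D i) \<and>
      (\<forall>\<beta>\<in>S. quo i (w i) (z \<beta> i) \<in> L \<beta> i) \<and>
      ((\<forall>\<beta>\<in>S. L \<beta> i = carrier (D i)) \<longrightarrow> w i = \<one>\<^bsub>D i\<^esub>)" by (rule exE)
  let ?w = "restrict w I"
  have "supp I D ?w \<subseteq> (\<Union>\<beta>\<in>S. {i\<in>I. L \<beta> i \<noteq> carrier (D i)})"
  proof
    fix i assume "i \<in> supp I D ?w"
    then have "i \<in> I" "w i \<noteq> \<one>\<^bsub>D i\<^esub>" by (auto simp: supp_def)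
    then have "\<exists>\<beta>\<in>S. L \<beta> i \<noteq> carrier (D i)" using w by blast
    then show "i \<in> (\<Union>\<beta>\<in>S. {i\<in>I. L \<beta> i \<noteq> carrier (D i)})" using \<open>i \<in> I\<close> by blast
  qed
  moreover have "|\<Union>\<beta>\<in>S. {i\<in>I. L \<beta> i \<noteq> carrier (D i)}| \<le>o cardSuc natLeq"
  proof (rule card_of_UNION_ordLeq_infinite_Field[OF aleph1_infinite_Card_order(2,1) S])
    show "\<forall>\<beta>\<in>S. |{i\<in>I. L \<beta> i \<noteq> carrier (D i)}| \<le>o cardSuc natLeq"
    proof
      fix \<beta> assume "\<beta> \<in> S"
      from L(3)[OF this] have "|{i\<in>I. L \<beta> i \<noteq> carrier (D i)}| \<le>o natLeq"
        by (simp only: countable_card_le_natLeq)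
      then show "|{i\<in>I. L \<beta> i \<noteq> carrier (D i)}| \<le>o cardSuc natLeq"
        using cardSuc_ordLeq[OF natLeq_Card_order] ordLeq_transitive by blast
    qed
  qed
  ultimately have "|supp I D ?w| \<le>o cardSuc natLeq"
    using card_of_mono1 ordLeq_transitive by blast
  moreover have "?w \<in> carrier DD" using w by auto
  ultimately have "?w \<in> Sigma_aleph1 I D" unfolding Sigma_aleph1_def by blast
  moreover have "\<forall>\<beta>\<in>S. \<forall>i\<in>I. quo i (?w i) (z \<beta> i) \<in> L \<beta> i" using w by simp
  ultimately show ?thesis by blast
qed

end

section \<open>Equicontinuity of compact sets of characters\<close>

locale intermediate_subgroup = feathered_product I D T
  for I :: "'i set" and D :: "'i \<Rightarrow> ('a, 'b) monoid_scheme" and T :: "'i \<Rightarrow> 'a topology" +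
  fixes G :: "('i \<Rightarrow> 'a) set"
  assumes G_subgroup: "subgroup G DD" and Sigma_sub: "Sigma_aleph1 I D \<subseteq> G"
begin

abbreviation "GG \<equiv> DD\<lparr>carrier := G\<rparr>"
abbreviation "GTop \<equiv> subtopology (P_modification TT) G"

sublocale S: P_group GG GTop
  by (rule Prod.P_group_subgroup_P_modification[OF G_subgroup])

lemma G_carrier: "x \<in> G \<Longrightarrow> x \<in> carrier DD"
  using subgroup.mem_carrier[OF G_subgroup] .

lemma G_coord: "x \<in> G \<Longrightarrow> i \<in> I \<Longrightarrow> x i \<in> carrier (D i)"
  using G_carrier[of x] by (auto simp: PiE_iff)

lemma box_coord: "x \<in> PiE I N \<Longrightarrow> i \<in> I \<Longrightarrow> x i \<in> N i"
  by (auto simp: PiE_iff)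

lemma box_open:
  assumes "basic N" shows "openin GTop (PiE I N \<inter> G)"
  unfolding openin_subtopology
  using gdelta_in_imp_openin_P_modification[OF box_gdelta[OF assms]] by blast

lemma box_G_subgroup: "basic N \<Longrightarrow> subgroup (PiE I N \<inter> G) DD"
  by (intro subgroup_Int box_subgroup G_subgroup)

lemma basic_base_G:
  assumes U: "openin GTop U" "\<one>\<^bsub>DD\<^esub> \<in> U"
  shows "\<exists>N. basic N \<and> PiE I N \<inter> G \<subseteq> U"
proof -
  obtain V where V: "openin (P_modification TT) V" "U = V \<inter> G"
    using U(1) unfolding openin_subtopology by blast
  then have "\<one>\<^bsub>DD\<^esub> \<in> V" using U(2) by blast
  from basic_base[OF V(1) this] obtain N where "basic N" "PiE I N \<subseteq> V" by blast
  then show ?thesis using V(2) by blast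
qed

text \<open>Points supported at a single coordinate belong to \<open>G\<close>, so intersecting a
  box with \<open>G\<close> loses nothing coordinatewise.\<close>

lemma box_subset_coord:
  assumes N: "basic N" and sub: "PiE I N \<inter> G \<subseteq> PiE I M" and i: "i \<in> I"
  shows "N i \<subseteq> M i"
proof
  fix a assume a: "a \<in> N i"
  define e where "e = (\<lambda>j\<in>I. if j = i then a else \<one>\<^bsub>D j\<^esub>)"
  have "e \<in> PiE I N"
    using a subgroup.one_closed[OF basic_subgroup[OF N]] by (auto simp: e_def PiE_iff)
  moreover from this have "e \<in> carrier DD" using subgroup.mem_carrier[OF box_subgroup[OF N]] by blast
  then have "e \<in> Sigma_aleph1 I D"
    by (rule Sigma_aleph1_countableI)
       (rule countable_subset[of _ "{i}"], auto simp: supp_def e_def split: if_splits)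
  ultimately have "e \<in> PiE I M" using sub Sigma_sub by blast
  from box_coord[OF this i] show "a \<in> M i" using i by (simp add: e_def)
qed

text \<open>Congruence modulo the box. A character trivial on the box takes the same value at
  congruent points of \<open>G\<close>.\<close>

definition near :: "('i \<Rightarrow> 'a set) \<Rightarrow> ('i \<Rightarrow> 'a) \<Rightarrow> ('i \<Rightarrow> 'a) \<Rightarrow> bool" where
  "near N x y \<longleftrightarrow> (\<forall>i\<in>I. quo i (x i) (y i) \<in> N i)"

lemma nearD: "near N x y \<Longrightarrow> i \<in> I \<Longrightarrow> quo i (x i) (y i) \<in> N i"
  by (simp add: near_def)

lemma near_box:
  assumes N: "basic N" and n: "near N x y" and x: "x \<in> carrier DD" and y: "y \<in> PiE I N"
  shows "x \<in> PiE I N"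
proof -
  have "x i \<in> N i" if i: "i \<in> I" for i
  proof -
    interpret Di: topological_abelian_group "D i" "T i" by (rule factor_group[OF i])
    have c: "x i \<in> carrier (D i)" "y i \<in> carrier (D i)"
      using x i subgroup.mem_carrier[OF box_subgroup[OF N] y] by (auto simp: PiE_iff)
    have "quo i (x i) (y i) \<otimes>\<^bsub>D i\<^esub> y i \<in> N i"
      by (rule subgroup.m_closed[OF basic_subgroup[OF N i] nearD[OF n i] box_coord[OF y i]])
    then show ?thesis using c by (simp add: Di.m_assoc)
  qed
  then show ?thesis using x by (auto simp: PiE_iff)
qed

lemma near_eq:
  assumes N: "basic N" and n: "near N x y" and x: "x \<in> G" and y: "y \<in> G"
    and \<phi>: "\<phi> \<in> characters GG GTop" "\<And>v. v \<in> PiE I N \<inter> G \<Longrightarrow> \<phi> v = 1"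
  shows "\<phi> x = \<phi> y"
proof -
  let ?v = "x \<otimes>\<^bsub>DD\<^esub> inv\<^bsub>DD\<^esub> y"
  have iy: "inv\<^bsub>DD\<^esub> y \<in> G" by (rule subgroup.m_inv_closed[OF G_subgroup y])
  have vG: "?v \<in> G" by (rule subgroup.m_closed[OF G_subgroup x iy])
  have "?v \<in> PiE I N" using nearD[OF n] by (auto simp: inv_DD[OF G_carrier[OF y]] PiE_iff)
  then have v1: "\<phi> ?v = 1" using \<phi>(2) vG by blast
  have "?v \<otimes>\<^bsub>DD\<^esub> y = x"
    using Prod.m_assoc[OF G_carrier[OF x] Prod.inv_closed[OF G_carrier[OF y]] G_carrier[OF y]]
      Prod.l_inv[OF G_carrier[OF y]] Prod.r_one[OF G_carrier[OF x]] by (simp only:)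
  moreover have "\<phi> (?v \<otimes>\<^bsub>DD\<^esub> y) = \<phi> ?v * \<phi> y"
    using S.hom_circle_mult[OF S.X_hom[OF \<phi>(1)], of ?v y] vG y by simp
  ultimately show ?thesis using v1 by (simp only: mult_1_left)
qed

lemma box_nat_pow:
  assumes H: "subgroup H DD" and x: "x \<in> H" "x \<in> G"
  shows "x [^]\<^bsub>GG\<^esub> (n::nat) \<in> H"
proof (induction n)
  case 0
  then show ?case using subgroup.one_closed[OF H] by (simp del: one_product_group)
next
  case (Suc n)
  then show ?case using subgroup.m_closed[OF H Suc x(1)] by (simp del: mult_product_group)
qed

text \<open>The countably many earlier boxes meet in an open set, where some \<phi> in
  \<open>C\<close> is nontrivial. A power of the point found makes the value far from 1 without
  leaving the earlier boxes, and the new box is taken inside them and where \<phi> is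
  trivial.\<close>

lemma transfinite_witnesses:
  fixes R :: "'k rel"
  assumes R: "wf R" "\<And>\<alpha>. countable {\<beta>. (\<beta>, \<alpha>) \<in> R}"
    and C: "C \<subseteq> characters GG GTop"
    and ne: "\<forall>U. openin GTop U \<and> \<one>\<^bsub>DD\<^esub> \<in> U \<longrightarrow> (\<exists>\<phi>\<in>C. \<exists>x\<in>U. \<phi> x \<noteq> 1)"
  shows "\<exists>ch pt N. \<forall>\<alpha>. ch \<alpha> \<in> C \<and> pt \<alpha> \<in> G \<and> basic (N \<alpha>) \<and> 1 \<le> dist (ch \<alpha> (pt \<alpha>)) 1 \<and>
     (\<forall>v\<in>PiE I (N \<alpha>) \<inter> G. ch \<alpha> v = 1) \<and>
     (\<forall>\<beta>. (\<beta>, \<alpha>) \<in> R \<longrightarrow> pt \<alpha> \<in> PiE I (N \<beta>) \<and> (\<forall>i\<in>I. N \<alpha> i \<subseteq> N \<beta> i))"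
proof -
  \<comment> \<open>Well-founded choice produces one function, so a stage is a triple of character,
    point and box.\<close>
  define P where "P = (\<lambda>(f :: 'k \<Rightarrow> (('i \<Rightarrow> 'a) \<Rightarrow> complex) \<times> ('i \<Rightarrow> 'a) \<times> ('i \<Rightarrow> 'a set)) \<alpha> (v :: (('i \<Rightarrow> 'a) \<Rightarrow> complex) \<times> ('i \<Rightarrow> 'a) \<times> ('i \<Rightarrow> 'a set)).
     fst v \<in> C \<and> fst (snd v) \<in> G \<and> basic (snd (snd v)) \<and> 1 \<le> dist (fst v (fst (snd v))) 1 \<and>
     (\<forall>y\<in>PiE I (snd (snd v)) \<inter> G. fst v y = 1) \<and>
     (\<forall>\<beta>. (\<beta>, \<alpha>) \<in> R \<longrightarrow> fst (snd v) \<in> PiE I (snd (snd (f \<beta>))) \<and>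
        (\<forall>i\<in>I. snd (snd v) i \<subseteq> snd (snd (f \<beta>)) i)))"
  have "\<exists>f. \<forall>\<alpha>. P f \<alpha> (f \<alpha>)"
  proof (rule dependent_wf_choice[OF R(1)])
    show "P f \<alpha> v = P g \<alpha> v" if "\<And>\<beta>. (\<beta>, \<alpha>) \<in> R \<Longrightarrow> f \<beta> = g \<beta>" for f g \<alpha> v
      unfolding P_def using that by auto
    fix \<alpha> f assume IH: "\<And>\<beta>. (\<beta>, \<alpha>) \<in> R \<Longrightarrow> P f \<beta> (f \<beta>)"
    define M where "M \<beta> = snd (snd (f \<beta>))" for \<beta>
    have M: "basic (M \<beta>)" if "(\<beta>, \<alpha>) \<in> R" for \<beta> using IH[OF that] by (simp add: P_def M_def)
    \<comment> \<open>\<open>G\<close> is included for stages without predecessors, where the family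
      would be empty.\<close>
    let ?\<U> = "insert G ((\<lambda>\<beta>. PiE I (M \<beta>) \<inter> G) ` {\<beta>. (\<beta>, \<alpha>) \<in> R})"
    have U: "openin GTop (\<Inter>?\<U>)"
    proof (rule S.openin_countable_Inter)
      show "countable ?\<U>" using R(2) by (intro countable_insert countable_image)
      show "?\<U> \<noteq> {}" by blast
      fix X assume "X \<in> ?\<U>"
      then show "openin GTop X" using S.openin_carrier_self box_open[OF M] by auto
    qed
    have one: "\<one>\<^bsub>DD\<^esub> \<in> \<Inter>?\<U>"
      using subgroup.one_closed[OF G_subgroup] subgroup.one_closed[OF box_G_subgroup[OF M]] by blast
    obtain \<phi> x where \<phi>: "\<phi> \<in> C" and x: "x \<in> \<Inter>?\<U>" "\<phi> x \<noteq> 1" using ne[THEN spec, THEN mp, OF conjI[OF U one]] by blast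
    have ch: "\<phi> \<in> characters GG GTop" using \<phi> C by blast
    have xG: "x \<in> G" using x by blast
    have "\<exists>n::nat. 1 \<le> dist (\<phi> x ^ n) 1"
    proof (rule ccontr)
      assume "\<nexists>n. 1 \<le> dist (\<phi> x ^ n) 1"
      then have small: "dist (\<phi> x ^ n) 1 < 1" for n :: nat by (simp add: not_le)
      have "\<phi> x = 1" by (rule no_small_subgroup[OF S.X_norm[OF ch] small]) (simp add: xG)
      then show False using x(2) by simp
    qed
    then obtain n :: nat where n: "1 \<le> dist (\<phi> x ^ n) 1" by blast
    let ?y = "x [^]\<^bsub>GG\<^esub> n"
    have yG: "?y \<in> G" using xG S.nat_pow_closed[of x n] by simp
    have y1: "1 \<le> dist (\<phi> ?y) 1"
      using S.hom_circle_nat_pow[OF S.X_hom[OF ch], of x n] xG n by simp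
    have yM: "?y \<in> PiE I (M \<beta>)" if "(\<beta>, \<alpha>) \<in> R" for \<beta>
      by (rule box_nat_pow[OF box_subgroup[OF M[OF that]] _ xG]) (use x(1) that in blast)
    obtain N0 where N0: "openin GTop N0" "\<one>\<^bsub>GG\<^esub> \<in> N0" "\<forall>x\<in>N0. \<phi> x = 1"
      using ch S.characters_trivial_near_one by blast
    have "\<one>\<^bsub>DD\<^esub> \<in> N0 \<inter> \<Inter>?\<U>" using N0(2) one by simp
    from basic_base_G[OF openin_Int[OF N0(1) U] this]
    obtain N where N: "basic N" "PiE I N \<inter> G \<subseteq> N0 \<inter> \<Inter>?\<U>"
      by (elim exE conjE)
    have "N i \<subseteq> M \<beta> i" if "(\<beta>, \<alpha>) \<in> R" "i \<in> I" for \<beta> i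
      by (rule box_subset_coord[OF N(1) _ that(2)]) (use N(2) that(1) in blast)
    then have "P f \<alpha> (\<phi>, ?y, N)"
      unfolding P_def using \<phi> yG N y1 yM N0(3) by (auto simp: M_def)
    then show "\<exists>v. P f \<alpha> v" ..
  qed
  then obtain f where "\<forall>\<alpha>. P f \<alpha> (f \<alpha>)" by (rule exE)
  then show ?thesis
    unfolding P_def
    by (intro exI[of _ "\<lambda>\<alpha>. fst (f \<alpha>)"] exI[of _ "\<lambda>\<alpha>. fst (snd (f \<alpha>))"] exI[of _ "\<lambda>\<alpha>. snd (snd (f \<alpha>))"])
qed

lemma compact_equicontinuous:
  assumes C: "compactin S.dualT C"
  shows "\<exists>U. openin GTop U \<and> \<one>\<^bsub>GG\<^esub> \<in> U \<and> (\<forall>\<phi>\<in>C. \<forall>x\<in>U. \<phi> x = 1)"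
proof (rule ccontr)
  include cardinal_syntax
  assume no: "\<not> ?thesis"
  have ne: "\<forall>U. openin GTop U \<and> \<one>\<^bsub>DD\<^esub> \<in> U \<longrightarrow> (\<exists>\<phi>\<in>C. \<exists>x\<in>U. \<phi> x \<noteq> 1)"
    using no by auto
  have Cc: "C \<subseteq> characters GG GTop" using compactin_subset_topspace[OF C] by simp

  \<comment> \<open>The index set and the witnesses\<close>
  obtain W :: "nat set set" and R where R: "wf R" "total_on W R" "trans R"
    and seg: "\<forall>\<alpha>. countable {\<beta>. (\<beta>, \<alpha>) \<in> R} \<and> {\<beta>. (\<beta>, \<alpha>) \<in> R} \<subseteq> W"
    and W: "uncountable W" "|W| \<le>o cardSuc natLeq"
    using uncountable_wellorder_countable_segments by (elim exE conjE)
  have seg_count: "countable {\<beta>. (\<beta>, \<alpha>) \<in> R}" and seg_sub: "{\<beta>. (\<beta>, \<alpha>) \<in> R} \<subseteq> W" for \<alpha>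
    using seg by auto
  \<comment> \<open>A countable union of countable segments cannot exhaust \<open>W\<close>.\<close>
  have bound: "\<exists>\<gamma>\<in>W. \<forall>\<alpha>\<in>A. (\<alpha>, \<gamma>) \<in> R" if A: "countable A" "A \<subseteq> W" for A
  proof -
    have "countable (A \<union> (\<Union>\<alpha>\<in>A. {\<beta>. (\<beta>, \<alpha>) \<in> R}))"
      by (intro countable_Un countable_UN A seg_count)
    then have "\<not> W \<subseteq> A \<union> (\<Union>\<alpha>\<in>A. {\<beta>. (\<beta>, \<alpha>) \<in> R})" using W(1) countable_subset by blast
    then obtain \<gamma> where \<gamma>: "\<gamma> \<in> W" "\<gamma> \<notin> A" "\<And>\<alpha>. \<alpha> \<in> A \<Longrightarrow> (\<gamma>, \<alpha>) \<notin> R" by blast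
    have "(\<alpha>, \<gamma>) \<in> R" if "\<alpha> \<in> A" for \<alpha>
    proof -
      have "\<alpha> \<in> W" "\<alpha> \<noteq> \<gamma>" using that A \<gamma> by auto
      then have "(\<alpha>, \<gamma>) \<in> R \<or> (\<gamma>, \<alpha>) \<in> R" using R(2) \<gamma>(1) unfolding total_on_def by blast
      then show ?thesis using \<gamma>(3)[OF that] by blast
    qed
    then show ?thesis using \<gamma>(1) by blast
  qed
  obtain ch pt N where w: "\<forall>\<alpha>. ch \<alpha> \<in> C \<and> pt \<alpha> \<in> G \<and> basic (N \<alpha>) \<and> 1 \<le> dist (ch \<alpha> (pt \<alpha>)) 1 \<and>
     (\<forall>v\<in>PiE I (N \<alpha>) \<inter> G. ch \<alpha> v = 1) \<and>
     (\<forall>\<beta>. (\<beta>, \<alpha>) \<in> R \<longrightarrow> pt \<alpha> \<in> PiE I (N \<beta>) \<and> (\<forall>i\<in>I. N \<alpha> i \<subseteq> N \<beta> i))"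
    using transfinite_witnesses[OF R(1) seg_count Cc ne] by (elim exE)
  have ch: "ch \<alpha> \<in> C" and pt: "pt \<alpha> \<in> G" and N: "basic (N \<alpha>)" and far: "1 \<le> dist (ch \<alpha> (pt \<alpha>)) 1"
    and ch1: "\<And>v. v \<in> PiE I (N \<alpha>) \<inter> G \<Longrightarrow> ch \<alpha> v = 1" for \<alpha>
    using w[THEN spec, of \<alpha>] by auto
  have pt_N: "pt \<alpha> \<in> PiE I (N \<beta>)" and N_dec: "\<And>i. i \<in> I \<Longrightarrow> N \<alpha> i \<subseteq> N \<beta> i" if "(\<beta>, \<alpha>) \<in> R" for \<alpha> \<beta>
    using w[THEN spec, of \<alpha>] that by auto
  have chX: "ch \<alpha> \<in> characters GG GTop" for \<alpha> using ch Cc by blast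

  \<comment> \<open>A cofinal cluster point of the characters\<close>
  obtain \<phi> where \<phi>: "\<phi> \<in> C" and cluster: "\<And>Q \<alpha>. openin S.dualT Q \<Longrightarrow> \<phi> \<in> Q \<Longrightarrow> \<alpha> \<in> W \<Longrightarrow>
      \<exists>\<gamma>\<in>W. (\<alpha>, \<gamma>) \<in> R \<and> ch \<gamma> \<in> Q"
  \<comment> \<open>Otherwise every point of \<open>C\<close> has a neighbourhood that the
    characters avoid beyond some stage. Finitely many of these cover \<open>C\<close>, and a stage
    beyond the finitely many bounds leaves its character nowhere to lie.\<close>
  proof (rule ccontr)
    assume "\<not> thesis"
    then have "\<forall>\<phi>\<in>C. \<exists>p. openin S.dualT (fst p) \<and> \<phi> \<in> fst p \<and> snd p \<in> W \<and>
        (\<forall>\<gamma>\<in>W. (snd p, \<gamma>) \<in> R \<longrightarrow> ch \<gamma> \<notin> fst p)"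
      using that by (metis fst_conv snd_conv)
    from bchoice[OF this] obtain p where p: "\<forall>\<phi>\<in>C. openin S.dualT (fst (p \<phi>)) \<and> \<phi> \<in> fst (p \<phi>) \<and>
        snd (p \<phi>) \<in> W \<and> (\<forall>\<gamma>\<in>W. (snd (p \<phi>), \<gamma>) \<in> R \<longrightarrow> ch \<gamma> \<notin> fst (p \<phi>))" by (rule exE)
    have "\<forall>Q\<in>(\<lambda>\<phi>. fst (p \<phi>)) ` C. openin S.dualT Q" using p by blast
    moreover have "C \<subseteq> \<Union>((\<lambda>\<phi>. fst (p \<phi>)) ` C)" using p by blast
    ultimately obtain \<F> where \<F>: "finite \<F>" "\<F> \<subseteq> (\<lambda>\<phi>. fst (p \<phi>)) ` C" "C \<subseteq> \<Union>\<F>"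
      using C unfolding compactin_def by meson
    obtain C0 where C0: "finite C0" "C0 \<subseteq> C" "\<F> = (\<lambda>\<phi>. fst (p \<phi>)) ` C0"
      using finite_subset_image[OF \<F>(1,2)] by blast
    have "\<exists>\<gamma>\<in>W. \<forall>\<alpha>\<in>(\<lambda>\<phi>. snd (p \<phi>)) ` C0. (\<alpha>, \<gamma>) \<in> R"
      by (rule bound) (use C0 p in \<open>auto intro: countable_finite\<close>)
    then obtain \<gamma> where \<gamma>: "\<gamma> \<in> W" "\<forall>\<phi>\<in>C0. (snd (p \<phi>), \<gamma>) \<in> R" by blast
    obtain \<phi> where "\<phi> \<in> C0" "ch \<gamma> \<in> fst (p \<phi>)" using ch[of \<gamma>] \<F>(3) C0(3) by blast
    then show False using p \<gamma> C0(2) by blast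
  qed

  \<comment> \<open>Stabilisation modulo the box of the cluster point\<close>
  have \<phi>X: "\<phi> \<in> characters GG GTop" using \<phi> Cc by blast
  obtain N0 where N0: "openin GTop N0" "\<one>\<^bsub>GG\<^esub> \<in> N0" "\<forall>x\<in>N0. \<phi> x = 1"
    using \<phi>X S.characters_trivial_near_one by blast
  then have "\<one>\<^bsub>DD\<^esub> \<in> N0" by simp
  from basic_base_G[OF N0(1) this] obtain N' where N': "basic N'" "PiE I N' \<inter> G \<subseteq> N0" by blast
  have \<phi>1: "\<phi> x = 1" if "x \<in> PiE I N'" "x \<in> G" for x using N0(3) N'(2) that by blast
  let ?J = "{i\<in>I. N' i \<noteq> carrier (D i)}"
  \<comment> \<open>Only the countably many coordinates restricted by \<open>N'\<close> can
    obstruct, and each does so at countably many stages; hence all bad stages precede some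
    \<open>\<alpha>0\<close>.\<close>
  let ?Bad = "\<Union>i\<in>?J. {\<alpha>\<in>W. \<forall>n\<in>N' i. quo i n (pt \<alpha> i) \<notin> N \<alpha> i}"
  have "countable ?Bad"
  proof (intro countable_UN basic_countable[OF N'(1)])
    fix i assume "i \<in> ?J"
    then have i: "i \<in> I" by blast
    show "countable {\<alpha>\<in>W. \<forall>n\<in>N' i. quo i n (pt \<alpha> i) \<notin> N \<alpha> i}"
    proof (rule topological_abelian_group.countable_drops[OF factor_group[OF i] R(1,2), of "\<lambda>\<alpha>. N \<alpha> i" "\<lambda>\<alpha>. pt \<alpha> i"])
      show "subgroup (N \<alpha> i) (D i)" for \<alpha> by (rule basic_subgroup[OF N i])
      show "N \<alpha> i = carrier (D i) \<or> compactin (T i) (N \<alpha> i)" for \<alpha> using basic_compactin[OF N i] by blast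
      show "pt \<alpha> i \<in> carrier (D i)" for \<alpha> by (rule G_coord[OF pt i])
      show "pt \<alpha> i \<in> N \<beta> i" if "(\<beta>, \<alpha>) \<in> R" for \<alpha> \<beta> by (rule box_coord[OF pt_N[OF that] i])
      show "good i (N' i)" by (rule basic_good[OF N'(1) i])
    qed
  qed
  then have "\<exists>\<gamma>\<in>W. \<forall>\<alpha>\<in>?Bad. (\<alpha>, \<gamma>) \<in> R" by (rule bound) blast
  then obtain \<alpha>0 where \<alpha>0: "\<alpha>0 \<in> W" "\<forall>\<alpha>\<in>?Bad. (\<alpha>, \<alpha>0) \<in> R" by (rule bexE)

  \<comment> \<open>Moving the points into \<open>N'\<close>\<close>
  let ?W0 = "{\<alpha>\<in>W. (\<alpha>0, \<alpha>) \<in> R}"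
  have adjust: "\<exists>x. x \<in> G \<and> x \<in> PiE I N' \<and> near (N \<alpha>) x (pt \<alpha>)" if \<alpha>: "\<alpha> \<in> ?W0" for \<alpha>
  proof -
    have "\<alpha> \<notin> ?Bad"
    proof
      assume "\<alpha> \<in> ?Bad"
      then have "(\<alpha>, \<alpha>0) \<in> R" using \<alpha>0(2) by blast
      moreover have "(\<alpha>0, \<alpha>) \<in> R" using \<alpha> by blast
      ultimately show False using wf_not_sym[OF R(1)] by blast
    qed
    then have good: "\<exists>n\<in>N' i. quo i n (pt \<alpha> i) \<in> N \<alpha> i" if "i \<in> ?J" for i
      using that \<alpha> by blast
    \<comment> \<open>Where \<open>N'\<close> restricts, the stage is not bad; where only
      \<open>N \<alpha>\<close> restricts, the coordinate of \<open>pt \<alpha>\<close> is kept;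
      where neither does, the identity is taken. The last choice makes the support countable, so the
      new point lies in \<open>G\<close>.\<close>
    have "\<forall>i\<in>I. \<exists>n. n \<in> N' i \<and> quo i n (pt \<alpha> i) \<in> N \<alpha> i \<and>
       (N' i = carrier (D i) \<and> N \<alpha> i = carrier (D i) \<longrightarrow> n = \<one>\<^bsub>D i\<^esub>)"
    proof
      fix i assume i: "i \<in> I"
      interpret Di: topological_abelian_group "D i" "T i" by (rule factor_group[OF i])
      have p: "pt \<alpha> i \<in> carrier (D i)" by (rule G_coord[OF pt i])
      consider "i \<in> ?J" | "N' i = carrier (D i)" "N \<alpha> i = carrier (D i)"
        | "N' i = carrier (D i)" "N \<alpha> i \<noteq> carrier (D i)" using i by blast
      then show "\<exists>n. n \<in> N' i \<and> quo i n (pt \<alpha> i) \<in> N \<alpha> i \<and>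
         (N' i = carrier (D i) \<and> N \<alpha> i = carrier (D i) \<longrightarrow> n = \<one>\<^bsub>D i\<^esub>)"
      proof cases
        case 1
        then show ?thesis using good[OF 1] by blast
      next
        case 2
        then show ?thesis using p by (intro exI[of _ "\<one>\<^bsub>D i\<^esub>"]) simp
      next
        case 3
        have "quo i (pt \<alpha> i) (pt \<alpha> i) \<in> N \<alpha> i"
          using p subgroup.one_closed[OF basic_subgroup[OF N i]] by simp
        then show ?thesis using p 3 by (intro exI[of _ "pt \<alpha> i"]) simp
      qed
    qed
    from bchoice[OF this] obtain n where n: "\<forall>i\<in>I. n i \<in> N' i \<and> quo i (n i) (pt \<alpha> i) \<in> N \<alpha> i \<and>
       (N' i = carrier (D i) \<and> N \<alpha> i = carrier (D i) \<longrightarrow> n i = \<one>\<^bsub>D i\<^esub>)" by (rule exE)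
    let ?n = "restrict n I"
    have nN: "?n \<in> PiE I N'" using n by auto
    have "supp I D ?n \<subseteq> ?J \<union> {i\<in>I. N \<alpha> i \<noteq> carrier (D i)}"
    proof
      fix i assume "i \<in> supp I D ?n"
      then have "i \<in> I" "n i \<noteq> \<one>\<^bsub>D i\<^esub>" by (auto simp: supp_def)
      then show "i \<in> ?J \<union> {i\<in>I. N \<alpha> i \<noteq> carrier (D i)}" using n by blast
    qed
    moreover have "countable (?J \<union> {i\<in>I. N \<alpha> i \<noteq> carrier (D i)})"
      by (intro countable_Un basic_countable N N'(1))
    ultimately have "countable (supp I D ?n)" by (rule countable_subset)
    then have "?n \<in> Sigma_aleph1 I D"
      by (rule Sigma_aleph1_countableI[rotated]) (rule subgroup.mem_carrier[OF box_subgroup[OF N'(1)] nN])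
    moreover have "near (N \<alpha>) ?n (pt \<alpha>)" unfolding near_def using n by simp
    ultimately show ?thesis using Sigma_sub nN by blast
  qed
  then have "\<forall>\<alpha>\<in>?W0. \<exists>x. x \<in> G \<and> x \<in> PiE I N' \<and> near (N \<alpha>) x (pt \<alpha>)" by (rule ballI)
  from bchoice[OF this] obtain q where q: "\<forall>\<alpha>\<in>?W0. q \<alpha> \<in> G \<and> q \<alpha> \<in> PiE I N' \<and> near (N \<alpha>) (q \<alpha>) (pt \<alpha>)"
    by (rule exE)
  have qG: "q \<alpha> \<in> G" and qN': "q \<alpha> \<in> PiE I N'" and q_near: "near (N \<alpha>) (q \<alpha>) (pt \<alpha>)" if "\<alpha> \<in> ?W0" for \<alpha>
    using bspec[OF q that] by simp_all
  have q_far: "1 \<le> dist (ch \<alpha> (q \<alpha>)) 1" if "\<alpha> \<in> ?W0" for \<alpha>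
    using near_eq[OF N q_near[OF that] qG[OF that] pt chX ch1] far[of \<alpha>] by simp
  have q_N: "q \<alpha> \<in> PiE I (N \<beta>)" if "\<alpha> \<in> ?W0" "(\<beta>, \<alpha>) \<in> R" for \<alpha> \<beta>
  proof (rule near_box[OF N _ G_carrier[OF qG[OF that(1)]] pt_N[OF that(2)]])
    show "near (N \<beta>) (q \<alpha>) (pt \<alpha>)"
      using q_near[OF that(1)] N_dec[OF that(2)] unfolding near_def by blast
  qed

  \<comment> \<open>Limits of coherent families inside \<open>N'\<close>\<close>
  have meet: "\<exists>v. v \<in> G \<and> v \<in> PiE I N' \<and> (\<forall>\<beta>\<in>A. near (N \<beta>) v (z \<beta>))"
    if A: "A \<subseteq> ?W0" and z: "\<And>\<beta>. \<beta> \<in> A \<Longrightarrow> z \<beta> \<in> G \<and> z \<beta> \<in> PiE I N'"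
      and zz: "\<And>\<beta> \<beta>'. \<beta> \<in> A \<Longrightarrow> \<beta>' \<in> A \<Longrightarrow> (\<beta>', \<beta>) \<in> R \<Longrightarrow> near (N \<beta>') (z \<beta>) (z \<beta>')" for A z
  proof (cases "A = {}")
    case True
    then show ?thesis
      using subgroup.one_closed[OF box_G_subgroup[OF N'(1)]] by (intro exI[of _ "\<one>\<^bsub>DD\<^esub>"]) simp
  next
    case False
    \<comment> \<open>Working modulo the intersections with \<open>N' i\<close> makes the limit
      congruent to members of \<open>N'\<close>, hence itself a member. This needs at least one
      member, which is why the empty family is treated separately.\<close>
    have "\<exists>v\<in>Sigma_aleph1 I D. \<forall>\<beta>\<in>A. \<forall>i\<in>I. quo i (v i) (z \<beta> i) \<in> N \<beta> i \<inter> N' i"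
    proof (rule product_cosets_meet)
      show "total_on A R" using R(2) A unfolding total_on_def by blast
      have "|A| \<le>o |W|" by (rule card_of_mono1) (use A in blast)
      then show "|A| \<le>o cardSuc natLeq" using W(2) ordLeq_transitive by blast
      show "subgroup (N \<alpha> i \<inter> N' i) (D i)" if "i \<in> I" for \<alpha> i
        by (intro subgroup_Int basic_subgroup[OF N that] basic_subgroup[OF N'(1) that])
      show "N \<alpha> i \<inter> N' i = carrier (D i) \<or> compactin (T i) (N \<alpha> i \<inter> N' i)" if i: "i \<in> I" for \<alpha> i
      proof -
        have H: "Hausdorff_space (T i)" by (rule topological_abelian_group.Hausdorff[OF factor_group[OF i]])
        have s: "N \<alpha> i \<subseteq> carrier (D i)" "N' i \<subseteq> carrier (D i)"
          using subgroup.subset basic_subgroup[OF N i] basic_subgroup[OF N'(1) i] by blast+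
        consider "N \<alpha> i = carrier (D i)" "N' i = carrier (D i)"
          | "N \<alpha> i \<noteq> carrier (D i)" "N' i = carrier (D i)"
          | "N \<alpha> i = carrier (D i)" "N' i \<noteq> carrier (D i)"
          | "N \<alpha> i \<noteq> carrier (D i)" "N' i \<noteq> carrier (D i)" by blast
        then show ?thesis
        proof cases
          case 1
          then show ?thesis by simp
        next
          case 2
          then have "N \<alpha> i \<inter> N' i = N \<alpha> i" using s by blast
          then show ?thesis using basic_compactin[OF N i 2(1)] by simp
        next
          case 3
          then have "N \<alpha> i \<inter> N' i = N' i" using s by blast
          then show ?thesis using basic_compactin[OF N'(1) i 3(2)] by simp
        next
          case 4
          have "compactin (T i) (N \<alpha> i \<inter> N' i)"
            by (rule compact_Int_closedin[OF basic_compactin[OF N i 4(1)]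
                  compactin_imp_closedin[OF H basic_compactin[OF N'(1) i 4(2)]]])
          then show ?thesis ..
        qed
      qed
      show "countable {i\<in>I. N \<alpha> i \<inter> N' i \<noteq> carrier (D i)}" for \<alpha>
        by (rule countable_subset[OF _ countable_Un[OF basic_countable[OF N[of \<alpha>]] basic_countable[OF N'(1)]]]) blast
      show "z \<alpha> \<in> carrier DD" if "\<alpha> \<in> A" for \<alpha> using z[OF that] G_carrier by blast
      show "N \<alpha> i \<inter> N' i \<subseteq> N \<beta> i \<inter> N' i \<and> quo i (z \<alpha> i) (z \<beta> i) \<in> N \<beta> i \<inter> N' i"
        if "\<alpha> \<in> A" "\<beta> \<in> A" "(\<beta>, \<alpha>) \<in> R" "i \<in> I" for \<alpha> \<beta> i
      proof -
        have "z \<alpha> i \<in> N' i" "z \<beta> i \<in> N' i" using z that box_coord by blast+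
        then have "quo i (z \<alpha> i) (z \<beta> i) \<in> N' i"
          using basic_subgroup[OF N'(1) that(4)] subgroup.m_closed subgroup.m_inv_closed by metis
        then show ?thesis using nearD[OF zz[OF that(1-3)] that(4)] N_dec[OF that(3,4)] by blast
      qed
    qed
    then obtain v where v: "v \<in> Sigma_aleph1 I D"
      "\<forall>\<beta>\<in>A. \<forall>i\<in>I. quo i (v i) (z \<beta> i) \<in> N \<beta> i \<inter> N' i" by blast
    obtain \<beta> where \<beta>: "\<beta> \<in> A" using False by blast
    have vG: "v \<in> G" using v(1) Sigma_sub by blast
    have "near N' v (z \<beta>)" unfolding near_def using v(2) \<beta> by blast
    then have "v \<in> PiE I N'" using z[OF \<beta>] by (intro near_box[OF N'(1) _ G_carrier[OF vG]]) auto
    moreover have "\<forall>\<beta>\<in>A. near (N \<beta>) v (z \<beta>)" unfolding near_def using v(2) by blast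
    ultimately show ?thesis using vG by blast
  qed

  \<comment> \<open>Partial products with values away from 1\<close>
  define P where "P = (\<lambda>(g :: nat set \<Rightarrow> 'i \<Rightarrow> 'a) \<alpha> z. \<alpha> \<in> ?W0 \<longrightarrow> z \<in> G \<and> z \<in> PiE I N' \<and>
      (\<forall>\<beta>\<in>?W0. (\<beta>, \<alpha>) \<in> R \<longrightarrow> near (N \<beta>) z (g \<beta>)) \<and> 1/2 \<le> dist (ch \<alpha> z) 1)"
  \<comment> \<open>Later values agree with \<open>g \<beta>\<close> modulo
    \<open>N \<beta>\<close>, on which \<open>ch \<beta>\<close> is trivial, so the distance
    achieved at stage \<beta> is never lost.\<close>
  have "\<exists>g. \<forall>\<alpha>. P g \<alpha> (g \<alpha>)"
  proof (rule dependent_wf_choice[OF R(1)])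
    show "P f \<alpha> v = P g \<alpha> v" if "\<And>\<beta>. (\<beta>, \<alpha>) \<in> R \<Longrightarrow> f \<beta> = g \<beta>" for f g \<alpha> v
      unfolding P_def using that by auto
    fix \<alpha> g assume IH: "\<And>\<beta>. (\<beta>, \<alpha>) \<in> R \<Longrightarrow> P g \<beta> (g \<beta>)"
    show "\<exists>z. P g \<alpha> z"
    proof (cases "\<alpha> \<in> ?W0")
      case False
      then show ?thesis unfolding P_def by blast
    next
      case \<alpha>: True
      let ?A = "{\<beta>\<in>?W0. (\<beta>, \<alpha>) \<in> R}"
      have "\<exists>v. v \<in> G \<and> v \<in> PiE I N' \<and> (\<forall>\<beta>\<in>?A. near (N \<beta>) v (g \<beta>))"
      proof (rule meet)
        show "?A \<subseteq> ?W0" by blast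
        show "g \<beta> \<in> G \<and> g \<beta> \<in> PiE I N'" if "\<beta> \<in> ?A" for \<beta>
          using IH[of \<beta>] that unfolding P_def by blast
        show "near (N \<beta>') (g \<beta>) (g \<beta>')" if "\<beta> \<in> ?A" "\<beta>' \<in> ?A" "(\<beta>', \<beta>) \<in> R" for \<beta> \<beta>'
          using IH[of \<beta>] that unfolding P_def by blast
      qed
      then obtain v where v: "v \<in> G" "v \<in> PiE I N'" "\<forall>\<beta>\<in>?A. near (N \<beta>) v (g \<beta>)" by blast
      show ?thesis
      \<comment> \<open>Keep the limit \<open>v\<close> of the earlier stages if it is already far
        from 1. Otherwise multiply by \<open>q \<alpha>\<close>: its value is at distance at least
        1, so that of the product is at distance at least 1/2. Earlier congruences survive because
        \<open>q \<alpha>\<close> lies in all earlier boxes.\<close>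
      proof (cases "1/2 \<le> dist (ch \<alpha> v) 1")
        case True
        then have "P g \<alpha> v" unfolding P_def using v by blast
        then show ?thesis by (rule exI[of "P g \<alpha>" v])
      next
        case False
        let ?z = "v \<otimes>\<^bsub>DD\<^esub> q \<alpha>"
        have zG: "?z \<in> G" by (rule subgroup.m_closed[OF G_subgroup v(1) qG[OF \<alpha>]])
        have zN: "?z \<in> PiE I N'" by (rule subgroup.m_closed[OF box_subgroup[OF N'(1)] v(2) qN'[OF \<alpha>]])
        have near: "near (N \<beta>) ?z (g \<beta>)" if \<beta>: "\<beta> \<in> ?W0" "(\<beta>, \<alpha>) \<in> R" for \<beta>
          unfolding near_def
        proof
          fix i assume i: "i \<in> I"
          interpret Di: topological_abelian_group "D i" "T i" by (rule factor_group[OF i])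
          have gG: "g \<beta> \<in> G" using IH[OF \<beta>(2)] \<beta>(1) unfolding P_def by blast
          have c: "v i \<in> carrier (D i)" "q \<alpha> i \<in> carrier (D i)" "g \<beta> i \<in> carrier (D i)"
            using G_coord[OF _ i] v(1) qG[OF \<alpha>] gG by auto
          have "quo i (v i) (g \<beta> i) \<in> N \<beta> i" using v(3) \<beta> nearD[OF _ i] by blast
          then have "quo i (v i) (g \<beta> i) \<otimes>\<^bsub>D i\<^esub> q \<alpha> i \<in> N \<beta> i"
            using box_coord[OF q_N[OF \<alpha> \<beta>(2)] i] by (rule subgroup.m_closed[OF basic_subgroup[OF N i]])
          then show "quo i (?z i) (g \<beta> i) \<in> N \<beta> i"
            using i c by (simp add: Di.m_ac)
        qed
        have "1/2 \<le> dist (ch \<alpha> ?z) 1"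
        proof -
          have m: "ch \<alpha> ?z = ch \<alpha> v * ch \<alpha> (q \<alpha>)"
            using S.hom_circle_mult[OF S.X_hom[OF chX], of v "q \<alpha>" \<alpha>] v(1) qG[OF \<alpha>] by simp
          have nv: "norm (ch \<alpha> v) = 1" using S.X_norm[OF chX, of v \<alpha>] v(1) by simp
          have "dist (ch \<alpha> (q \<alpha>)) 1 = norm (ch \<alpha> v * (ch \<alpha> (q \<alpha>) - 1))"
            by (simp add: norm_mult nv dist_norm)
          also have "ch \<alpha> v * (ch \<alpha> (q \<alpha>) - 1) = (ch \<alpha> ?z - 1) - (ch \<alpha> v - 1)"
            unfolding m by (simp add: algebra_simps)
          also have "norm \<dots> \<le> dist (ch \<alpha> ?z) 1 + dist (ch \<alpha> v) 1"
            unfolding dist_norm by (rule norm_triangle_ineq4)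
          finally show ?thesis using q_far[OF \<alpha>] False by linarith
        qed
        then have "P g \<alpha> ?z" unfolding P_def using zG zN near by blast
        then show ?thesis by (rule exI[of "P g \<alpha>" ?z])
      qed
    qed
  qed
  then obtain g where g: "\<forall>\<alpha>. P g \<alpha> (g \<alpha>)" by (rule exE)
  have gP: "g \<alpha> \<in> G \<and> g \<alpha> \<in> PiE I N' \<and> (\<forall>\<beta>\<in>?W0. (\<beta>, \<alpha>) \<in> R \<longrightarrow> near (N \<beta>) (g \<alpha>) (g \<beta>)) \<and>
      1/2 \<le> dist (ch \<alpha> (g \<alpha>)) 1" if "\<alpha> \<in> ?W0" for \<alpha>
    using g[THEN spec, of \<alpha>] that unfolding P_def by (rule mp)

  \<comment> \<open>The final point and the contradiction\<close>
  have "\<exists>v. v \<in> G \<and> v \<in> PiE I N' \<and> (\<forall>\<beta>\<in>?W0. near (N \<beta>) v (g \<beta>))"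
  proof (rule meet)
    show "g \<beta> \<in> G \<and> g \<beta> \<in> PiE I N'" if "\<beta> \<in> ?W0" for \<beta> using gP[OF that] by blast
    show "near (N \<beta>') (g \<beta>) (g \<beta>')" if "\<beta> \<in> ?W0" "\<beta>' \<in> ?W0" "(\<beta>', \<beta>) \<in> R" for \<beta> \<beta>'
      using gP[OF that(1)] that(2,3) by blast
  qed blast
  then obtain y where y: "y \<in> G" "y \<in> PiE I N'" "\<forall>\<beta>\<in>?W0. near (N \<beta>) y (g \<beta>)" by blast
  \<comment> \<open>Since \<phi> is 1 at \<open>y\<close>, this is a neighbourhood of \<phi> and
    must contain some \<open>ch \<gamma>\<close> beyond \<open>\<alpha>0\<close>; but
    \<open>ch \<gamma>\<close> has the same value at \<open>y\<close> as at
    \<open>g \<gamma>\<close>, at distance at least 1/2 from 1.\<close>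
  let ?Q = "{\<psi> \<in> topspace S.dualT. evaluation GG GTop y \<psi> \<in> sphere 0 1 \<inter> ball 1 (1/2)}"
  have "evaluation GG GTop y \<in> S.bidual" using S.evaluation_in_bidual[of y] y(1) by simp
  then have "continuous_map S.dualT circle_topology (evaluation GG GTop y)"
    by (simp add: characters_iff)
  then have Q: "openin S.dualT ?Q"
    by (rule openin_continuous_map_preimage) (auto simp: circle_topology_def openin_open)
  have "\<phi> \<in> ?Q" using \<phi>X \<phi>1[OF y(2,1)] y(1) by (simp add: evaluation_def)
  from cluster[OF Q this \<alpha>0(1)] obtain \<gamma> where \<gamma>: "\<gamma> \<in> ?W0" "ch \<gamma> \<in> ?Q" by blast
  have "ch \<gamma> y = ch \<gamma> (g \<gamma>)"
    by (rule near_eq[OF N _ y(1) _ chX ch1]) (use y(3) gP[OF \<gamma>(1)] \<gamma>(1) in blast)+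
  moreover have "dist (ch \<gamma> y) 1 < 1/2"
    using \<gamma>(2) y(1) chX[of \<gamma>] by (simp add: evaluation_def dist_commute)
  ultimately show False using gP[OF \<gamma>(1)] by simp
qed

theorem reflexive_intermediate: "reflexive GG GTop"
  by (rule S.reflexive_if_compact_equicontinuous[OF compact_equicontinuous])

end

theorem theorem6:
  fixes I :: "'i set"
    and D :: "'i \<Rightarrow> ('a, 'b) monoid_scheme"
    and T :: "'i \<Rightarrow> 'a topology"
  assumes "\<And>i. i \<in> I \<Longrightarrow> topological_abelian_group (D i) (T i)"
    and "\<And>i. i \<in> I \<Longrightarrow> feathered (T i)"
  shows "subgroup (Sigma_aleph1 I D) (product_group I D) \<and>
    reflexive ((product_group I D)\<lparr>carrier := Sigma_aleph1 I D\<rparr>)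
              (subtopology (P_modification (product_topology T I)) (Sigma_aleph1 I D)) \<and>
    (\<forall>G. subgroup G (product_group I D) \<and> Sigma_aleph1 I D \<subseteq> G \<longrightarrow>
       reflexive ((product_group I D)\<lparr>carrier := G\<rparr>) (subtopology (P_modification (product_topology T I)) G))"
proof -
  interpret feathered_product I D T by (rule feathered_product.intro[OF assms])
  have refl: "reflexive ((product_group I D)\<lparr>carrier := G\<rparr>) (subtopology (P_modification (product_topology T I)) G)"
    if "subgroup G (product_group I D)" "Sigma_aleph1 I D \<subseteq> G" for G
  proof -
    interpret intermediate_subgroup I D T G 
      by (intro intermediate_subgroup.intro intermediate_subgroup_axioms.intro feathered_product_axioms that)
    show ?thesis by (rule reflexive_intermediate)
  qed
  show ?thesis using subgroup_Sigma_aleph1 refl by blast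
qed

end
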